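(* Let $\mathfrak H_1,\mathfrak H_2$ be Hilbert spaces, let $A\in[\mathfrak H_1]$ be selfadjoint, $B\in[\mathfrak H_1,\mathfrak H_2]$, $J_2=J_2^*=J_2^{-1}\in[\mathfrak H_2]$, and assume that $\nu_-(A),\nu_-(J_2)<\infty$. If the equality $$\nu_-(A)=\nu_-(A-B^*J_2B)+\nu_-(J_2)\qquad(\mathrm{E})$$ holds, then $\operatorname{ran}B^*\subset\operatorname{ran}|A|^{1/2}$ and $B^*=|A|^{1/2}K$ for a unique operator $K\in[\mathfrak H_2,\mathfrak H_A]$, and this $K$ is $J$-contractive: $J_2-K^*J_AK\ge0$. Conversely, if $B^*=|A|^{1/2}K$ for some $J$-contractive operator $K\in[\mathfrak H_2,\overline{\operatorname{ran}}A]$ (i.e. $J_2-K^*J_AK\ge 0$), then the equality $(\mathrm{E})$ is satisfied.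
   Context: $[\mathfrak H,\mathfrak K]$ denotes the bounded everywhere defined linear operators from $\mathfrak H$ to $\mathfrak K$, $[\mathfrak H]=[\mathfrak H,\mathfrak H]$. For a bounded selfadjoint $X$, $\nu_-(X)\in\{0,1,\dots\}\cup\{\infty\}$ is the dimension of its spectral subspace for $(-\infty,0)$, and $|X|=(X^2)^{1/2}$. With the polar decomposition $A=J_A|A|$, the operator $J_A=\operatorname{sgn}(A)$ is a symmetry (selfadjoint and unitary) on $\overline{\operatorname{ran}}A$ and $\mathfrak H_A=(\overline{\operatorname{ran}}A,J_A)$ is the Kreĭn space on $\overline{\operatorname{ran}}A$ with fundamental symmetry $J_A$. All adjoints are Hilbert space adjoints. *)

theory Defs
  imports "HOL-Analysis.Analysis"
begin

section \<open>Complex Hilbert spaces\<close>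

text \<open>
  The real inner product inherited from \<^class>\<open>real_inner\<close> (which fixes norm and topology) is
  required to be the real part of the complex one. The complex inner product is linear in its
  first argument. Completeness is \<^class>\<open>complete_space\<close>; separability is not assumed, and the
  zero space is allowed.
\<close>

class complex_inner = real_inner +
  fixes scaleC :: "complex \<Rightarrow> 'a \<Rightarrow> 'a" (infixr "*\<^sub>C" 75)
    and cinner :: "'a \<Rightarrow> 'a \<Rightarrow> complex"
  assumes scaleC_add_right: "a *\<^sub>C (x + y) = a *\<^sub>C x + a *\<^sub>C y"
    and scaleC_add_left: "(a + b) *\<^sub>C x = a *\<^sub>C x + b *\<^sub>C x"
    and scaleC_scaleC: "a *\<^sub>C b *\<^sub>C x = (a * b) *\<^sub>C x"
    and scaleC_of_real: "complex_of_real r *\<^sub>C x = r *\<^sub>R x"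
    and cinner_commute: "cinner x y = cnj (cinner y x)"
    and cinner_add_left: "cinner (x + y) z = cinner x z + cinner y z"
    and cinner_scaleC_left: "cinner (a *\<^sub>C x) y = a * cinner x y"
    and Re_cinner: "Re (cinner x y) = inner x y"

class chilbert_space = complex_inner + complete_space

instantiation complex :: chilbert_space
begin
definition scaleC_complex :: "complex \<Rightarrow> complex \<Rightarrow> complex" where
  "scaleC_complex a x = a * x"
definition cinner_complex :: "complex \<Rightarrow> complex \<Rightarrow> complex" where
  "cinner_complex x y = x * cnj y"
instance
  by standard
    (auto simp: scaleC_complex_def cinner_complex_def algebra_simps inner_complex_def scaleR_conv_of_real)
end

lemma scaleC_one: "1 *\<^sub>C x = (x :: 'a :: complex_inner)"
  using scaleC_of_real[of 1 x] by simp

global_interpretation complex_vector: vector_space "scaleC :: complex \<Rightarrow> 'a \<Rightarrow> 'a :: complex_inner"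
  by unfold_locales (simp_all add: scaleC_add_right scaleC_add_left scaleC_scaleC scaleC_one)

text \<open>
  The dimension of a complex subspace with values in \<open>{0, 1, \<dots>} \<union> {\<infinity>}\<close>. The library's \<open>dim\<close> is
  \<open>0\<close> on infinite-dimensional subspaces, hence the case distinction.
\<close>

definition cdimension :: "'a :: complex_inner set \<Rightarrow> enat" where
  "cdimension V =
    (if \<exists>b. finite b \<and> complex_vector.span b = V then enat (complex_vector.dim V) else \<infinity>)"


section \<open>Bounded operators\<close>

definition bounded_clinear :: "('a :: complex_inner \<Rightarrow> 'b :: complex_inner) \<Rightarrow> bool" where
  "bounded_clinear T \<longleftrightarrow> bounded_linear T \<and> (\<forall>a x. T (a *\<^sub>C x) = a *\<^sub>C T x)"

definition cadjoint :: "('a :: complex_inner \<Rightarrow> 'b :: complex_inner) \<Rightarrow> 'b \<Rightarrow> 'a" where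
  "cadjoint T = (THE S. \<forall>x y. cinner (T x) y = cinner x (S y))"

definition selfadjoint :: "('a :: complex_inner \<Rightarrow> 'a) \<Rightarrow> bool" where
  "selfadjoint T \<longleftrightarrow> bounded_clinear T \<and> cadjoint T = T"

definition nonneg_op :: "('a :: complex_inner \<Rightarrow> 'a) \<Rightarrow> bool" where
  "nonneg_op T \<longleftrightarrow> bounded_clinear T \<and> (\<forall>x. cinner (T x) x \<in> \<real>\<^sub>\<ge>\<^sub>0)"

definition op_sqrt :: "('a :: complex_inner \<Rightarrow> 'a) \<Rightarrow> 'a \<Rightarrow> 'a" where
  "op_sqrt T = (THE R. nonneg_op R \<and> R \<circ> R = T)"

definition abs_op :: "('a :: complex_inner \<Rightarrow> 'a) \<Rightarrow> 'a \<Rightarrow> 'a" where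
  "abs_op X = op_sqrt (X \<circ> X)"

text \<open>
  The partially isometric factor \<open>J\<^sub>A\<close> in the polar decomposition \<open>A = J\<^sub>A |A|\<close> of a selfadjoint
  operator, extended by \<open>0\<close> from the closure of the range of \<open>A\<close> to the whole space.
\<close>

definition sgn_op :: "('a :: complex_inner \<Rightarrow> 'a) \<Rightarrow> 'a \<Rightarrow> 'a" where
  "sgn_op A = (THE J. bounded_clinear J \<and> J \<circ> abs_op A = A \<and>
    (\<forall>x. (\<forall>y\<in>range A. cinner x y = 0) \<longrightarrow> J x = 0))"

text \<open>
  The bounded operators into a closed subspace \<open>M\<close>. Regarded as operators into the whole space,
  they have an adjoint whose restriction to \<open>M\<close> is the adjoint of the operator into \<open>M\<close>.
\<close>

definition bounded_ops_into :: "'b :: complex_inner set \<Rightarrow> ('a :: complex_inner \<Rightarrow> 'b) set" where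
  "bounded_ops_into M = {K. bounded_clinear K \<and> range K \<subseteq> M}"


section \<open>Spectral subspaces and the number of negative squares\<close>

definition orth_projection :: "('a :: complex_inner \<Rightarrow> 'a) \<Rightarrow> bool" where
  "orth_projection P \<longleftrightarrow> selfadjoint P \<and> P \<circ> P = P"

text \<open>The scalar measure \<open>S \<mapsto> \<langle>E(S) x, x\<rangle>\<close> on the Borel sets of the real line.\<close>

definition scalar_measure :: "(real set \<Rightarrow> 'a :: complex_inner \<Rightarrow> 'a) \<Rightarrow> 'a \<Rightarrow> real measure" where
  "scalar_measure E x = measure_of UNIV (sets borel) (\<lambda>S. ennreal (Re (cinner (E S x) x)))"

text \<open>
  \<open>E\<close> is a projection-valued measure with \<open>X = \<integral> t dE(t)\<close>. By polarization, the latter identity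
  may be stated for the quadratic forms.
\<close>

definition is_spectral_measure ::
    "('a :: complex_inner \<Rightarrow> 'a) \<Rightarrow> (real set \<Rightarrow> 'a \<Rightarrow> 'a) \<Rightarrow> bool" where
  "is_spectral_measure X E \<longleftrightarrow>
    (\<forall>S\<in>sets borel. orth_projection (E S)) \<and>
    E UNIV = id \<and>
    (\<forall>S\<in>sets borel. \<forall>T\<in>sets borel. E (S \<inter> T) = E S \<circ> E T) \<and>
    (\<forall>F :: nat \<Rightarrow> real set. range F \<subseteq> sets borel \<longrightarrow> disjoint_family F \<longrightarrow>
      (\<forall>x. (\<lambda>n. E (F n) x) sums E (\<Union>n. F n) x)) \<and>
    (\<forall>x. integrable (scalar_measure E x) (\<lambda>t. t) \<and>
      cinner (X x) x = complex_of_real (\<integral>t. t \<partial>scalar_measure E x))"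

text \<open>
  For selfadjoint \<open>X\<close> the spectral measure is unique on the Borel sets, but its values on other
  sets are arbitrary: hence \<open>SOME\<close> rather than \<open>THE\<close>.
\<close>

definition spectral_subspace :: "('a :: complex_inner \<Rightarrow> 'a) \<Rightarrow> real set \<Rightarrow> 'a set" where
  "spectral_subspace X S = range ((SOME E. is_spectral_measure X E) S)"

definition nu_minus :: "('a :: complex_inner \<Rightarrow> 'a) \<Rightarrow> enat" where
  "nu_minus X = cdimension (spectral_subspace X {..<0})"

end

(*
  Equality (E) compares the two ways of counting the negative squares of the block operator with
  rows [A, B*] and [B, J_2], through its quadratic form q on H_1 x H_2. Completing the square in
  the second variable gives nu_-(A - B* J_2 B) + nu_-(J_2). If B* = |A|^(1/2) K, completing the
  square in the first variable gives q(x, y) = [w, w] + <(J_2 - K* J_A K) y, y> with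
  w = |A|^(1/2) x + J_A K y and [w, w] = <J_A w, w>, so for a J-contractive K the number of
  negative squares is at most nu_-(A).
  Conversely, (E) makes the negative spectral subspace N of A a maximal q-negative subspace, so q is
  nonnegative on its q-orthogonal complement. This bounds |<x, B* y>| by a constant
  times ||y|| || |A|^(1/2) x ||, whence the factorization, and in the limit |A|^(1/2) x -> - J_A K y on the complement
  of N it becomes J-contractivity of K.
  Since nu_- is defined by an arbitrary spectral measure, the spectral theorem is needed: the
  spectral projections for half-lines are kernels of positive parts of A - t, and the
  measures of the remaining Borel sets come from the Lebesgue-Stieltjes measures of |E_t x|^2.
*)

theory Submission
  imports Defs "HOL-Probability.Distribution_Functions"
begin

section \<open>Operators on Hilbert spaces\<close>

text \<open>Finiteness of nu_-(A) is used analytically as well as for counting. On N, the range of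
  \<open>P\<close>, the operator \<open>R\<close> (the square root of |A|) is an injective map of a
  finite-dimensional space into itself, hence invertible and bounded below. So the q-orthogonality
  condition can be solved for the component in N, and the factorization bound holds on N directly.
  The number nu_-(A - B^* J_2 B), on the other hand, is not assumed finite; its finiteness has to be
  derived in both directions before dimensions can be added. All dimension comparisons follow one
  principle: if a form is negative on a subspace L and nonnegative on the kernel of a linear map,
  then the map is injective on L. Measure theory ends at \<open>splits_negative\<close>, the few
  properties of the projection for the negative half-line that the rest relies on. Likewise a single
  Riesz lemma, for functionals dominated by the norm of \<open>T x\<close>, yields adjoints,
  orthogonal projections, closures of ranges and the factorization through \<open>R\<close>.\<close>

lemma cinner_scaleC_right: "cinner x (a *\<^sub>C y) = cnj a * cinner (x :: 'a :: complex_inner) y"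
  by (metis cinner_commute cinner_scaleC_left complex_cnj_mult)

text \<open>The real inner product determines the complex one, so operator identities below are
  proved for \<open>inner\<close> and complex linearity supplies the imaginary part.\<close>

lemma cinner_eq_Complex:
  "cinner x y = Complex (inner x y) (inner (x :: 'a :: complex_inner) (\<i> *\<^sub>C y))"
proof -
  have "Re (cinner x (\<i> *\<^sub>C y)) = Im (cinner x y)"
    by (simp add: cinner_scaleC_right)
  then show ?thesis by (simp add: complex_eq_iff Re_cinner)
qed

lemma inner_scaleC_left:
  "inner (a *\<^sub>C x) y = inner (x :: 'a :: complex_inner) (cnj a *\<^sub>C y)"
  by (simp add: cinner_scaleC_left cinner_scaleC_right flip: Re_cinner)

lemma scaleC_i_i: "\<i> *\<^sub>C \<i> *\<^sub>C x = - (x :: 'a :: complex_inner)"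
  using scaleC_of_real[of "-1" x] by (simp add: scaleC_scaleC)

lemma scaleC_scaleR: "a *\<^sub>C r *\<^sub>R x = r *\<^sub>R a *\<^sub>C (x :: 'a :: complex_inner)"
  by (simp add: scaleC_scaleC mult.commute flip: scaleC_of_real)

lemma cinner_self: "cinner x x = complex_of_real ((norm (x :: 'a :: complex_inner))\<^sup>2)"
proof -
  have "Im (cinner x x) = 0"
    using arg_cong[OF cinner_commute[of x x], of Im] by simp
  then show ?thesis by (simp add: complex_eq_iff Re_cinner power2_norm_eq_inner)
qed

lemma norm_scaleC: "norm (a *\<^sub>C x) = cmod a * norm (x :: 'a :: complex_inner)"
proof -
  have "complex_of_real ((norm (a *\<^sub>C x))\<^sup>2) = complex_of_real ((cmod a * norm x)\<^sup>2)"
    unfolding cinner_self[symmetric] cinner_scaleC_left cinner_scaleC_right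
    by (simp add: cinner_self power_mult_distrib complex_norm_square mult.commute
        del: of_real_power)
  then have "(norm (a *\<^sub>C x))\<^sup>2 = (cmod a * norm x)\<^sup>2"
    using of_real_eq_iff by blast
  then show ?thesis by (simp add: power2_eq_iff_nonneg)
qed

lemma csubspace_imp_subspace:
  "complex_vector.subspace M \<Longrightarrow> subspace (M :: 'a :: complex_inner set)"
  unfolding complex_vector.subspace_def subspace_def by (metis scaleC_of_real)

lemma bounded_clinear_bounded_linear: "bounded_clinear T \<Longrightarrow> bounded_linear T"
  by (simp add: bounded_clinear_def)

lemma bounded_clinear_scaleC: "bounded_clinear T \<Longrightarrow> T (a *\<^sub>C x) = a *\<^sub>C T x"
  by (simp add: bounded_clinear_def)

lemma bounded_clinear_linear: "bounded_clinear T \<Longrightarrow> linear T"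
  by (simp add: bounded_clinear_bounded_linear bounded_linear.linear)

lemmas bounded_clinear_add = linear_add[OF bounded_clinear_linear]
  and bounded_clinear_diff = linear_diff[OF bounded_clinear_linear]
  and bounded_clinear_minus = linear_neg[OF bounded_clinear_linear]
  and bounded_clinear_zero = linear_0[OF bounded_clinear_linear]
  and bounded_clinear_scaleR = linear_scale[OF bounded_clinear_linear]

lemmas bounded_clinear_simps = bounded_clinear_add bounded_clinear_diff bounded_clinear_minus
  bounded_clinear_zero bounded_clinear_scaleR bounded_clinear_scaleC

lemma bounded_clinear_tendsto:
  assumes "bounded_clinear T" "(g \<longlongrightarrow> a) F"
  shows "((\<lambda>n. T (g n)) \<longlongrightarrow> T a) F"
  using assms bounded_clinear_bounded_linear bounded_linear.tendsto by blast

lemma bounded_clinearI: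
  assumes "\<And>x y. T (x + y) = T x + T y" "\<And>a x. T (a *\<^sub>C x) = a *\<^sub>C T x"
    "\<And>x. norm (T x) \<le> norm x * k"
  shows "bounded_clinear T"
  unfolding bounded_clinear_def
  using assms by (auto intro!: bounded_linear_intro simp flip: scaleC_of_real)

lemma bounded_clinear_ident: "bounded_clinear (\<lambda>x. x)"
  by (simp add: bounded_clinear_def bounded_linear_ident)

lemma bounded_clinear_zero_op: "bounded_clinear (\<lambda>x. 0)"
  by (simp add: bounded_clinear_def bounded_linear_zero)

lemma bounded_clinear_add_op:
  "bounded_clinear S \<Longrightarrow> bounded_clinear T \<Longrightarrow> bounded_clinear (\<lambda>x. S x + T x)"
  by (simp add: bounded_clinear_def bounded_linear_add scaleC_add_right)

lemma bounded_clinear_diff_op: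
  "bounded_clinear S \<Longrightarrow> bounded_clinear T \<Longrightarrow> bounded_clinear (\<lambda>x. S x - T x)"
  by (simp add: bounded_clinear_def bounded_linear_sub complex_vector.scale_right_diff_distrib)

lemma bounded_clinear_scaleR_op: "bounded_clinear T \<Longrightarrow> bounded_clinear (\<lambda>x. r *\<^sub>R T x)"
  by (simp add: bounded_clinear_def bounded_linear_const_scaleR scaleC_scaleR)

lemma bounded_clinear_compose:
  "bounded_clinear S \<Longrightarrow> bounded_clinear T \<Longrightarrow> bounded_clinear (\<lambda>x. S (T x))"
  by (simp add: bounded_clinear_def bounded_linear_compose)

lemmas bounded_clinear_intros = bounded_clinear_ident bounded_clinear_zero_op
  bounded_clinear_add_op bounded_clinear_diff_op bounded_clinear_scaleR_op

lemma bounded_clinear_bound: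
  assumes "bounded_clinear T"
  obtains k where "k > 0" "\<And>x. norm (T x) \<le> k * norm x"
  using bounded_linear.pos_bounded[OF bounded_clinear_bounded_linear[OF assms]]
  by (metis mult.commute)

lemma bounded_clinear_limit:
  assumes T: "\<And>n :: nat. bounded_clinear (T n)" and lim: "\<And>x. (\<lambda>n. T n x) \<longlonglongrightarrow> L x"
    and k: "\<And>n x. norm (T n x) \<le> norm x * k"
  shows "bounded_clinear (L :: 'a :: complex_inner \<Rightarrow> 'b :: complex_inner)"
proof (rule bounded_clinearI)
  show "L (x + y) = L x + L y" for x y
    using LIMSEQ_unique[OF lim[of "x + y"]] tendsto_add[OF lim[of x] lim[of y]]
    by (simp add: bounded_clinear_add[OF T])
  show "L (a *\<^sub>C x) = a *\<^sub>C L x" for a x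
  proof -
    have "bounded_linear (scaleC a :: 'b \<Rightarrow> 'b)"
      by (rule bounded_linear_intro[where K = "cmod a"])
        (simp_all add: scaleC_add_right scaleC_scaleR norm_scaleC)
    then have "(\<lambda>n. a *\<^sub>C T n x) \<longlonglongrightarrow> a *\<^sub>C L x"
      using lim bounded_linear.tendsto by blast
    then show ?thesis
      using LIMSEQ_unique[OF lim[of "a *\<^sub>C x"]] by (simp add: bounded_clinear_scaleC[OF T])
  qed
  show "norm (L x) \<le> norm x * k" for x
    using Lim_bounded[OF tendsto_norm[OF lim[of x]]] k by blast
qed

section \<open>Riesz representation and adjoints\<close>

lemma quadratic_nonneg_discriminant:
  fixes a b c :: real
  assumes "\<And>t. a + 2 * t * b + t\<^sup>2 * c \<ge> 0" and "c \<ge> 0"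
  shows "b\<^sup>2 \<le> a * c"
proof (cases "c = 0")
  case True
  have "b = 0"
  proof (rule ccontr)
    assume "b \<noteq> 0"
    \<comment> \<open>At this \<open>t\<close> the affine function \<open>a + 2 * t * b\<close>
      equals -1.\<close>
    then show False using assms(1)[of "- (a + 1) / (2 * b)"] True by (simp add: field_simps)
  qed
  then show ?thesis using True by simp
next
  case False
  then show ?thesis using assms(1)[of "- b / c"] assms(2)
    by (simp add: power2_eq_square field_simps)
qed

text \<open>The representing vector is the limit of \<open>T x\<^sub>n\<close> along a minimising sequence of
  \<open>\<parallel>T x\<parallel>\<^sup>2 - 2 f x\<close>.\<close>

lemma riesz_representation_range:
  fixes T :: "'a :: real_vector \<Rightarrow> 'b :: {real_inner, complete_space}" and f :: "'a \<Rightarrow> real"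
  assumes S: "subspace S" and T: "linear T" and f: "linear f"
    and bound: "\<And>x. x \<in> S \<Longrightarrow> \<bar>f x\<bar> \<le> c * norm (T x)"
  obtains z where "z \<in> closure (T ` S)" "\<And>x. x \<in> S \<Longrightarrow> f x = inner (T x) z"
proof -
  define g where "g = (\<lambda>x. (norm (T x))\<^sup>2 - 2 * f x)"
  have glow: "- c\<^sup>2 \<le> g x" if "x \<in> S" for x
  proof -
    have "0 \<le> (norm (T x) - c)\<^sup>2" by simp
    then show ?thesis using bound[OF that] by (simp add: g_def power2_diff mult.commute)
  qed
  define m where "m = Inf (g ` S)"
  have bdd: "bdd_below (g ` S)" using glow by (auto intro!: bdd_belowI)
  have ne: "S \<noteq> {}" using S subspace_0 by blast
  have m_le: "m \<le> g x" if "x \<in> S" for x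
    unfolding m_def using that bdd by (intro cInf_lower) auto
  have "\<exists>x\<in>S. g x < m + 1 / real (Suc n)" for n
    using cInf_lessD[of "g ` S" "m + 1 / real (Suc n)"] ne by (auto simp: m_def)
  then obtain x where xS: "\<And>n. x n \<in> S" and xm: "\<And>n. g (x n) < m + 1 / real (Suc n)"
    by metis
  \<comment> \<open>Parallelogram law at the midpoint: \<open>f\<close> is linear and cancels, so
    near-minimisers have close images under \<open>T\<close>.\<close>
  have par: "(norm (T (u - v)))\<^sup>2 \<le> 2 * (g u - m) + 2 * (g v - m)" if "u \<in> S" "v \<in> S" for u v
  proof -
    have "(1/2) *\<^sub>R (u + v) \<in> S" using that S by (simp add: subspace_add subspace_scale)
    then have "m \<le> g ((1/2) *\<^sub>R (u + v))" by (rule m_le)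
    moreover have "(norm (T (u - v)))\<^sup>2 = 2 * g u + 2 * g v - 4 * g ((1/2) *\<^sub>R (u + v))"
      unfolding g_def power2_norm_eq_inner
      by (simp add: linear_add[OF T] linear_diff[OF T] linear_scale[OF T] linear_add[OF f]
          linear_scale[OF f] inner_add_left inner_add_right inner_diff_left inner_diff_right
          inner_commute add_divide_distrib diff_divide_distrib algebra_simps)
    ultimately show ?thesis by simp
  qed
  have "Cauchy (\<lambda>n. T (x n))"
  proof (rule metric_CauchyI)
    fix e :: real assume "e > 0"
    then obtain N where N: "1 / real (Suc N) < e\<^sup>2 / 4"
      using nat_approx_posE[of "e\<^sup>2 / 4"] by auto
    have "dist (T (x n)) (T (x k)) < e" if "n \<ge> N" "k \<ge> N" for n k
    proof -
      have le: "1 / real (Suc n) \<le> 1 / real (Suc N)" "1 / real (Suc k) \<le> 1 / real (Suc N)"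
        using that by (simp_all add: frac_le)
      have "(norm (T (x n - x k)))\<^sup>2 < e\<^sup>2"
      proof -
        have "g (x n) - m < e\<^sup>2 / 4" "g (x k) - m < e\<^sup>2 / 4"
          using xm[of n] xm[of k] N le by argo+
        then show ?thesis using par[OF xS xS, of n k] by argo
      qed
      then show ?thesis using \<open>e > 0\<close>
        by (simp add: dist_norm linear_diff[OF T] power2_less_imp_less)
    qed
    then show "\<exists>M. \<forall>n\<ge>M. \<forall>k\<ge>M. dist (T (x n)) (T (x k)) < e" by blast
  qed
  then obtain z where z: "(\<lambda>n. T (x n)) \<longlonglongrightarrow> z"
    using Cauchy_convergent convergent_def by blast
  have gm: "(\<lambda>n. g (x n)) \<longlonglongrightarrow> m"
  proof (rule tendsto_sandwich[of "\<lambda>_. m" _ _ "\<lambda>n. m + 1 / real (Suc n)"])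
    show "(\<lambda>n. m + 1 / real (Suc n)) \<longlonglongrightarrow> m"
      using tendsto_add[OF tendsto_const LIMSEQ_inverse_real_of_nat, of m]
      by (simp add: inverse_eq_divide)
  qed (auto intro!: always_eventually m_le xS less_imp_le[OF xm] simp del: of_nat_Suc)
  show thesis
  proof
    show "z \<in> closure (T ` S)"
      unfolding closure_sequential using z xS by (intro exI[of _ "\<lambda>n. T (x n)"]) auto
    fix h assume h: "h \<in> S"
    \<comment> \<open>Minimality along \<open>x n + t *\<^sub>R h\<close> survives the limit,
      although only \<open>T (x n)\<close> and \<open>g (x n)\<close> are known to converge. The
      constant term drops out, so the discriminant bound forces the linear coefficient to
      vanish.\<close>
    have nn: "0 + 2 * t * (inner z (T h) - f h) + t\<^sup>2 * (norm (T h))\<^sup>2 \<ge> 0" for t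
    proof -
      have "g (x n) + 2 * t * (inner (T (x n)) (T h) - f h) + t\<^sup>2 * (norm (T h))\<^sup>2 \<ge> m" for n
      proof -
        have "x n + t *\<^sub>R h \<in> S" using xS h S by (simp add: subspace_add subspace_scale)
        moreover have "g (x n + t *\<^sub>R h)
          = g (x n) + 2 * t * (inner (T (x n)) (T h) - f h) + t\<^sup>2 * (norm (T h))\<^sup>2"
          unfolding g_def power2_norm_eq_inner
          by (simp add: linear_add[OF T] linear_scale[OF T] linear_add[OF f] linear_scale[OF f]
              inner_add_left inner_add_right inner_commute power2_eq_square algebra_simps)
        ultimately show ?thesis using m_le by metis
      qed
      moreover have "(\<lambda>n. g (x n) + 2 * t * (inner (T (x n)) (T h) - f h) + t\<^sup>2 * (norm (T h))\<^sup>2)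
         \<longlonglongrightarrow> m + 2 * t * (inner z (T h) - f h) + t\<^sup>2 * (norm (T h))\<^sup>2"
        by (intro tendsto_intros gm z)
      ultimately have "m + 2 * t * (inner z (T h) - f h) + t\<^sup>2 * (norm (T h))\<^sup>2 \<ge> m"
        by (meson Lim_bounded2)
      then show ?thesis by simp
    qed
    have "(inner z (T h) - f h)\<^sup>2 \<le> 0"
      using quadratic_nonneg_discriminant[OF nn] by simp
    then show "f h = inner (T h) z" by (simp add: inner_commute)
  qed
qed

lemma inner_eqI: "(\<And>x. inner x y = inner x z) \<Longrightarrow> y = (z :: 'a :: real_inner)"
  by (metis inner_diff_right inner_eq_zero_iff right_minus_eq)

lemma cinner_eqI: "(\<And>x. cinner x y = cinner x z) \<Longrightarrow> y = (z :: 'a :: complex_inner)"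
  by (metis inner_eqI Re_cinner)

text \<open>\<open>S y\<close> represents the real functional \<open>inner (T x) y\<close>. Complex
  linearity follows because the real inner product separates points and moves \<open>a\<close> to
  the other side as \<open>cnj a\<close>.\<close>

lemma adjoint_exists:
  fixes T :: "'a :: chilbert_space \<Rightarrow> 'b :: complex_inner"
  assumes T: "bounded_clinear T"
  obtains S where "bounded_clinear S" "\<And>x y. inner (T x) y = inner x (S y)"
proof -
  obtain k where k: "k > 0" "\<And>x. norm (T x) \<le> k * norm x"
    using bounded_clinear_bound[OF T] by blast
  have "\<exists>z. \<forall>x. inner (T x) y = inner x z" for y
  proof -
    have "linear (\<lambda>x. inner (T x) y)"
      by (intro linearI) (simp_all add: bounded_clinear_simps[OF T] inner_add_left)
    moreover have "\<bar>inner (T x) y\<bar> \<le> (k * norm y) * norm x" for x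
      using Cauchy_Schwarz_ineq2[of "T x" y] mult_right_mono[OF k(2), of "norm y" x]
      by (simp add: algebra_simps)
    ultimately obtain z where "\<And>x. inner (T x) y = inner x z"
      using riesz_representation_range[OF subspace_UNIV linear_id, of "\<lambda>x. inner (T x) y"]
      by (metis UNIV_I id_apply)
    then show ?thesis by blast
  qed
  then obtain S where S: "\<And>x y. inner (T x) y = inner x (S y)" by metis
  have "bounded_clinear S"
  proof (rule bounded_clinearI)
    show "S (x + y) = S x + S y" for x y
      by (rule inner_eqI) (simp add: inner_add_right flip: S)
    show "S (a *\<^sub>C x) = a *\<^sub>C S x" for a x
    proof (rule inner_eqI)
      fix u
      have "inner u (S (a *\<^sub>C x)) = inner (T (cnj a *\<^sub>C u)) x"
        by (simp add: bounded_clinear_simps[OF T] inner_scaleC_left flip: S)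
      also have "\<dots> = inner u (a *\<^sub>C S x)"
        by (simp add: S inner_scaleC_left)
      finally show "inner u (S (a *\<^sub>C x)) = inner u (a *\<^sub>C S x)" .
    qed
    show "norm (S x) \<le> norm x * k" for x
    proof -
      have "(norm (S x))\<^sup>2 = inner (T (S x)) x"
        by (simp add: S power2_norm_eq_inner)
      also have "\<dots> \<le> k * norm (S x) * norm x"
        using Cauchy_Schwarz_ineq2[of "T (S x)" x] mult_right_mono[OF k(2), of "norm x" "S x"]
        by simp
      finally have "norm (S x) * norm (S x) \<le> norm (S x) * (norm x * k)"
        by (simp add: power2_eq_square algebra_simps)
      then show ?thesis
        by (metis k(1) less_imp_le mult_left_le_imp_le mult_nonneg_nonneg norm_ge_zero
            order_le_less)
    qed
  qed
  then show thesis using that S by blast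
qed

text \<open>Complex linearity of \<open>S\<close> turns the real identity at
  \<open>\<i> *\<^sub>C y\<close> into the one for imaginary parts, so adjoints can be handled
  through \<open>inner\<close> alone.\<close>

lemma cadjoint_unique:
  assumes "\<And>x y. inner (T x) y = inner x (S y)" "bounded_clinear T" "bounded_clinear S"
  shows "cadjoint T = S"
proof -
  have *: "cinner (T x) y = cinner x (S y)" for x y
    using assms(1)[of x y] assms(1)[of x "\<i> *\<^sub>C y"]
    by (simp add: cinner_eq_Complex bounded_clinear_scaleC[OF assms(3)])
  show ?thesis
    unfolding cadjoint_def
  proof (rule the_equality)
    fix S' assume S': "\<forall>x y. cinner (T x) y = cinner x (S' y)"
    show "S' = S"
    proof
      show "S' y = S y" for y
        by (rule cinner_eqI) (metis S' *)
    qed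
  qed (simp add: *)
qed

lemma cadjoint:
  fixes T :: "'a :: chilbert_space \<Rightarrow> 'b :: complex_inner"
  assumes "bounded_clinear T"
  shows bounded_clinear_cadjoint: "bounded_clinear (cadjoint T)"
    and inner_cadjoint: "inner (T x) y = inner x (cadjoint T y)"
proof -
  obtain S where S: "bounded_clinear S" "\<And>x y. inner (T x) y = inner x (S y)"
    using adjoint_exists[OF assms] by blast
  have "cadjoint T = S" by (rule cadjoint_unique[OF S(2) assms S(1)])
  then show "bounded_clinear (cadjoint T)" "inner (T x) y = inner x (cadjoint T y)"
    using S by simp_all
qed

section \<open>Selfadjoint and nonnegative operators\<close>

lemma selfadjoint_iff:
  fixes T :: "'a :: chilbert_space \<Rightarrow> 'a"
  shows "selfadjoint T \<longleftrightarrow> bounded_clinear T \<and> (\<forall>x y. inner (T x) y = inner x (T y))"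
  unfolding selfadjoint_def using inner_cadjoint[of T] cadjoint_unique[of T T] by metis

lemma selfadjoint_bounded_clinear:
  "selfadjoint T \<Longrightarrow> bounded_clinear T"
  by (simp add: selfadjoint_def)

lemma selfadjoint_inner:
  fixes T :: "'a :: chilbert_space \<Rightarrow> 'a"
  shows "selfadjoint T \<Longrightarrow> inner (T x) y = inner x (T y)"
  by (simp add: selfadjoint_iff)

text \<open>Multiplication by \<i> is skew for the real inner product and commutes with
  \<open>T\<close>, so \<open>inner (T x) (\<i> *\<^sub>C x)\<close> equals its own
  negative.\<close>

lemma selfadjoint_cinner_self:
  fixes T :: "'a :: chilbert_space \<Rightarrow> 'a"
  assumes sa: "selfadjoint T"
  shows "cinner (T x) x = complex_of_real (inner (T x) x)"
proof -
  note T = selfadjoint_bounded_clinear[OF sa]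
  have "inner (T x) (\<i> *\<^sub>C x) = inner (cnj \<i> *\<^sub>C T x) x"
    by (simp add: inner_scaleC_left)
  also have "\<dots> = inner (T (- (\<i> *\<^sub>C x))) x"
    by (simp add: bounded_clinear_simps[OF T])
  also have "\<dots> = - inner (T x) (\<i> *\<^sub>C x)"
    by (simp add: selfadjoint_inner[OF sa] inner_commute bounded_clinear_simps[OF T])
  finally have "inner (T x) (\<i> *\<^sub>C x) = 0" by simp
  then show ?thesis by (simp add: cinner_eq_Complex complex_eq_iff)
qed

text \<open>A complex form that is real on the diagonal is Hermitian, so the pointwise condition in
  \<open>nonneg_op\<close> already contains symmetry.\<close>

lemma nonneg_op_iff:
  fixes T :: "'a :: chilbert_space \<Rightarrow> 'a"
  shows "nonneg_op T \<longleftrightarrow> selfadjoint T \<and> (\<forall>x. 0 \<le> inner (T x) x)"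
proof
  assume nn: "nonneg_op T"
  then have T: "bounded_clinear T" by (simp add: nonneg_op_def)
  have re: "inner (T x) x \<ge> 0" and im: "inner (T x) (\<i> *\<^sub>C x) = 0" for x
    using nn by (auto simp: nonneg_op_def cinner_eq_Complex complex_nonneg_Reals_iff)
  have "inner (T x) y = inner x (T y)" for x y
  proof -
    \<comment> \<open>Polarization of \<open>im\<close>; at \<open>u = \<i> *\<^sub>C y\<close> it
      becomes symmetry.\<close>
    have "inner (T x) (\<i> *\<^sub>C u) + inner (T u) (\<i> *\<^sub>C x) = 0" for u
      using im[of "x + u"] im[of x] im[of u]
      by (simp add: bounded_clinear_add[OF T] scaleC_add_right inner_add_left inner_add_right)
    from this[of "\<i> *\<^sub>C y"] show ?thesis
      by (simp add: bounded_clinear_scaleC[OF T] inner_scaleC_left scaleC_i_i scaleC_scaleC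
          scaleC_one inner_commute)
  qed
  then show "selfadjoint T \<and> (\<forall>x. 0 \<le> inner (T x) x)"
    using re T by (simp add: selfadjoint_iff)
next
  assume "selfadjoint T \<and> (\<forall>x. 0 \<le> inner (T x) x)"
  then show "nonneg_op T"
    by (simp add: nonneg_op_def selfadjoint_cinner_self selfadjoint_bounded_clinear
        complex_nonneg_Reals_iff)
qed

lemma nonneg_op_selfadjoint:
  fixes T :: "'a :: chilbert_space \<Rightarrow> 'a"
  shows "nonneg_op T \<Longrightarrow> selfadjoint T"
  by (simp add: nonneg_op_iff)

lemma nonneg_op_inner:
  fixes T :: "'a :: chilbert_space \<Rightarrow> 'a"
  shows "nonneg_op T \<Longrightarrow> 0 \<le> inner (T x) x"
  by (simp add: nonneg_op_iff)

lemma nonneg_op_Cauchy_Schwarz: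
  fixes T :: "'a :: chilbert_space \<Rightarrow> 'a"
  assumes nn: "nonneg_op T"
  shows "(inner (T x) y)\<^sup>2 \<le> inner (T x) x * inner (T y) y"
proof (rule quadratic_nonneg_discriminant)
  note sa = nonneg_op_selfadjoint[OF nn]
  note T = selfadjoint_bounded_clinear[OF sa]
  show "0 \<le> inner (T y) y" by (rule nonneg_op_inner[OF nn])
  have "0 \<le> inner (T (x + t *\<^sub>R y)) (x + t *\<^sub>R y)" for t by (rule nonneg_op_inner[OF nn])
  then show "0 \<le> inner (T x) x + 2 * t * inner (T x) y + t\<^sup>2 * inner (T y) y" for t
    using selfadjoint_inner[OF sa, of y x]
    by (simp add: bounded_clinear_simps[OF T] inner_add_left inner_add_right power2_eq_square
        inner_commute algebra_simps)
qed

lemma nonneg_op_eq_zero: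
  fixes T :: "'a :: chilbert_space \<Rightarrow> 'a"
  assumes "nonneg_op T" "inner (T x) x = 0"
  shows "T x = 0"
  using nonneg_op_Cauchy_Schwarz[OF assms(1), of x "T x"] assms(2) by simp

section \<open>Orthogonal projections\<close>

lemma orth_projectionD:
  fixes P :: "'a :: chilbert_space \<Rightarrow> 'a"
  assumes "orth_projection P"
  shows orth_projection_clinear: "bounded_clinear P"
    and orth_projection_idem: "P (P x) = P x"
    and orth_projection_inner: "inner (P x) y = inner x (P y)"
    and orth_projection_norm: "(norm (P x))\<^sup>2 = inner (P x) x"
    and orth_projection_pythagoras: "(norm x)\<^sup>2 = (norm (P x))\<^sup>2 + (norm (x - P x))\<^sup>2"
    and orth_projection_norm_le: "norm (P x) \<le> norm x"
proof -
  have sa: "selfadjoint P" and id: "\<And>x. P (P x) = P x"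
    using assms by (auto simp: orth_projection_def fun_eq_iff)
  show "bounded_clinear P" "P (P x) = P x" "inner (P x) y = inner x (P y)"
    using sa id by (auto simp: selfadjoint_iff)
  have i: "inner (P x) (P x) = inner (P x) x"
    by (metis id sa selfadjoint_inner)
  then show "(norm (P x))\<^sup>2 = inner (P x) x"
    by (simp add: power2_norm_eq_inner)
  show py: "(norm x)\<^sup>2 = (norm (P x))\<^sup>2 + (norm (x - P x))\<^sup>2"
    using i by (simp add: power2_norm_eq_inner inner_diff_left inner_diff_right inner_commute)
  show "norm (P x) \<le> norm x"
    by (rule power2_le_imp_le) (simp_all add: py)
qed

lemma orth_projectionI:
  fixes P :: "'a :: chilbert_space \<Rightarrow> 'a"
  assumes "bounded_clinear P" "\<And>x. P (P x) = P x" "\<And>x y. inner (P x) y = inner x (P y)"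
  shows "orth_projection P"
  using assms by (auto simp: orth_projection_def selfadjoint_iff)

text \<open>\<open>P v\<close> is the vector of \<open>M\<close> that represents
  \<open>inner x v\<close> on \<open>M\<close>. The Riesz lemma finds it in the closure, and
  closedness keeps it in \<open>M\<close>. Linearity comes from the uniqueness of this
  representative.\<close>

lemma orth_projection_onto:
  fixes M :: "'a :: chilbert_space set"
  assumes M: "complex_vector.subspace M" and cl: "closed M"
  obtains P where "orth_projection P" "range P = M"
proof -
  note sub = csubspace_imp_subspace[OF M]
  have "\<exists>z\<in>M. \<forall>x\<in>M. inner x v = inner x z" for v
  proof -
    have lin: "linear (\<lambda>x. inner x v)"
      by (intro linearI) (simp_all add: inner_add_left)
    have "\<bar>inner x v\<bar> \<le> norm v * norm (id x)" for x
      using Cauchy_Schwarz_ineq2[of x v] by (simp add: mult.commute)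
    then obtain z where "z \<in> closure (id ` M)" "\<And>x. x \<in> M \<Longrightarrow> inner x v = inner (id x) z"
      using riesz_representation_range[OF sub linear_id lin] by metis
    then show ?thesis using cl by auto
  qed
  then obtain P where PM: "\<And>v. P v \<in> M" and P: "\<And>v x. x \<in> M \<Longrightarrow> inner x v = inner x (P v)"
    by metis
  have uniq: "P v = z" if "z \<in> M" "\<And>x. x \<in> M \<Longrightarrow> inner x v = inner x z" for v z
  proof -
    have "P v - z \<in> M" using PM that sub by (simp add: subspace_diff)
    then have "inner (P v - z) (P v - z) = 0"
      using P[of "P v - z" v] that(2)[of "P v - z"] by (simp add: inner_diff_right)
    then show ?thesis by simp
  qed
  have fix_M: "P v = v" if "v \<in> M" for v using that by (intro uniq) auto
  have "orth_projection P"
  proof (rule orth_projectionI)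
    show "P (P x) = P x" for x using fix_M PM by blast
    show "inner (P x) y = inner x (P y)" for x y
      using P[OF PM, of x y] P[OF PM, of y x] by (simp add: inner_commute)
    show "bounded_clinear P"
    proof (rule bounded_clinearI)
      show "P (x + y) = P x + P y" for x y
        by (rule uniq) (simp_all add: PM subspace_add[OF sub] inner_add_right flip: P)
      show "P (a *\<^sub>C x) = a *\<^sub>C P x" for a x
      proof (rule uniq)
        show "a *\<^sub>C P x \<in> M" using M PM by (simp add: complex_vector.subspace_scale)
        fix u assume "u \<in> M"
        then have "cnj a *\<^sub>C u \<in> M" using M by (simp add: complex_vector.subspace_scale)
        from P[OF this, of x] show "inner u (a *\<^sub>C x) = inner u (a *\<^sub>C P x)"
          by (simp add: inner_scaleC_left)
      qed
      show "norm (P x) \<le> norm x * 1" for x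
      proof -
        have "norm (P x) * norm (P x) \<le> norm (P x) * norm x"
          using P[OF PM, of x x] norm_cauchy_schwarz[of "P x" x]
          by (simp add: power2_eq_square flip: power2_norm_eq_inner)
        then show ?thesis
          by (metis mult.right_neutral mult_left_le_imp_le norm_ge_zero order_le_less)
      qed
    qed
  qed
  moreover have "range P = M" using PM fix_M by (metis image_subset_iff rangeI subsetI subset_antisym)
  ultimately show thesis using that by blast
qed

lemma orth_projection_kernel:
  fixes T :: "'a :: chilbert_space \<Rightarrow> 'b :: complex_inner"
  assumes T: "bounded_clinear T"
  obtains P where "orth_projection P" "\<And>x. P x = x \<longleftrightarrow> T x = 0"
proof -
  have "complex_vector.subspace {x. T x = 0}"
    by (auto simp: complex_vector.subspace_def bounded_clinear_simps[OF T])
  moreover have "closed {x. T x = 0}"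
    using bounded_clinear_bounded_linear[OF T]
    by (intro closed_Collect_eq continuous_intros linear_continuous_on)
  ultimately obtain P where P: "orth_projection P" "range P = {x. T x = 0}"
    using orth_projection_onto by blast
  have "P x = x \<longleftrightarrow> T x = 0" for x
  proof
    assume "P x = x"
    moreover have "P x \<in> {x. T x = 0}" unfolding P(2)[symmetric] by simp
    ultimately show "T x = 0" by simp
  next
    assume "T x = 0"
    then have "x \<in> range P" by (simp add: P(2))
    then show "P x = x" using orth_projection_idem[OF P(1)] by auto
  qed
  then show thesis using P that by blast
qed

section \<open>Square roots\<close>

text \<open>Cauchy-Schwarz for the form of \<open>S\<close> at \<open>x\<close> and
  \<open>S x\<close> bounds the fourth power of \<open>norm (S x)\<close> by a product of two form
  values, and both factors are controlled by the hypothesis.\<close>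

lemma nonneg_contraction_norm_le:
  fixes S :: "'a :: chilbert_space \<Rightarrow> 'a"
  assumes nn: "nonneg_op S" and le: "\<And>x. inner (S x) x \<le> (norm x)\<^sup>2"
  shows "norm (S x) \<le> norm x"
proof (cases "S x = 0")
  case False
  have "((norm (S x))\<^sup>2)\<^sup>2 \<le> inner (S x) x * inner (S (S x)) (S x)"
    using nonneg_op_Cauchy_Schwarz[OF nn, of x "S x"] by (simp add: power2_norm_eq_inner)
  also have "\<dots> \<le> (norm x)\<^sup>2 * (norm (S x))\<^sup>2"
    by (intro mult_mono le nonneg_op_inner[OF nn]) auto
  finally have "(norm (S x))\<^sup>2 \<le> (norm x)\<^sup>2"
    using False by (simp add: power2_eq_square)
  then show ?thesis by (rule power2_le_imp_le) simp
qed simp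

text \<open>\<open>Y = lim Y\<^sub>n\<close> solves \<open>2 Y = S + Y\<^sup>2\<close>, that is \<open>(1 - Y)\<^sup>2 = 1 - S\<close>.\<close>

fun sqrt_iter :: "('a :: real_vector \<Rightarrow> 'a) \<Rightarrow> nat \<Rightarrow> 'a \<Rightarrow> 'a" where
  "sqrt_iter S 0 = (\<lambda>x. 0)"
| "sqrt_iter S (Suc n) = (\<lambda>x. (1/2) *\<^sub>R (S x + sqrt_iter S n (sqrt_iter S n x)))"

text \<open>The same iteration for the number \<open>1\<close> majorises the increments of \<open>sqrt_iter S\<close>
  if \<open>\<parallel>S\<parallel> \<le> 1\<close>.\<close>

fun sqrt_bound :: "nat \<Rightarrow> real" where
  "sqrt_bound 0 = 0"
| "sqrt_bound (Suc n) = (1 + (sqrt_bound n)\<^sup>2) / 2"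

lemma sqrt_bound_le_1: "0 \<le> sqrt_bound n \<and> sqrt_bound n \<le> 1"
  by (induction n) (auto simp: power_le_one)

lemma sqrt_bound_mono: "sqrt_bound n \<le> sqrt_bound (Suc n)"
proof -
  have "0 \<le> (1 - sqrt_bound n)\<^sup>2" by simp
  then show ?thesis by (simp add: power2_diff)
qed

lemma sqrt_bound_Cauchy: "Cauchy sqrt_bound"
proof -
  have "incseq sqrt_bound" by (rule incseq_SucI) (rule sqrt_bound_mono)
  then obtain L where "sqrt_bound \<longlonglongrightarrow> L"
    using incseq_convergent[of sqrt_bound 1] sqrt_bound_le_1 by blast
  then show ?thesis by (simp add: LIMSEQ_imp_Cauchy)
qed

lemma sqrt_iter_clinear:
  "bounded_clinear S \<Longrightarrow> bounded_clinear (sqrt_iter S n)"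
proof (induction n)
  case (Suc n)
  from bounded_clinear_compose[OF Suc.IH Suc.IH] Suc.prems show ?case
    by (auto intro!: bounded_clinear_intros)
qed (simp add: bounded_clinear_intros)

text \<open>Each iterate is a polynomial in \<open>S\<close>. In the limit this becomes the
  commutation clause of \<open>sqrt_exists\<close>.\<close>

lemma sqrt_iter_commute:
  assumes "bounded_clinear S" and W: "bounded_clinear W" and "\<And>x. W (S x) = S (W x)"
  shows "W (sqrt_iter S n x) = sqrt_iter S n (W x)"
  using assms
  by (induction n arbitrary: x) (auto simp: bounded_clinear_simps[OF W])

lemma sqrt_iter_selfadjoint:
  fixes S :: "'a :: chilbert_space \<Rightarrow> 'a"
  assumes "selfadjoint S"
  shows "inner (sqrt_iter S n x) y = inner x (sqrt_iter S n y)"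
  by (induction n arbitrary: x y)
    (simp_all add: inner_add_left inner_add_right selfadjoint_inner[OF assms])

lemma sqrt_iter_norm:
  assumes "\<And>x. norm (S x) \<le> norm x"
  shows "norm (sqrt_iter S n x) \<le> sqrt_bound n * norm x"
proof (induction n arbitrary: x)
  case (Suc n)
  have "norm (sqrt_iter S n (sqrt_iter S n x)) \<le> sqrt_bound n * norm (sqrt_iter S n x)"
    by (rule Suc)
  also have "\<dots> \<le> sqrt_bound n * (sqrt_bound n * norm x)"
    by (intro mult_left_mono Suc) (simp add: sqrt_bound_le_1)
  finally have "norm (S x + sqrt_iter S n (sqrt_iter S n x)) \<le> norm x + (sqrt_bound n)\<^sup>2 * norm x"
    using assms[of x] by (intro norm_triangle_le) (simp add: power2_eq_square mult.assoc)
  then show ?case by (simp add: distrib_right)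
qed simp

text \<open>Since the \<open>Y\<^sub>n\<close> commute,
  \<open>2 (Y\<^bsub>n+2\<^esub> - Y\<^bsub>n+1\<^esub>) = (Y\<^bsub>n+1\<^esub> + Y\<^sub>n) (Y\<^bsub>n+1\<^esub> - Y\<^sub>n)\<close>.\<close>

lemma sqrt_iter_step:
  assumes S: "bounded_clinear S" and contr: "\<And>x. norm (S x) \<le> norm x"
  shows "norm (sqrt_iter S (Suc n) x - sqrt_iter S n x)
    \<le> (sqrt_bound (Suc n) - sqrt_bound n) * norm x"
proof (induction n arbitrary: x)
  case 0
  then show ?case using contr[of x] by simp
next
  case (Suc n)
  define Y Z y z where "Y = sqrt_iter S (Suc n)" "Z = sqrt_iter S n"
    "y = sqrt_bound (Suc n)" "z = sqrt_bound n"
  note defs = this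
  have Y: "bounded_clinear Y" and Z: "bounded_clinear Z"
    unfolding defs using S by (auto intro: sqrt_iter_clinear simp del: sqrt_iter.simps)
  have comm: "Y (Z x) = Z (Y x)"
    unfolding defs
    by (rule sqrt_iter_commute[OF S sqrt_iter_clinear[OF S]])
      (simp add: sqrt_iter_commute[OF S S] del: sqrt_iter.simps)
  have bd: "norm (Y u) \<le> y * norm u" "norm (Z u) \<le> z * norm u" for u
    unfolding defs by (rule sqrt_iter_norm[OF contr])+
  have step: "norm (Y x - Z x) \<le> (y - z) * norm x"
    using Suc[of x] by (simp add: defs)
  have "norm (Y (Y x - Z x) + Z (Y x - Z x)) \<le> y * norm (Y x - Z x) + z * norm (Y x - Z x)"
    by (intro norm_triangle_le add_mono bd)
  also have "\<dots> \<le> (y + z) * ((y - z) * norm x)"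
    using mult_left_mono[OF step, of "y + z"] sqrt_bound_le_1[of n] sqrt_bound_le_1[of "Suc n"]
    unfolding defs by (simp add: distrib_right del: sqrt_bound.simps)
  finally have "norm (Y (Y x) - Z (Z x)) \<le> (y\<^sup>2 - z\<^sup>2) * norm x"
    by (simp add: bounded_clinear_diff[OF Y] bounded_clinear_diff[OF Z] comm power2_eq_square
        algebra_simps)
  moreover have "sqrt_iter S (Suc (Suc n)) x - sqrt_iter S (Suc n) x
     = (1/2) *\<^sub>R (Y (Y x) - Z (Z x))"
    unfolding defs
    by (subst (1 2) sqrt_iter.simps(2))
      (simp add: scaleR_right_diff_distrib scaleR_add_right del: sqrt_iter.simps)
  moreover have "sqrt_bound (Suc (Suc n)) - sqrt_bound (Suc n) = (y\<^sup>2 - z\<^sup>2) / 2"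
    unfolding defs by (simp add: field_simps)
  ultimately show ?case by (simp only: norm_scaleR)
qed

lemma sqrt_iter_diff:
  assumes S: "bounded_clinear S" and contr: "\<And>x. norm (S x) \<le> norm x" and "n \<le> m"
  shows "norm (sqrt_iter S m x - sqrt_iter S n x) \<le> (sqrt_bound m - sqrt_bound n) * norm x"
  using \<open>n \<le> m\<close>
proof (induction m rule: dec_induct)
  case (step m)
  have "norm (sqrt_iter S (Suc m) x - sqrt_iter S n x)
    \<le> norm (sqrt_iter S (Suc m) x - sqrt_iter S m x) + norm (sqrt_iter S m x - sqrt_iter S n x)"
    by (rule norm_diff_triangle_le[OF order_refl order_refl])
  then show ?case
    using step.IH sqrt_iter_step[OF S contr, of m x]
    by (simp add: left_diff_distrib del: sqrt_iter.simps sqrt_bound.simps)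
qed simp

text \<open>\<open>S = 1 - T\<close> is a nonnegative contraction, so the iterates converge to some
  \<open>Y\<close> with \<open>2 Y = S + Y\<^sup>2\<close>, and \<open>R = 1 - Y\<close>. The
  commutation clause is what later makes the root unique.\<close>

lemma sqrt_exists_contraction:
  fixes T :: "'a :: chilbert_space \<Rightarrow> 'a"
  assumes nn: "nonneg_op T" and le: "\<And>x. inner (T x) x \<le> (norm x)\<^sup>2"
  obtains R where "nonneg_op R" "\<And>x. R (R x) = T x"
    "\<And>W x. bounded_clinear W \<Longrightarrow> (\<And>x. W (T x) = T (W x)) \<Longrightarrow> W (R x) = R (W x)"
proof -
  define S where "S = (\<lambda>x. x - T x)"
  note T = selfadjoint_bounded_clinear[OF nonneg_op_selfadjoint[OF nn]]
  have S: "bounded_clinear S" unfolding S_def by (intro bounded_clinear_intros T)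
  have Ssa: "selfadjoint S"
    using S selfadjoint_inner[OF nonneg_op_selfadjoint[OF nn]]
    by (simp add: selfadjoint_iff S_def inner_diff_left inner_diff_right)
  have Snn: "nonneg_op S"
    using Ssa le by (simp add: nonneg_op_iff S_def inner_diff_left power2_norm_eq_inner)
  have contr: "norm (S x) \<le> norm x" for x
    using nonneg_op_inner[OF nn]
    by (intro nonneg_contraction_norm_le[OF Snn])
      (simp add: S_def inner_diff_left power2_norm_eq_inner)
  let ?Y = "sqrt_iter S"
  have "\<exists>l. (\<lambda>n. ?Y n x) \<longlonglongrightarrow> l" for x
  proof -
    have "Cauchy (\<lambda>n. ?Y n x)"
    proof (rule metric_CauchyI)
      fix e :: real assume e: "e > 0"
      have "e / (norm x + 1) > 0" using e by (simp add: add_nonneg_pos)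
      then obtain N where N: "\<And>m n. m \<ge> N \<Longrightarrow> n \<ge> N \<Longrightarrow>
          dist (sqrt_bound m) (sqrt_bound n) < e / (norm x + 1)"
        using metric_CauchyD[OF sqrt_bound_Cauchy] by blast
      have le: "dist (?Y m x) (?Y n x) < e" if "n \<le> m" "m \<ge> N" "n \<ge> N" for m n
      proof -
        have "dist (?Y m x) (?Y n x) \<le> (sqrt_bound m - sqrt_bound n) * norm x"
          using sqrt_iter_diff[OF S contr that(1)] by (simp add: dist_norm)
        also have "\<dots> \<le> e / (norm x + 1) * norm x"
          using N[OF that(2,3)] by (intro mult_right_mono) (auto simp: dist_real_def)
        also have "\<dots> < e"
          using e by (simp add: field_simps add_nonneg_pos add_pos_nonneg)
        finally show ?thesis .
      qed
      then have "dist (?Y m x) (?Y n x) < e" if "m \<ge> N" "n \<ge> N" for m n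
        using that by (metis dist_commute nle_le)
      then show "\<exists>M. \<forall>m\<ge>M. \<forall>n\<ge>M. dist (?Y m x) (?Y n x) < e" by blast
    qed
    then show ?thesis using Cauchy_convergent convergent_def by blast
  qed
  then obtain Y where Y: "\<And>x. (\<lambda>n. ?Y n x) \<longlonglongrightarrow> Y x" by metis
  have Yn: "norm (?Y n x) \<le> norm x" for n x
    using sqrt_iter_norm[OF contr, of n x] sqrt_bound_le_1[of n]
      mult_right_mono[of "sqrt_bound n" 1 "norm x"] by simp
  have Ycl: "bounded_clinear Y"
    by (rule bounded_clinear_limit[OF sqrt_iter_clinear[OF S] Y, of 1]) (simp add: Yn)
  have Ynorm: "norm (Y x) \<le> norm x" for x
    using Lim_bounded[OF tendsto_norm[OF Y[of x]]] Yn by blast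
  have Ysym: "inner (Y x) y = inner x (Y y)" for x y
    using LIMSEQ_unique[OF tendsto_inner[OF Y[of x] tendsto_const[of y]]]
      tendsto_inner[OF tendsto_const[of x] Y[of y]]
    by (simp add: sqrt_iter_selfadjoint[OF Ssa])
  have eq: "Y x = (1/2) *\<^sub>R (S x + Y (Y x))" for x
  proof -
    \<comment> \<open>The operators \<open>?Y n\<close> are uniformly bounded, so the moving
      argument \<open>?Y n x\<close> may be replaced by its limit.\<close>
    have "(\<lambda>n. ?Y n (?Y n x) - ?Y n (Y x)) \<longlonglongrightarrow> 0"
    proof (rule Lim_null_comparison)
      show "\<forall>\<^sub>F n in sequentially. norm (?Y n (?Y n x) - ?Y n (Y x)) \<le> norm (?Y n x - Y x)"
        using Yn by (simp flip: bounded_clinear_diff[OF sqrt_iter_clinear[OF S]])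
      show "(\<lambda>n. norm (?Y n x - Y x)) \<longlonglongrightarrow> 0"
        using Y[of x] by (simp add: LIM_zero tendsto_norm_zero)
    qed
    from tendsto_add[OF this Y[of "Y x"]] have "(\<lambda>n. ?Y n (?Y n x)) \<longlonglongrightarrow> Y (Y x)"
      by simp
    then have "(\<lambda>n. ?Y (Suc n) x) \<longlonglongrightarrow> (1/2) *\<^sub>R (S x + Y (Y x))"
      by (auto intro!: tendsto_intros)
    then show ?thesis using LIMSEQ_Suc[OF Y[of x]] LIMSEQ_unique by blast
  qed
  show thesis
  proof (rule that[of "\<lambda>x. x - Y x"])
    have "inner (Y x) x \<le> inner x x" for x
      using norm_cauchy_schwarz[of "Y x" x] mult_right_mono[OF Ynorm[of x], of "norm x"]
      by (simp add: power2_eq_square flip: power2_norm_eq_inner)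
    then show "nonneg_op (\<lambda>x. x - Y x)"
      by (auto simp: nonneg_op_iff selfadjoint_iff Ysym inner_diff_left inner_diff_right
          intro!: bounded_clinear_intros Ycl)
    show "x - Y x - Y (x - Y x) = T x" for x
    proof -
      have "2 *\<^sub>R Y x = S x + Y (Y x)" by (subst eq) simp
      then have "Y x + Y x = S x + Y (Y x)" by (simp add: scaleR_2)
      then show ?thesis by (simp add: bounded_clinear_diff[OF Ycl] S_def algebra_simps)
    qed
    fix W x assume W: "bounded_clinear W" and c: "\<And>x. W (T x) = T (W x)"
    have "W (?Y n x) = ?Y n (W x)" for n
      by (rule sqrt_iter_commute[OF S W]) (simp add: S_def bounded_clinear_diff[OF W] c)
    then have "(\<lambda>n. ?Y n (W x)) \<longlonglongrightarrow> W (Y x)"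
      using bounded_clinear_tendsto[OF W Y[of x]] by simp
    then have "W (Y x) = Y (W x)" using Y LIMSEQ_unique by blast
    then show "W (x - Y x) = W x - Y (W x)" by (simp add: bounded_clinear_diff[OF W])
  qed
qed

lemma nonneg_op_scaleR:
  fixes T :: "'a :: chilbert_space \<Rightarrow> 'a"
  assumes "nonneg_op T" "r \<ge> 0"
  shows "nonneg_op (\<lambda>x. r *\<^sub>R T x)"
  using assms by (auto simp: nonneg_op_iff selfadjoint_iff intro!: bounded_clinear_intros)

text \<open>Dividing by a bound \<open>k\<close> of \<open>T\<close> reduces to the contractive
  case; the root is scaled back by \<open>sqrt k\<close>.\<close>

lemma sqrt_exists:
  fixes T :: "'a :: chilbert_space \<Rightarrow> 'a"
  assumes nn: "nonneg_op T"
  obtains R where "nonneg_op R" "\<And>x. R (R x) = T x"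
    "\<And>W x. bounded_clinear W \<Longrightarrow> (\<And>x. W (T x) = T (W x)) \<Longrightarrow> W (R x) = R (W x)"
proof -
  obtain k where k: "k > 0" "\<And>x. norm (T x) \<le> k * norm x"
    using bounded_clinear_bound selfadjoint_bounded_clinear[OF nonneg_op_selfadjoint[OF nn]]
    by blast
  have "nonneg_op (\<lambda>x. (1/k) *\<^sub>R T x)"
    using nonneg_op_scaleR[OF nn] k(1) by simp
  moreover have "inner ((1/k) *\<^sub>R T x) x \<le> (norm x)\<^sup>2" for x
  proof -
    have "inner (T x) x \<le> k * norm x * norm x"
      using norm_cauchy_schwarz[of "T x" x] mult_right_mono[OF k(2), of "norm x" x] by simp
    then show ?thesis using k(1) by (simp add: power2_eq_square field_simps)
  qed
  ultimately obtain R where R: "nonneg_op R" "\<And>x. R (R x) = (1/k) *\<^sub>R T x"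
    "\<And>W x. bounded_clinear W \<Longrightarrow> (\<And>x. W ((1/k) *\<^sub>R T x) = (1/k) *\<^sub>R T (W x)) \<Longrightarrow> W (R x) = R (W x)"
    using sqrt_exists_contraction by blast
  note Rcl = selfadjoint_bounded_clinear[OF nonneg_op_selfadjoint[OF R(1)]]
  show thesis
  proof (rule that[of "\<lambda>x. sqrt k *\<^sub>R R x"])
    show "nonneg_op (\<lambda>x. sqrt k *\<^sub>R R x)"
      using nonneg_op_scaleR[OF R(1)] k(1) by simp
    show "sqrt k *\<^sub>R R (sqrt k *\<^sub>R R x) = T x" for x
      using k(1) by (simp add: bounded_clinear_scaleR[OF Rcl] R(2))
    fix W x assume W: "bounded_clinear W" and c: "\<And>x. W (T x) = T (W x)"
    show "W (sqrt k *\<^sub>R R x) = sqrt k *\<^sub>R R (W x)"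
      by (simp add: bounded_clinear_scaleR[OF W] R(3)[OF W] c)
  qed
qed

text \<open>With \<open>y = (R - R') x\<close>, commutation gives
  \<open>(R + R') y = (R\<^sup>2 - R'\<^sup>2) x = 0\<close>. Both forms are nonnegative, so
  \<open>R y = R' y = 0\<close>, and then
  \<open>inner y y = inner x ((R - R') y) = 0\<close>.\<close>

lemma sqrt_unique:
  fixes R R' :: "'a :: chilbert_space \<Rightarrow> 'a"
  assumes R: "nonneg_op R" and R': "nonneg_op R'" and sq: "\<And>x. R (R x) = R' (R' x)"
    and comm: "\<And>x. R' (R x) = R (R' x)"
  shows "R = R'"
proof
  fix x
  note sa = nonneg_op_selfadjoint[OF R] nonneg_op_selfadjoint[OF R']
  note cl = sa[THEN selfadjoint_bounded_clinear]
  define y where "y = R x - R' x"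
  have "inner (R y) y + inner (R' y) y = 0"
    by (simp add: y_def bounded_clinear_diff[OF cl(1)] bounded_clinear_diff[OF cl(2)] sq comm
        flip: inner_add_left)
  with nonneg_op_inner[OF R, of y] nonneg_op_inner[OF R', of y]
  have "inner (R y) y = 0" "inner (R' y) y = 0" by linarith+
  then have "R y = 0" "R' y = 0" using nonneg_op_eq_zero R R' by blast+
  moreover have "inner y y = inner x (R y - R' y)"
    by (simp add: y_def inner_diff_left inner_diff_right selfadjoint_inner[OF sa(1)]
        selfadjoint_inner[OF sa(2)] bounded_clinear_diff[OF cl(1)] bounded_clinear_diff[OF cl(2)])
  ultimately show "R x = R' x" by (simp add: y_def)
qed

text \<open>Any root \<open>R'\<close> commutes with its square \<open>T\<close>, hence with the
  constructed root \<open>Q\<close>. So \<open>sqrt_unique\<close> applies to \<open>Q\<close> and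
  every other root, although two arbitrary roots are not known to commute in advance.\<close>

lemma op_sqrt_unique:
  fixes T :: "'a :: chilbert_space \<Rightarrow> 'a"
  assumes T: "nonneg_op T" and R: "nonneg_op R" and sq: "\<And>x. R (R x) = T x"
  shows "op_sqrt T = R"
proof -
  obtain Q where Q: "nonneg_op Q" "\<And>x. Q (Q x) = T x"
    "\<And>W x. bounded_clinear W \<Longrightarrow> (\<And>x. W (T x) = T (W x)) \<Longrightarrow> W (Q x) = Q (W x)"
    using sqrt_exists[OF T] by blast
  have uniq: "Q = R'" if R': "nonneg_op R'" "\<And>x. R' (R' x) = T x" for R'
  proof (rule sqrt_unique[OF Q(1) R'(1)])
    show "R' (Q x) = Q (R' x)" for x
      by (rule Q(3)[OF selfadjoint_bounded_clinear[OF nonneg_op_selfadjoint[OF R'(1)]]])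
        (metis R'(2))
  qed (simp add: Q(2) R'(2))
  show ?thesis
    unfolding op_sqrt_def
  proof (rule the_equality)
    show "nonneg_op R \<and> R \<circ> R = T" using R sq by auto
    show "R' = R" if "nonneg_op R' \<and> R' \<circ> R' = T" for R'
      using uniq[of R'] uniq[OF R sq] that by (metis comp_apply)
  qed
qed

lemma op_sqrt:
  fixes T :: "'a :: chilbert_space \<Rightarrow> 'a"
  assumes T: "nonneg_op T"
  shows nonneg_op_sqrt: "nonneg_op (op_sqrt T)"
    and op_sqrt_square: "op_sqrt T (op_sqrt T x) = T x"
    and op_sqrt_commute:
      "bounded_clinear W \<Longrightarrow> (\<And>x. W (T x) = T (W x)) \<Longrightarrow> W (op_sqrt T x) = op_sqrt T (W x)"
proof -
  obtain Q where Q: "nonneg_op Q" "\<And>x. Q (Q x) = T x"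
    "\<And>W x. bounded_clinear W \<Longrightarrow> (\<And>x. W (T x) = T (W x)) \<Longrightarrow> W (Q x) = Q (W x)"
    using sqrt_exists[OF T] by blast
  have "op_sqrt T = Q" by (rule op_sqrt_unique[OF T Q(1,2)])
  then show "nonneg_op (op_sqrt T)" "op_sqrt T (op_sqrt T x) = T x"
    "bounded_clinear W \<Longrightarrow> (\<And>x. W (T x) = T (W x)) \<Longrightarrow> W (op_sqrt T x) = op_sqrt T (W x)"
    using Q by auto
qed

section \<open>The absolute value of a selfadjoint operator\<close>

lemma nonneg_op_square:
  fixes A :: "'a :: chilbert_space \<Rightarrow> 'a"
  assumes "selfadjoint A"
  shows "nonneg_op (A \<circ> A)"
proof -
  note sym = selfadjoint_inner[OF assms]
  have "inner (A (A x)) y = inner x (A (A y))" for x y by (simp only: sym)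
  moreover have "0 \<le> inner (A (A x)) x" for x unfolding sym[of "A x"] by simp
  ultimately show ?thesis
    using bounded_clinear_compose[OF assms[THEN selfadjoint_bounded_clinear]
        assms[THEN selfadjoint_bounded_clinear]]
    by (simp add: nonneg_op_iff selfadjoint_iff comp_def)
qed

lemma abs_op:
  fixes A :: "'a :: chilbert_space \<Rightarrow> 'a"
  assumes A: "selfadjoint A"
  shows nonneg_abs_op: "nonneg_op (abs_op A)"
    and abs_op_square: "abs_op A (abs_op A x) = A (A x)"
    and abs_op_commute:
      "bounded_clinear W \<Longrightarrow> (\<And>x. W (A x) = A (W x)) \<Longrightarrow> W (abs_op A x) = abs_op A (W x)"
  using op_sqrt[OF nonneg_op_square[OF A]] by (simp_all add: abs_op_def)

lemma norm_abs_op: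
  fixes A :: "'a :: chilbert_space \<Rightarrow> 'a"
  assumes A: "selfadjoint A"
  shows "norm (abs_op A x) = norm (A x)"
proof -
  have "inner (abs_op A x) (abs_op A x) = inner (A x) (A x)"
    by (metis A abs_op_square nonneg_abs_op nonneg_op_selfadjoint selfadjoint_inner)
  then show ?thesis by (simp add: norm_eq_sqrt_inner)
qed

lemma abs_op_unique:
  fixes A :: "'a :: chilbert_space \<Rightarrow> 'a"
  assumes "selfadjoint A" "nonneg_op R" "\<And>x. R (R x) = A (A x)"
  shows "abs_op A = R"
  unfolding abs_op_def by (rule op_sqrt_unique[OF nonneg_op_square]) (use assms in auto)

section \<open>Resolutions of the identity\<close>

lemma orth_projection_complement:
  fixes P :: "'a :: chilbert_space \<Rightarrow> 'a"
  assumes P: "orth_projection P"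
  shows "orth_projection (\<lambda>x. x - P x)"
  by (rule orth_projectionI)
    (simp_all add: bounded_clinear_intros orth_projection_clinear[OF P]
      bounded_clinear_diff[OF orth_projection_clinear[OF P]] orth_projection_idem[OF P]
      inner_diff_left inner_diff_right orth_projection_inner[OF P])

lemma orth_projection_orthogonal_commute:
  fixes P Q :: "'a :: chilbert_space \<Rightarrow> 'a"
  assumes P: "orth_projection P" and Q: "orth_projection Q" and PQ: "\<And>x. P (Q x) = 0"
  shows "Q (P x) = 0"
proof (rule inner_eqI)
  show "inner y (Q (P x)) = inner y 0" for y
    by (simp add: PQ flip: orth_projection_inner[OF P] orth_projection_inner[OF Q])
qed

lemma orth_projection_add:
  fixes P Q :: "'a :: chilbert_space \<Rightarrow> 'a"
  assumes P: "orth_projection P" and Q: "orth_projection Q" and PQ: "\<And>x. P (Q x) = 0"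
  shows "orth_projection (\<lambda>x. P x + Q x)"
    and "(norm (P x + Q x))\<^sup>2 = (norm (P x))\<^sup>2 + (norm (Q x))\<^sup>2"
proof -
  note QP = orth_projection_orthogonal_commute[OF P Q PQ]
  note cl = orth_projection_clinear[OF P] orth_projection_clinear[OF Q]
  show PQp: "orth_projection (\<lambda>x. P x + Q x)"
    by (rule orth_projectionI)
      (simp_all add: bounded_clinear_intros cl bounded_clinear_add[OF cl(1)]
        bounded_clinear_add[OF cl(2)] orth_projection_idem[OF P] orth_projection_idem[OF Q]
        PQ QP inner_add_left inner_add_right orth_projection_inner[OF P] orth_projection_inner[OF Q])
  show "(norm (P x + Q x))\<^sup>2 = (norm (P x))\<^sup>2 + (norm (Q x))\<^sup>2"
    using orth_projection_norm[OF PQp, of x]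
    by (simp add: orth_projection_norm[OF P] orth_projection_norm[OF Q] inner_add_left)
qed

text \<open>The squared norm of \<open>P x\<close> is the quadratic form of \<open>P\<close>, which
  determines \<open>P\<close> by polarization. This makes the projection belonging to a Borel set
  unique once its scalar measures are known.\<close>

lemma orth_projection_eqI:
  fixes P Q :: "'a :: chilbert_space \<Rightarrow> 'a"
  assumes P: "orth_projection P" and Q: "orth_projection Q" and eq: "\<And>x. norm (P x) = norm (Q x)"
  shows "P = Q"
proof
  fix x
  note cl = orth_projection_clinear[OF P] orth_projection_clinear[OF Q]
  have q: "inner (P x) x = inner (Q x) x" for x
    using orth_projection_norm[OF P, of x] orth_projection_norm[OF Q, of x] eq by simp
  show "P x = Q x"
  proof (rule inner_eqI)
    fix y
    have "inner (P (y + x)) (y + x) = inner (Q (y + x)) (y + x)" by (rule q)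
    then have "inner (P y) x + inner (P x) y = inner (Q y) x + inner (Q x) y"
      using q[of x] q[of y] by (simp add: bounded_clinear_add[OF cl(1)]
        bounded_clinear_add[OF cl(2)] inner_add_left inner_add_right)
    then show "inner y (P x) = inner y (Q x)"
      by (simp add: orth_projection_inner[OF P] orth_projection_inner[OF Q] inner_commute[of _ y])
  qed
qed

text \<open>Take the adjoint of \<open>P W P = W P\<close> to get
  \<open>P W P = P W\<close>.\<close>

lemma orth_projection_commuteI:
  fixes P W :: "'a :: chilbert_space \<Rightarrow> 'a"
  assumes P: "orth_projection P" and W: "selfadjoint W" and inv: "\<And>x. P (W (P x)) = W (P x)"
  shows "P (W x) = W (P x)"
proof (rule inner_eqI)
  fix y
  have "inner y (P (W x)) = inner (W (P y)) x"
    by (simp only: selfadjoint_inner[OF W] orth_projection_inner[OF P])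
  also have "\<dots> = inner (P (W (P y))) x" by (simp only: inv)
  also have "\<dots> = inner y (P (W (P x)))"
    by (simp only: selfadjoint_inner[OF W] orth_projection_inner[OF P])
  finally show "inner y (P (W x)) = inner y (W (P x))" by (simp only: inv)
qed

lemma selfadjoint_diff_scaleR:
  fixes A :: "'a :: chilbert_space \<Rightarrow> 'a"
  assumes "selfadjoint A"
  shows "selfadjoint (\<lambda>x. A x - t *\<^sub>R x)"
  using assms
  by (auto simp: selfadjoint_iff inner_diff_left inner_diff_right intro!: bounded_clinear_intros)

text \<open>The projection is the one onto the kernel of the positive part of \<open>A - t\<close>.\<close>

lemma half_line_projection:
  fixes A :: "'a :: chilbert_space \<Rightarrow> 'a"
  assumes A: "selfadjoint A"
  obtains E where "orth_projection E"
    "\<And>W x. selfadjoint W \<Longrightarrow> (\<And>x. W (A x) = A (W x)) \<Longrightarrow> E (W x) = W (E x)"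
    "\<And>x. E x = x \<Longrightarrow> inner (A x) x \<le> t * (norm x)\<^sup>2"
    "\<And>x. E x = 0 \<Longrightarrow> x \<noteq> 0 \<Longrightarrow> inner (A x) x > t * (norm x)\<^sup>2"
proof -
  define X where "X = (\<lambda>x. A x - t *\<^sub>R x)"
  have X: "selfadjoint X" unfolding X_def by (rule selfadjoint_diff_scaleR[OF A])
  note Xcl = selfadjoint_bounded_clinear[OF X]
  note absnn = nonneg_abs_op[OF X]
  note abscl = selfadjoint_bounded_clinear[OF nonneg_op_selfadjoint[OF absnn]]
  have absX: "X (abs_op X x) = abs_op X (X x)" for x
    by (rule abs_op_commute[OF X Xcl]) simp
  have U: "bounded_clinear (\<lambda>x. abs_op X x + X x)"
    by (intro bounded_clinear_intros abscl Xcl)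
  obtain E where E: "orth_projection E" and ker: "\<And>x. E x = x \<longleftrightarrow> abs_op X x + X x = 0"
    using orth_projection_kernel[OF U] by blast
  note Ecl = orth_projection_clinear[OF E]
  have form: "inner (X x) x = inner (A x) x - t * (norm x)\<^sup>2" for x
    by (simp add: X_def inner_diff_left power2_norm_eq_inner)
  show thesis
  proof (rule that[OF E])
    fix W x assume W: "selfadjoint W" and comm: "\<And>x. W (A x) = A (W x)"
    note Wcl = selfadjoint_bounded_clinear[OF W]
    have WX: "W (X x) = X (W x)" for x
      by (simp add: X_def comm bounded_clinear_diff[OF Wcl] bounded_clinear_scaleR[OF Wcl])
    have "W (abs_op X x) = abs_op X (W x)" for x
      by (rule abs_op_commute[OF X Wcl WX])
    then have WU: "W (abs_op X x + X x) = abs_op X (W x) + X (W x)" for x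
      by (simp add: bounded_clinear_add[OF Wcl] WX)
    show "E (W x) = W (E x)"
    proof (rule orth_projection_commuteI[OF E W])
      fix x
      have "abs_op X (E x) + X (E x) = 0"
        using ker[of "E x"] by (simp add: orth_projection_idem[OF E])
      then have "abs_op X (W (E x)) + X (W (E x)) = 0"
        using WU[of "E x"] by (simp add: bounded_clinear_zero[OF Wcl])
      then show "E (W (E x)) = W (E x)" by (simp add: ker)
    qed
  next
    fix x assume "E x = x"
    then have "X x = - abs_op X x" by (simp add: ker eq_neg_iff_add_eq_0 add.commute)
    then have "inner (X x) x \<le> 0" using nonneg_op_inner[OF absnn, of x] by simp
    then show "inner (A x) x \<le> t * (norm x)\<^sup>2" by (simp add: form)
  next
    fix x assume Ex: "E x = 0" and x: "x \<noteq> 0"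
    have orth: "inner (E y) x = 0" for y by (simp add: orth_projection_inner[OF E] Ex)
    \<comment> \<open>\<open>(|X| + X) (|X| - X) = |X|\<^sup>2 - X\<^sup>2 = 0\<close>, so
      \<open>|X| - X\<close> maps into the range of \<open>E\<close>, to which \<open>x\<close> is
      orthogonal.\<close>
    have ranV: "inner (abs_op X y - X y) x = 0" for y
    proof -
      have "abs_op X (abs_op X y - X y) + X (abs_op X y - X y) = 0"
        by (simp add: bounded_clinear_diff[OF abscl] bounded_clinear_diff[OF Xcl] absX
            abs_op_square[OF X])
      then have "E (abs_op X y - X y) = abs_op X y - X y" by (simp add: ker)
      then show ?thesis using orth[of "abs_op X y - X y"] by simp
    qed
    have "inner y (abs_op X x - X x) = inner y 0" for y
      using ranV[of y]
      by (simp add: inner_diff_left inner_diff_right selfadjoint_inner[OF X]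
          selfadjoint_inner[OF nonneg_op_selfadjoint[OF absnn]])
    then have Xabs: "X x = abs_op X x"
      using inner_eqI[of "abs_op X x - X x" 0] by simp
    \<comment> \<open>Strictness: a vector with vanishing form would lie in the kernel of
      \<open>|X| + X\<close>, which is the range of \<open>E\<close>.\<close>
    have "inner (X x) x \<noteq> 0"
    proof
      assume "inner (X x) x = 0"
      then have "abs_op X x = 0" using nonneg_op_eq_zero[OF absnn] Xabs by simp
      then have "E x = x" by (simp add: ker Xabs)
      then show False using Ex x by simp
    qed
    then have "inner (X x) x > 0" using nonneg_op_inner[OF absnn, of x] Xabs by simp
    then show "inner (A x) x > t * (norm x)\<^sup>2" by (simp add: form)
  qed
qed

text \<open>For a monotone family of projections the squared distance of two values at
  \<open>x\<close> is an increment of squared norms. Convergence of real numbers thus gives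
  convergence of vectors.\<close>

lemma Cauchy_if_sq_dist_le:
  fixes y :: "nat \<Rightarrow> 'a :: real_normed_vector"
  assumes f: "Cauchy f" and le: "\<And>m n. n \<le> m \<Longrightarrow> (norm (y m - y n))\<^sup>2 \<le> \<bar>f m - f n :: real\<bar>"
  shows "Cauchy y"
proof (rule metric_CauchyI)
  fix e :: real assume "e > 0"
  then obtain N where N: "\<And>m n. m \<ge> N \<Longrightarrow> n \<ge> N \<Longrightarrow> dist (f m) (f n) < e\<^sup>2"
    using metric_CauchyD[OF f, of "e\<^sup>2"] by auto
  have "dist (y m) (y n) < e" if "n \<le> m" "m \<ge> N" "n \<ge> N" for m n
  proof -
    have "(norm (y m - y n))\<^sup>2 < e\<^sup>2"
      using le[OF that(1)] N[OF that(2,3)] by (simp add: dist_real_def)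
    then show ?thesis using \<open>e > 0\<close> by (simp add: dist_norm power2_less_imp_less)
  qed
  then show "\<exists>M. \<forall>m\<ge>M. \<forall>n\<ge>M. dist (y m) (y n) < e"
    by (metis dist_commute nle_le)
qed

lemma orth_projection_diff_norm:
  fixes P Q :: "'a :: chilbert_space \<Rightarrow> 'a"
  assumes P: "orth_projection P" and Q: "orth_projection Q" and PQ: "\<And>x. P (Q x) = P x"
  shows "(norm (Q x - P x))\<^sup>2 = (norm (Q x))\<^sup>2 - (norm (P x))\<^sup>2"
  using orth_projection_pythagoras[OF P, of "Q x"] by (simp add: PQ)

text \<open>The partial sums are projections, increasing with \<open>N\<close>; their squared norms
  at \<open>x\<close> stay below that of \<open>x\<close> and converge, and hence so do the partial
  sums at \<open>x\<close>.\<close>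

lemma orth_projections_sum:
  fixes P :: "nat \<Rightarrow> 'a :: chilbert_space \<Rightarrow> 'a"
  assumes P: "\<And>n. orth_projection (P n)" and orth: "\<And>m n x. m \<noteq> n \<Longrightarrow> P m (P n x) = 0"
  obtains Q where "orth_projection Q" "\<And>x. (\<lambda>n. P n x) sums Q x"
    "\<And>x. (\<lambda>n. (norm (P n x))\<^sup>2) sums (norm (Q x))\<^sup>2"
proof -
  define S where "S = (\<lambda>N x. \<Sum>n<N. P n x)"
  \<comment> \<open>The third clause carries the induction: it makes \<open>P N\<close> orthogonal
    to the partial sum it is added to.\<close>
  have S: "orth_projection (S N) \<and> (norm (S N x))\<^sup>2 = (\<Sum>n<N. (norm (P n x))\<^sup>2) \<and>
      (\<forall>k\<ge>N. \<forall>x. P k (S N x) = 0)" for N x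
  proof (induction N arbitrary: x)
    case 0
    then show ?case
      by (auto simp: S_def bounded_clinear_zero[OF orth_projection_clinear[OF P]]
          intro!: orth_projectionI bounded_clinear_intros)
  next
    case (Suc N)
    have SN: "orth_projection (S N)" and PS: "\<And>x k. k \<ge> N \<Longrightarrow> P k (S N x) = 0"
      using Suc.IH by blast+
    have SP: "S N (P N x) = 0" for x
      by (rule orth_projection_orthogonal_commute[OF P SN]) (simp add: PS)
    have eq: "S (Suc N) = (\<lambda>x. S N x + P N x)" by (simp add: S_def)
    show ?case
      unfolding eq using orth_projection_add[OF SN P SP] Suc.IH orth
      by (auto simp: PS bounded_clinear_add[OF orth_projection_clinear[OF P]])
  qed
  have SS: "S n (S m x) = S n x" if "n \<le> m" for n m x
  proof -
    have "P k (S m x) = P k x" if "k < m" for k m x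
      using that
    proof (induction m)
      case (Suc m)
      then show ?case
        using S[of m x] orth[of k m] orth_projection_idem[OF P]
        by (cases "k = m") (auto simp: S_def bounded_clinear_add[OF orth_projection_clinear[OF P]])
    qed simp
    then show ?thesis using that by (simp add: S_def)
  qed
  have Sle: "(\<Sum>n<N. (norm (P n x))\<^sup>2) \<le> (norm x)\<^sup>2" for N x
    using S[of N x] orth_projection_norm_le[of "S N" x] power_mono[of "norm (S N x)" "norm x" 2]
    by simp
  have summ: "summable (\<lambda>n. (norm (P n x))\<^sup>2)" for x
    by (rule summableI_nonneg_bounded[OF _ Sle]) simp
  have "\<exists>l. (\<lambda>N. S N x) \<longlonglongrightarrow> l" for x
  proof -
    have "Cauchy (\<lambda>N. \<Sum>n<N. (norm (P n x))\<^sup>2)"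
      using summ[of x] LIMSEQ_imp_Cauchy summable_LIMSEQ by blast
    then have "Cauchy (\<lambda>N. S N x)"
    proof (rule Cauchy_if_sq_dist_le)
      fix m n :: nat assume "n \<le> m"
      then have "(norm (S m x - S n x))\<^sup>2 = (norm (S m x))\<^sup>2 - (norm (S n x))\<^sup>2"
        using S SS by (intro orth_projection_diff_norm) auto
      then show "(norm (S m x - S n x))\<^sup>2
          \<le> \<bar>(\<Sum>n<m. (norm (P n x))\<^sup>2) - (\<Sum>k<n. (norm (P k x))\<^sup>2)\<bar>"
        using S[of m x] S[of n x] by simp
    qed
    then show ?thesis using Cauchy_convergent convergent_def by blast
  qed
  then obtain Q where Q: "\<And>x. (\<lambda>N. S N x) \<longlonglongrightarrow> Q x" by metis
  have Qcl: "bounded_clinear Q"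
    using S by (intro bounded_clinear_limit[OF _ Q, where k = 1])
      (auto intro: orth_projection_clinear orth_projection_norm_le)
  have SQ: "S N (Q x) = S N x" for N x
  proof -
    have "(\<lambda>m. S N (S m x)) \<longlonglongrightarrow> S N (Q x)"
      using S orth_projection_clinear by (intro bounded_clinear_tendsto[OF _ Q]) blast
    moreover have "(\<lambda>m. S N (S m x)) \<longlonglongrightarrow> S N x"
      by (rule tendsto_eventually) (auto simp: eventually_sequentially intro!: exI[of _ N] SS)
    ultimately show ?thesis using LIMSEQ_unique by blast
  qed
  show thesis
  proof (rule that)
    show "orth_projection Q"
    proof (rule orth_projectionI[OF Qcl])
      show "Q (Q x) = Q x" for x
        using Q[of "Q x"] Q[of x] LIMSEQ_unique by (simp add: SQ) blast
      show "inner (Q x) y = inner x (Q y)" for x y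
      proof -
        have "(\<lambda>N. inner (S N x) y) \<longlonglongrightarrow> inner (Q x) y"
          by (intro tendsto_intros Q)
        moreover have "(\<lambda>N. inner (S N x) y) \<longlonglongrightarrow> inner x (Q y)"
          using S orth_projection_inner[of "S _" x y] tendsto_inner[OF tendsto_const Q, of x y]
          by simp
        ultimately show ?thesis using LIMSEQ_unique by blast
      qed
    qed
    show "(\<lambda>n. P n x) sums Q x" for x
      using Q[of x] by (simp add: sums_def S_def)
    show "(\<lambda>n. (norm (P n x))\<^sup>2) sums (norm (Q x))\<^sup>2" for x
    proof -
      have "(\<lambda>N. (norm (S N x))\<^sup>2) \<longlonglongrightarrow> (norm (Q x))\<^sup>2"
        by (intro tendsto_intros Q)
      then show ?thesis using S[of _ x] by (simp add: sums_def)
    qed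
  qed
qed

text \<open>\<open>E t\<close> stands for the spectral projection of the half-line up to and
  including \<open>t\<close>: a weak inequality on its range, a strict one on its kernel.
  Monotonicity, right continuity and constancy outside a bounded interval are derived from this
  pair.\<close>

locale resolution_of_identity =
  fixes A :: "'a :: chilbert_space \<Rightarrow> 'a" and E :: "real \<Rightarrow> 'a \<Rightarrow> 'a"
  assumes A: "selfadjoint A"
    and proj: "orth_projection (E t)"
    and comm_A: "E t (A x) = A (E t x)"
    and comm: "E s (E t x) = E t (E s x)"
    and below: "E t x = x \<Longrightarrow> inner (A x) x \<le> t * (norm x)\<^sup>2"
    and above: "E t x = 0 \<Longrightarrow> x \<noteq> 0 \<Longrightarrow> inner (A x) x > t * (norm x)\<^sup>2"

text \<open>Each half-line projection commutes with every selfadjoint operator commuting with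
  \<open>A\<close>. Applied to \<open>A\<close> itself and then to \<open>E t\<close>, this gives
  mutual commutation of independently chosen projections.\<close>

lemma resolution_of_identity_exists:
  fixes A :: "'a :: chilbert_space \<Rightarrow> 'a"
  assumes A: "selfadjoint A"
  obtains E where "resolution_of_identity A E"
proof -
  define good where "good t E \<longleftrightarrow> orth_projection E \<and>
      (\<forall>W. selfadjoint W \<longrightarrow> (\<forall>x. W (A x) = A (W x)) \<longrightarrow> (\<forall>x. E (W x) = W (E x))) \<and>
      (\<forall>x. E x = x \<longrightarrow> inner (A x) x \<le> t * (norm x)\<^sup>2) \<and>
      (\<forall>x. E x = 0 \<longrightarrow> x \<noteq> 0 \<longrightarrow> inner (A x) x > t * (norm x)\<^sup>2)" for t E
  have "\<exists>E. good t E" for t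
    by (rule half_line_projection[OF A, of t]) (auto simp: good_def)
  then obtain E where E: "\<And>t. good t (E t)" by metis
  have Eproj: "orth_projection (E t)" for t using E[of t] by (simp add: good_def)
  have Ecomm: "E t (W x) = W (E t x)"
    if "selfadjoint W" "\<And>x. W (A x) = A (W x)" for t W x
    using E[of t] that by (simp add: good_def)
  have comm_A: "E t (A x) = A (E t x)" for t x by (rule Ecomm[OF A]) simp
  have "E s (E t x) = E t (E s x)" for s t x
    by (rule Ecomm) (use Eproj comm_A in \<open>auto simp: orth_projection_def\<close>)
  then have "resolution_of_identity A E"
    unfolding resolution_of_identity_def
    using A E Eproj comm_A by (simp add: good_def)
  then show thesis by (rule that)
qed

context resolution_of_identity
begin

lemma E_clinear: "bounded_clinear (E t)"
  by (rule orth_projection_clinear[OF proj])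

text \<open>A nonzero \<open>z\<close> in the range of \<open>E s\<close> and the kernel of
  \<open>E t\<close> would satisfy t |z|^2 < <A z, z> <= s |z|^2.\<close>

lemma mono:
  assumes "s \<le> t"
  shows "E s (E t x) = E s x" "E t (E s x) = E s x"
proof -
  have "E s x - E t (E s x) = 0"
  proof (rule ccontr)
    let ?z = "E s x - E t (E s x)"
    assume z: "?z \<noteq> 0"
    have "E t ?z = 0"
      by (simp add: bounded_clinear_diff[OF E_clinear] orth_projection_idem[OF proj])
    then have "inner (A ?z) ?z > t * (norm ?z)\<^sup>2" using z by (rule above)
    moreover have "E s ?z = ?z"
      by (simp add: bounded_clinear_diff[OF E_clinear] orth_projection_idem[OF proj] comm[of s t])
    then have "inner (A ?z) ?z \<le> s * (norm ?z)\<^sup>2" by (rule below)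
    ultimately have "t * (norm ?z)\<^sup>2 < s * (norm ?z)\<^sup>2" by linarith
    then show False using assms by (simp add: mult_less_cancel_right)
  qed
  then show "E t (E s x) = E s x" by simp
  then show "E s (E t x) = E s x" by (simp add: comm[of s t])
qed

definition F :: "'a \<Rightarrow> real \<Rightarrow> real" where "F x t = (norm (E t x))\<^sup>2"

lemma F_diff: "s \<le> t \<Longrightarrow> (norm (E t x - E s x))\<^sup>2 = F x t - F x s"
  unfolding F_def by (rule orth_projection_diff_norm[OF proj proj]) (rule mono)

lemma F_mono: "s \<le> t \<Longrightarrow> F x s \<le> F x t"
  using F_diff[of s t x] zero_le_power2[of "norm (E t x - E s x)"] by linarith

lemma bounds:
  obtains k where "k > 0" "\<And>t x. t \<le> - k \<Longrightarrow> E t x = 0" "\<And>t x. t \<ge> k \<Longrightarrow> E t x = x"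
proof -
  obtain k where k: "k > 0" "\<And>x. norm (A x) \<le> k * norm x"
    using bounded_clinear_bound selfadjoint_bounded_clinear[OF A] by blast
  have q: "\<bar>inner (A x) x\<bar> \<le> k * (norm x)\<^sup>2" for x
    using Cauchy_Schwarz_ineq2[of "A x" x] mult_right_mono[OF k(2), of "norm x" x]
    by (simp add: power2_eq_square)
  show thesis
  \<comment> \<open>The inequality on the range of \<open>E t\<close> is weak, so the bound
    \<open>k\<close> alone would leave \<open>t = - k\<close> open, where an eigenvalue may
    sit.\<close>
  proof (rule that[of "k + 1"])
    show "k + 1 > 0" using k by simp
    show "E t x = 0" if t: "t \<le> - (k + 1)" for t x
    proof (rule ccontr)
      assume nz: "E t x \<noteq> 0"
      have "inner (A (E t x)) (E t x) \<le> t * (norm (E t x))\<^sup>2"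
        by (rule below) (rule orth_projection_idem[OF proj])
      then have "- k * (norm (E t x))\<^sup>2 \<le> t * (norm (E t x))\<^sup>2" using q[of "E t x"] by linarith
      then have "- k \<le> t" by (rule mult_right_le_imp_le) (use nz in simp)
      then show False using t by simp
    qed
    show "E t x = x" if t: "t \<ge> k + 1" for t x
    proof (rule ccontr)
      let ?z = "x - E t x"
      assume "E t x \<noteq> x"
      then have nz: "?z \<noteq> 0" by simp
      have "E t ?z = 0" by (simp add: bounded_clinear_diff[OF E_clinear] orth_projection_idem[OF proj])
      then have "inner (A ?z) ?z > t * (norm ?z)\<^sup>2" using nz by (rule above)
      then have "t * (norm ?z)\<^sup>2 < k * (norm ?z)\<^sup>2" using q[of ?z] by linarith
      then show False using t by (simp add: mult_less_cancel_right)
    qed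
  qed
qed

text \<open>Let \<open>z\<close> be the limit of the decreasing values. Its part
  \<open>u = z - E t z\<close> lies in the kernel of \<open>E t\<close> and in the range of every
  \<open>E s\<close> with \<open>s > t\<close>. If \<open>u\<close> were nonzero, its Rayleigh
  quotient \<open>r\<close> would exceed \<open>t\<close> strictly and yet be at most every such
  \<open>s\<close>; take \<open>s\<close> halfway between.\<close>

lemma right_continuous_E:
  "(\<lambda>n. E (t + 1 / real (Suc n)) x) \<longlonglongrightarrow> E t x"
proof -
  let ?d = "\<lambda>n. t + 1 / real (Suc n)"
  let ?y = "\<lambda>n. E (?d n) x"
  have dmono: "?d m \<le> ?d n" if "n \<le> m" for m n
    using that by (simp add: frac_le)
  have "decseq (\<lambda>n. F x (?d n))"
    using dmono F_mono by (simp add: decseq_def)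
  moreover have "\<forall>n. 0 \<le> F x (?d n)" by (simp add: F_def)
  ultimately have "convergent (\<lambda>n. F x (?d n))"
    by (metis decseq_convergent convergentI)
  then have "Cauchy (\<lambda>n. F x (?d n))" by (simp add: convergent_Cauchy)
  then have "Cauchy ?y"
  proof (rule Cauchy_if_sq_dist_le)
    fix m n :: nat assume "n \<le> m"
    have "(norm (?y m - ?y n))\<^sup>2 = (norm (?y n - ?y m))\<^sup>2" by (simp add: norm_minus_commute)
    also have "\<dots> = F x (?d n) - F x (?d m)" by (rule F_diff[OF dmono[OF \<open>n \<le> m\<close>]])
    finally show "(norm (?y m - ?y n))\<^sup>2 \<le> \<bar>F x (?d m) - F x (?d n)\<bar>" by simp
  qed
  then obtain z where z: "?y \<longlonglongrightarrow> z" using Cauchy_convergent convergent_def by blast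
  have Ez: "E s z = z" if s: "s > t" for s
  proof -
    obtain N where N: "1 / real (Suc N) < s - t" using s nat_approx_posE[of "s - t"] by auto
    have "E s (?y n) = ?y n" if "n \<ge> N" for n
      using N dmono[OF that] by (intro mono) simp
    then have "(\<lambda>n. E s (?y n)) \<longlonglongrightarrow> z"
      by (intro Lim_transform_eventually[OF z])
        (auto simp: eventually_sequentially simp del: of_nat_Suc intro!: exI[of _ N])
    moreover have "(\<lambda>n. E s (?y n)) \<longlonglongrightarrow> E s z"
      by (rule bounded_clinear_tendsto[OF E_clinear z])
    ultimately show ?thesis using LIMSEQ_unique by blast
  qed
  define u where "u = z - E t z"
  have "E t u = 0"
    by (simp add: u_def bounded_clinear_diff[OF E_clinear] orth_projection_idem[OF proj])
  have Eu: "E s u = u" if "s > t" for s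
    using that by (simp add: u_def bounded_clinear_diff[OF E_clinear] comm[of s t] Ez)
  have "u = 0"
  proof (rule ccontr)
    assume "u \<noteq> 0"
    define r where "r = inner (A u) u / (norm u)\<^sup>2"
    have "r > t"
      using above[OF \<open>E t u = 0\<close> \<open>u \<noteq> 0\<close>] \<open>u \<noteq> 0\<close> by (simp add: r_def pos_less_divide_eq)
    then have "inner (A u) u \<le> ((r + t) / 2) * (norm u)\<^sup>2" by (intro below Eu) simp
    then have "r \<le> (r + t) / 2" using \<open>u \<noteq> 0\<close> by (simp add: r_def pos_divide_le_eq)
    then show False using \<open>r > t\<close> by simp
  qed
  moreover have "E t z = E t x"
  proof -
    have "E t (?y n) = E t x" for n by (rule mono) simp
    with bounded_clinear_tendsto[OF E_clinear z, of t] have "(\<lambda>n. E t x) \<longlonglongrightarrow> E t z" by simp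
    then show ?thesis by (simp add: LIMSEQ_const_iff)
  qed
  ultimately show ?thesis using z by (simp add: u_def)
qed

lemma F_right_continuous: "continuous (at_right t) (F x)"
proof -
  have "(\<lambda>n. F x (t + 1 / real (Suc n))) \<longlonglongrightarrow> F x t"
    unfolding F_def by (intro tendsto_intros right_continuous_E)
  then have "\<exists>d>0. F x (t + d) - F x t < e" if e: "e > 0" for e
  proof -
    obtain n where "dist (F x (t + 1 / real (Suc n))) (F x t) < e"
      using metric_LIMSEQ_D[OF \<open>(\<lambda>n. F x (t + 1 / real (Suc n))) \<longlonglongrightarrow> F x t\<close> e] by blast
    then show ?thesis by (intro exI[of _ "1 / real (Suc n)"]) (simp add: dist_real_def)
  qed
  then show ?thesis by (simp add: continuous_at_right_real_increasing F_mono)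
qed

definition \<mu> :: "'a \<Rightarrow> real measure" where "\<mu> x = interval_measure (F x)"

lemma sets_\<mu>: "sets (\<mu> x) = sets borel" and space_\<mu>: "space (\<mu> x) = UNIV"
  by (simp_all add: \<mu>_def)

lemma \<mu>_Ioc: "s \<le> t \<Longrightarrow> measure (\<mu> x) {s<..t} = F x t - F x s"
  unfolding \<mu>_def by (rule measure_interval_measure_Ioc[OF _ F_mono F_right_continuous])

lemma \<mu>_finite: "finite_measure (\<mu> x)" and \<mu>_UNIV: "measure (\<mu> x) UNIV = (norm x)\<^sup>2"
proof -
  obtain k where k: "k > 0" "\<And>t x. t \<le> - k \<Longrightarrow> E t x = 0" "\<And>t x. t \<ge> k \<Longrightarrow> E t x = x"
    using bounds by blast
  have bot: "(F x \<longlongrightarrow> 0) at_bot"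
    by (rule tendsto_eventually)
      (use k(2) in \<open>auto simp: F_def eventually_at_bot_linorder intro!: exI[of _ "-k"]\<close>)
  have top: "(F x \<longlongrightarrow> (norm x)\<^sup>2) at_top"
    by (rule tendsto_eventually)
      (use k(3) in \<open>auto simp: F_def eventually_at_top_linorder intro!: exI[of _ k]\<close>)
  note * = F_mono F_right_continuous bot top zero_le_power2
  show "finite_measure (\<mu> x)"
    using finite_borel_measure_interval_measure[OF *] by (simp add: \<mu>_def finite_borel_measure_def)
  show "measure (\<mu> x) UNIV = (norm x)\<^sup>2"
    using interval_measure_UNIV[OF *] by (simp add: \<mu>_def measure_def)
qed

end

section \<open>The spectral measure\<close>

text \<open>After \<open>n\<close> bisections each increment of \<open>g\<close> carries an extra
  factor \<open>1 / 2 ^ n\<close>, while the increments of \<open>F\<close> telescope. This takes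
  the place of Riemann-Stieltjes sums in \<open>integral_\<mu>\<close>.\<close>

lemma eq_if_increment_le:
  fixes g F :: "real \<Rightarrow> real"
  assumes le: "\<And>s t. a \<le> s \<Longrightarrow> s \<le> t \<Longrightarrow> t \<le> b \<Longrightarrow> \<bar>g t - g s\<bar> \<le> (t - s) * (F t - F s)"
    and "a \<le> b"
  shows "g a = g b"
proof -
  have bisect: "\<bar>g t - g s\<bar> \<le> (t - s) / 2 ^ n * (F t - F s)" if "a \<le> s" "s \<le> t" "t \<le> b" for s t n
    using that
  proof (induction n arbitrary: s t)
    case 0
    then show ?case using le by simp
  next
    case (Suc n)
    let ?m = "(s + t) / 2"
    have "\<bar>g t - g ?m\<bar> \<le> (t - ?m) / 2 ^ n * (F t - F ?m)"
      "\<bar>g ?m - g s\<bar> \<le> (?m - s) / 2 ^ n * (F ?m - F s)"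
      using Suc.prems by (intro Suc.IH; simp)+
    moreover have "t - ?m = (t - s) / 2" "?m - s = (t - s) / 2" by (simp_all add: field_simps)
    ultimately have "\<bar>g t - g s\<bar> \<le> (t - s) / 2 / 2 ^ n * (F t - F ?m) + (t - s) / 2 / 2 ^ n * (F ?m - F s)"
      by simp
    also have "\<dots> = (t - s) / 2 / 2 ^ n * (F t - F s)"
      by (simp only: distrib_left[symmetric]) simp
    finally show ?case by simp
  qed
  have "(\<lambda>n. (b - a) * (F b - F a) * (1 / 2) ^ n) \<longlonglongrightarrow> (b - a) * (F b - F a) * 0"
    by (intro tendsto_intros LIMSEQ_power_zero) simp
  then have "\<bar>g b - g a\<bar> \<le> (b - a) * (F b - F a) * 0"
  proof (rule LIMSEQ_le_const)
    have "\<bar>g b - g a\<bar> \<le> (b - a) * (F b - F a) * (1 / 2) ^ n" for n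
      using bisect[OF order_refl \<open>a \<le> b\<close> order_refl, of n] by (simp add: power_divide)
    then show "\<exists>N. \<forall>n\<ge>N. \<bar>g b - g a\<bar> \<le> (b - a) * (F b - F a) * (1 / 2) ^ n" by blast
  qed
  then show ?thesis by simp
qed

context resolution_of_identity
begin

text \<open>The value of the spectral measure at \<open>S\<close>, characterised by scalar measures
  alone, so that it can be constructed by induction over the Borel sets without choosing anything
  along the way.\<close>

definition rep :: "real set \<Rightarrow> ('a \<Rightarrow> 'a) \<Rightarrow> bool" where
  "rep S P \<longleftrightarrow> orth_projection P \<and> (\<forall>x. (norm (P x))\<^sup>2 = measure (\<mu> x) S)"

lemma rep_projection: "rep S P \<Longrightarrow> orth_projection P"
  and rep_norm: "rep S P \<Longrightarrow> (norm (P x))\<^sup>2 = measure (\<mu> x) S"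
  by (simp_all add: rep_def)

lemma rep_unique: "rep S P \<Longrightarrow> rep S Q \<Longrightarrow> P = Q"
  unfolding rep_def by (metis orth_projection_eqI norm_ge_zero power2_eq_iff_nonneg)

lemma \<mu>_Un:
  assumes "S \<in> sets borel" "T \<in> sets borel" "S \<inter> T = {}"
  shows "measure (\<mu> x) (S \<union> T) = measure (\<mu> x) S + measure (\<mu> x) T"
proof -
  interpret finite_measure "\<mu> x" by (rule \<mu>_finite)
  show ?thesis using assms by (intro finite_measure_Union) (simp_all add: sets_\<mu>)
qed

lemma \<mu>_le: "measure (\<mu> x) S \<le> (norm x)\<^sup>2"
  using finite_measure.bounded_measure[OF \<mu>_finite, of x S] by (simp add: space_\<mu> \<mu>_UNIV)

text \<open>At the vector \<open>Q x\<close> the set \<open>T\<close> already carries the full mass,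
  so nothing is left for the disjoint set \<open>S\<close>.\<close>

lemma rep_orthogonal:
  assumes P: "rep S P" and Q: "rep T Q"
    and "S \<in> sets borel" "T \<in> sets borel" "S \<inter> T = {}"
  shows "P (Q x) = 0"
proof -
  have "(norm (P (Q x)))\<^sup>2 + (norm (Q (Q x)))\<^sup>2 = measure (\<mu> (Q x)) (S \<union> T)"
    using \<mu>_Un[OF assms(3-5)] by (simp add: rep_norm[OF P] rep_norm[OF Q])
  also have "\<dots> \<le> (norm (Q x))\<^sup>2" by (rule \<mu>_le)
  finally show ?thesis by (simp add: orth_projection_idem[OF rep_projection[OF Q]])
qed

lemma rep_Un:
  assumes P: "rep S P" and Q: "rep T Q"
    and "S \<in> sets borel" "T \<in> sets borel" "S \<inter> T = {}"
  shows "rep (S \<union> T) (\<lambda>x. P x + Q x)"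
  using orth_projection_add[OF rep_projection[OF P] rep_projection[OF Q] rep_orthogonal[OF assms]]
  by (simp add: rep_def \<mu>_Un[OF assms(3-5)] rep_norm[OF P] rep_norm[OF Q])

lemma rep_UN:
  assumes P: "\<And>n. rep (S n) (P n)" and S: "range S \<subseteq> sets borel" and disj: "disjoint_family S"
  obtains Q where "rep (\<Union>n. S n) Q" "\<And>x. (\<lambda>n. P n x) sums Q x"
proof -
  have "P m (P n x) = 0" if "m \<noteq> n" for m n x
    using S disj that by (intro rep_orthogonal[OF P P]) (auto simp: disjoint_family_on_def)
  then obtain Q where Q: "orth_projection Q" "\<And>x. (\<lambda>n. P n x) sums Q x"
    "\<And>x. (\<lambda>n. (norm (P n x))\<^sup>2) sums (norm (Q x))\<^sup>2"
    using orth_projections_sum[of P] rep_projection[OF P] by blast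
  have "(norm (Q x))\<^sup>2 = measure (\<mu> x) (\<Union>n. S n)" for x
  proof -
    interpret finite_measure "\<mu> x" by (rule \<mu>_finite)
    have "(\<lambda>n. measure (\<mu> x) (S n)) sums measure (\<mu> x) (\<Union>n. S n)"
      using S disj by (intro finite_measure_UNION) (simp_all add: sets_\<mu>)
    then show ?thesis using Q(3)[of x] sums_unique2 by (simp add: rep_norm[OF P]) blast
  qed
  then have "rep (\<Union>n. S n) Q" using Q(1) by (simp add: rep_def)
  then show thesis using that Q(2) by blast
qed

text \<open>Dynkin's pi-lambda argument from half-open intervals: complements correspond to
  \<open>1 - P\<close> and disjoint unions to sums of mutually orthogonal projections.\<close>

lemma rep_exists:
  assumes "S \<in> sets borel"
  shows "\<exists>P. rep S P"
proof -
  let ?G = "range (\<lambda>(a, b). {a<..b :: real})"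
  have borel: "sets borel = sigma_sets UNIV ?G"
    unfolding borel_sigma_sets_Ioc by (rule sets_measure_of) simp
  have "Int_stable ?G"
  proof (rule Int_stableI)
    fix S T assume "S \<in> ?G" "T \<in> ?G"
    then obtain a b c d where "S = {a<..b}" "T = {c<..d}" by auto
    then show "S \<inter> T \<in> ?G" by (intro image_eqI[of _ _ "(max a c, min b d)"]) auto
  qed
  moreover have "?G \<subseteq> Pow UNIV" by simp
  moreover have "S \<in> sigma_sets UNIV ?G" using assms borel by simp
  ultimately show ?thesis
  proof (induction rule: sigma_sets_induct_disjoint)
    case (basic S)
    then obtain a b where S: "S = {a<..b}" by auto
    show ?case
    proof (cases "a \<le> b")
      case True
      have "orth_projection (\<lambda>x. E b x - E a x)"
        by (rule orth_projectionI)
          (simp_all add: bounded_clinear_intros E_clinear bounded_clinear_diff[OF E_clinear]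
            orth_projection_idem[OF proj] mono[OF True] inner_diff_left inner_diff_right
            orth_projection_inner[OF proj])
      then have "rep S (\<lambda>x. E b x - E a x)"
        using F_diff[OF True] \<mu>_Ioc[OF True] by (simp add: rep_def S)
      then show ?thesis by blast
    next
      case False
      then have "rep S (\<lambda>x. 0)"
        by (auto simp: rep_def S intro!: orth_projectionI bounded_clinear_intros)
      then show ?thesis by blast
    qed
  next
    case empty
    have "rep {} (\<lambda>x. 0)"
      by (auto simp: rep_def intro!: orth_projectionI bounded_clinear_intros)
    then show ?case by blast
  next
    case (compl S)
    then obtain P where P: "rep S P" by blast
    have "measure (\<mu> x) (UNIV - S) = (norm x)\<^sup>2 - measure (\<mu> x) S" for x
      using finite_measure.finite_measure_compl[OF \<mu>_finite, of S x] compl(1) borel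
      by (simp add: sets_\<mu> space_\<mu> \<mu>_UNIV)
    moreover have "(norm (x - P x))\<^sup>2 = (norm x)\<^sup>2 - measure (\<mu> x) S" for x
      using orth_projection_pythagoras[OF rep_projection[OF P], of x]
      by (simp add: rep_norm[OF P])
    ultimately have "rep (UNIV - S) (\<lambda>x. x - P x)"
      using orth_projection_complement[OF rep_projection[OF P]] by (simp add: rep_def)
    then show ?case by blast
  next
    case (union S)
    then obtain P where "\<And>n. rep (S n) (P n)" by metis
    moreover have "range S \<subseteq> sets borel" unfolding borel by (rule union(2))
    ultimately obtain Q where "rep (\<Union>n. S n) Q" using rep_UN[of S P] union(1) by blast
    then show ?case by blast
  qed
qed

section \<open>The projection-valued measure of A\<close>

definition pvm :: "real set \<Rightarrow> 'a \<Rightarrow> 'a" where "pvm S = (SOME P. rep S P)"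

lemma rep_pvm: "S \<in> sets borel \<Longrightarrow> rep S (pvm S)"
  unfolding pvm_def using someI_ex[OF rep_exists] .

lemma pvm_eqI: "S \<in> sets borel \<Longrightarrow> rep S P \<Longrightarrow> pvm S = P"
  using rep_pvm rep_unique by blast

lemma pvm_Un:
  assumes "S \<in> sets borel" "T \<in> sets borel" "S \<inter> T = {}"
  shows "pvm (S \<union> T) x = pvm S x + pvm T x"
  using pvm_eqI[OF _ rep_Un[OF rep_pvm rep_pvm assms]] assms by simp

lemma pvm_disjoint:
  assumes "S \<in> sets borel" "T \<in> sets borel" "S \<inter> T = {}"
  shows "pvm S (pvm T x) = 0"
  using rep_orthogonal[OF rep_pvm rep_pvm] assms by simp

text \<open>Split \<open>S\<close> and \<open>T\<close> into their intersection and the two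
  differences; by disjointness every mixed product vanishes.\<close>

lemma pvm_Int:
  assumes S: "S \<in> sets borel" and T: "T \<in> sets borel"
  shows "pvm (S \<inter> T) x = pvm S (pvm T x)"
proof -
  have sets: "S \<inter> T \<in> sets borel" "S - T \<in> sets borel" "T - S \<in> sets borel" using S T by auto
  have "pvm S y = pvm (S \<inter> T) y + pvm (S - T) y" for y
    using pvm_Un[of "S \<inter> T" "S - T" y] sets by (auto simp: Int_Diff_Un)
  moreover have "pvm T x = pvm (S \<inter> T) x + pvm (T - S) x"
    using pvm_Un[of "S \<inter> T" "T - S" x] sets by (auto simp: Int_Diff_Un Int_commute[of S T])
  moreover have "pvm (S - T) (pvm (S \<inter> T) x) = 0" "pvm (S - T) (pvm (T - S) x) = 0"
    "pvm (S \<inter> T) (pvm (T - S) x) = 0"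
    using sets by (auto intro!: pvm_disjoint)
  moreover note rep_projection[OF rep_pvm[OF sets(1)]] rep_projection[OF rep_pvm[OF sets(2)]]
  ultimately show ?thesis
    by (simp add: bounded_clinear_add[OF orth_projection_clinear] orth_projection_idem)
qed

lemma pvm_UNIV: "pvm UNIV = id"
  by (rule pvm_eqI)
    (auto simp: rep_def \<mu>_UNIV id_def intro!: orth_projectionI bounded_clinear_intros)

lemma pvm_sums:
  assumes S: "range S \<subseteq> sets borel" and disj: "disjoint_family S"
  shows "(\<lambda>n. pvm (S n) x) sums pvm (\<Union>n. S n) x"
proof -
  obtain Q where Q: "rep (\<Union>n. S n) Q" "\<And>x. (\<lambda>n. pvm (S n) x) sums Q x"
    using rep_UN[OF rep_pvm S disj] S by auto
  have "pvm (\<Union>n. S n) = Q" using S by (intro pvm_eqI[OF _ Q(1)]) auto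
  then show ?thesis using Q(2) by simp
qed

text \<open>\<open>is_spectral_measure\<close> speaks of the measure rebuilt from \<open>pvm\<close>
  by \<open>measure_of\<close>, whereas the integrals are computed for the Lebesgue-Stieltjes
  measure.\<close>

lemma scalar_measure_pvm: "scalar_measure pvm x = \<mu> x"
proof -
  interpret finite_measure "\<mu> x" by (rule \<mu>_finite)
  have "ennreal (Re (cinner (pvm S x) x)) = emeasure (\<mu> x) S" if "S \<in> sets borel" for S
    using rep_norm[OF rep_pvm[OF that], of x]
      orth_projection_norm[OF rep_projection[OF rep_pvm[OF that]], of x]
    by (simp add: Re_cinner emeasure_eq_measure)
  then have "scalar_measure pvm x = measure_of UNIV (sets borel) (emeasure (\<mu> x))"
    unfolding scalar_measure_def
    using sets.sigma_sets_eq[of "borel :: real measure"] by (intro measure_of_eq) auto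
  also have "\<dots> = \<mu> x"
    using measure_of_of_measure[of "\<mu> x"] by (simp add: sets_\<mu> space_\<mu>)
  finally show ?thesis .
qed

text \<open>Both <A E_t x, x> and the integral of the identity over \<open>{-k<..t}\<close> have
  increments between \<open>s * (F x t - F x s)\<close> and \<open>t * (F x t - F x s)\<close>. By
  \<open>eq_if_increment_le\<close> their difference \<open>g\<close> takes the same value at
  \<open>-k\<close> and \<open>k\<close>, and it vanishes at \<open>-k\<close>.\<close>

lemma integrable_\<mu>: "integrable (\<mu> x) (\<lambda>t. t)"
  and integral_\<mu>: "(\<integral>t. t \<partial>\<mu> x) = inner (A x) x"
proof -
  interpret finite_measure "\<mu> x" by (rule \<mu>_finite)
  obtain k where k: "k > 0" "\<And>t x. t \<le> - k \<Longrightarrow> E t x = 0" "\<And>t x. t \<ge> k \<Longrightarrow> E t x = x"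
    using bounds by blast
  note Acl = selfadjoint_bounded_clinear[OF A]
  have "measure (\<mu> x) (UNIV - {-k<..k}) = 0"
    using finite_measure_compl[of "{-k<..k}"] \<mu>_Ioc[of "-k" k x] k
    by (simp add: sets_\<mu> space_\<mu> \<mu>_UNIV F_def)
  then have null: "UNIV - {-k<..k} \<in> null_sets (\<mu> x)"
    by (simp add: null_sets_def emeasure_eq_measure sets_\<mu>)
  have AE: "AE t in \<mu> x. t \<in> {-k<..k}"
    by (rule AE_I'[OF null]) auto
  have meas: "(\<lambda>t. t) \<in> borel_measurable (\<mu> x)"
    by (simp add: measurable_cong_sets[OF sets_\<mu> refl])
  show int: "integrable (\<mu> x) (\<lambda>t. t)"
    by (rule integrable_const_bound[of _ k]) (use AE meas in auto)
  have seti: "set_integrable (\<mu> x) {s<..t} (\<lambda>t. t)" for s t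
    unfolding set_integrable_def using int by (intro integrable_mult_indicator) (simp_all add: sets_\<mu>)
  define I where "I = (\<lambda>t. LINT u:{-k<..t}|\<mu> x. u)"
  define g where "g = (\<lambda>t. inner (A (E t x)) x - I t)"
  have "g (-k) = g k"
  proof (rule eq_if_increment_le[where F = "F x" and g = g and a = "-k" and b = k])
    fix s t assume st: "-k \<le> s" "s \<le> t" "t \<le> k"
    let ?y = "E t x - E s x"
    have Ey: "E t ?y = ?y" "E s ?y = 0"
      by (simp_all add: bounded_clinear_diff[OF E_clinear] orth_projection_idem[OF proj] mono[OF st(2)])
    have lower: "s * (norm ?y)\<^sup>2 \<le> inner (A ?y) ?y"
      using above[OF Ey(2)] by (cases "?y = 0") (auto simp: bounded_clinear_zero[OF Acl])
    have upper: "inner (A ?y) ?y \<le> t * (norm ?y)\<^sup>2" by (rule below[OF Ey(1)])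
    \<comment> \<open>\<open>A\<close> commutes with the projection \<open>E t - E s\<close>, so its
      form has no cross term between \<open>?y\<close> and \<open>x - ?y\<close>.\<close>
    have Ay: "inner (A (E t x)) x - inner (A (E s x)) x = inner (A ?y) ?y"
    proof -
      have "inner (A ?y) x = inner (A (E t ?y)) x - inner (A (E s ?y)) x"
        by (simp add: Ey bounded_clinear_zero[OF Acl])
      also have "\<dots> = inner (A ?y) ?y"
        by (simp add: comm_A[symmetric] orth_projection_inner[OF proj] inner_diff_right)
      finally show ?thesis by (simp add: bounded_clinear_diff[OF Acl] inner_diff_left)
    qed
    have F: "(norm ?y)\<^sup>2 = F x t - F x s" by (rule F_diff[OF st(2)])
    have "{-k<..t} = {-k<..s} \<union> {s<..t}" using st by auto
    then have "I t = I s + (LINT u:{s<..t}|\<mu> x. u)"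
      unfolding I_def by (simp add: set_integral_Un seti)
    moreover have "s * (F x t - F x s) \<le> (LINT u:{s<..t}|\<mu> x. u)"
      "(LINT u:{s<..t}|\<mu> x. u) \<le> t * (F x t - F x s)"
    proof -
      have c: "set_integrable (\<mu> x) {s<..t} (\<lambda>_. c)" and
        "(LINT u:{s<..t}|\<mu> x. c) = c * (F x t - F x s)" for c :: real
        using \<mu>_Ioc[OF st(2), of x]
        using integrable_real_indicator[of "{s<..t}" "\<mu> x"]
        by (simp_all add: set_integrable_def set_lebesgue_integral_def sets_\<mu> mult.commute
            emeasure_eq_measure)
      then show "s * (F x t - F x s) \<le> (LINT u:{s<..t}|\<mu> x. u)"
        "(LINT u:{s<..t}|\<mu> x. u) \<le> t * (F x t - F x s)"
        using set_integral_mono[OF c[of s] seti[of s t]] set_integral_mono[OF seti[of s t] c[of t]]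
        by auto
    qed
    ultimately show "\<bar>g t - g s\<bar> \<le> (t - s) * (F x t - F x s)"
      using lower upper Ay unfolding F g_def left_diff_distrib by linarith
  qed (use k in simp)
  moreover have "g (-k) = 0" 
    by (simp add: g_def I_def k set_lebesgue_integral_def bounded_clinear_zero[OF Acl])
  moreover have "I k = (\<integral>t. t \<partial>\<mu> x)"
    unfolding I_def set_lebesgue_integral_def
    by (rule integral_cong_AE) (use AE meas in \<open>auto simp: sets_\<mu>\<close>)
  ultimately show "(\<integral>t. t \<partial>\<mu> x) = inner (A x) x"
    by (simp add: g_def k)
qed

lemma is_spectral_measure_pvm: "is_spectral_measure A pvm"
  unfolding is_spectral_measure_def
  using rep_projection[OF rep_pvm] pvm_UNIV pvm_Int pvm_sums integrable_\<mu> integral_\<mu>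
  by (auto simp: scalar_measure_pvm selfadjoint_cinner_self[OF A])

end

theorem spectral_measure_exists:
  fixes A :: "'a :: chilbert_space \<Rightarrow> 'a"
  assumes "selfadjoint A"
  obtains E where "is_spectral_measure A E"
  using resolution_of_identity_exists[OF assms] resolution_of_identity.is_spectral_measure_pvm
  by metis

section \<open>The number of negative squares\<close>

text \<open>\<open>measure_of\<close> returns the prescribed values only for a countably additive
  function; here this comes from the pointwise sigma-additivity of \<open>E\<close>.\<close>

lemma emeasure_scalar_measure:
  fixes X :: "'a :: chilbert_space \<Rightarrow> 'a"
  assumes E: "is_spectral_measure X E" and S: "S \<in> sets borel"
  shows "emeasure (scalar_measure E x) S = ennreal ((norm (E S x))\<^sup>2)"
proof -
  have proj: "orth_projection (E S)" if "S \<in> sets borel" for S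
    using E that by (simp add: is_spectral_measure_def)
  have norm: "Re (cinner (E S x) x) = (norm (E S x))\<^sup>2" if "S \<in> sets borel" for S
    by (simp add: Re_cinner orth_projection_norm[OF proj[OF that]])
  have sums: "(\<lambda>n. E (F n) x) sums E (\<Union>n. F n) x"
    if "range F \<subseteq> sets borel" "disjoint_family F" for F :: "nat \<Rightarrow> real set"
    using E that by (simp add: is_spectral_measure_def)
  show ?thesis
    unfolding scalar_measure_def norm[OF S, symmetric]
  proof (rule emeasure_measure_of_sigma)
    show "sigma_algebra UNIV (sets (borel :: real measure))"
      using sets.sigma_algebra_axioms[of "borel :: real measure"] by simp
    have "E {} x = 0"
    proof -
      have "(\<lambda>n :: nat. E {} x) sums E (\<Union>n :: nat. {}) x"
        by (rule sums) (auto simp: disjoint_family_on_def)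
      then have "summable (\<lambda>n :: nat. E {} x)" by (rule sums_summable)
      then show ?thesis by (simp add: summable_const_iff)
    qed
    then show "positive (sets borel) (\<lambda>S. ennreal (Re (cinner (E S x) x)))"
      by (simp add: positive_def Re_cinner)
    show "countably_additive (sets borel) (\<lambda>S. ennreal (Re (cinner (E S x) x)))"
    proof (rule countably_additiveI)
      fix F :: "nat \<Rightarrow> real set"
      assume F: "range F \<subseteq> sets borel" "disjoint_family F" "\<Union> (range F) \<in> sets borel"
      have "(\<lambda>n. inner (E (F n) x) x) sums inner (E (\<Union>n. F n) x) x"
        using bounded_linear.sums[OF bounded_linear_inner_left sums[OF F(1,2)]] .
      then show "(\<Sum>n. ennreal (Re (cinner (E (F n) x) x))) = ennreal (Re (cinner (E (\<Union> (range F)) x) x))"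
        using F(1) norm by (intro suminf_ennreal_eq) (auto simp: Re_cinner)
    qed
  qed (rule S)
qed

lemma sets_scalar_measure: "sets (scalar_measure E x) = sets borel"
  and space_scalar_measure: "space (scalar_measure E x) = UNIV"
  using sets.sigma_sets_eq[of "borel :: real measure"] by (simp_all add: scalar_measure_def)

text \<open>\<open>nu_minus\<close> picks an arbitrary spectral measure, and
  \<open>is_spectral_measure\<close> states only the quadratic form of \<open>X\<close>. So even the
  commutation of \<open>P\<close> with \<open>X\<close> has to be recovered from scalar
  integrals.\<close>

lemma spectral_measure_negative_part:
  fixes X :: "'a :: chilbert_space \<Rightarrow> 'a"
  assumes X: "selfadjoint X" and E: "is_spectral_measure X E"
  defines "P \<equiv> E {..<0}"
  shows "orth_projection P" "P (X x) = X (P x)"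
    "P x = x \<Longrightarrow> x \<noteq> 0 \<Longrightarrow> inner (X x) x < 0"
    "P x = 0 \<Longrightarrow> 0 \<le> inner (X x) x"
proof -
  let ?N = "{..<0 :: real}" and ?M = "scalar_measure E"
  note Xcl = selfadjoint_bounded_clinear[OF X]
  have proj: "orth_projection (E S)" if "S \<in> sets borel" for S
    using E that by (simp add: is_spectral_measure_def)
  have Int: "E (S \<inter> T) x = E S (E T x)" if "S \<in> sets borel" "T \<in> sets borel" for S T x
    using E that by (simp add: is_spectral_measure_def)
  have int: "integrable (?M x) (\<lambda>t. t)" and form: "inner (X x) x = (\<integral>t. t \<partial>?M x)" for x
    using E selfadjoint_cinner_self[OF X] by (simp_all add: is_spectral_measure_def)
  note em = emeasure_scalar_measure[OF E]
  have UNIV: "E UNIV = id" using E by (simp add: is_spectral_measure_def)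
  have P: "orth_projection P" unfolding P_def by (rule proj) simp
  then show "orth_projection P" .
  note Pcl = orth_projection_clinear[OF P]
  have compl: "E (- ?N) = (\<lambda>x. x - P x)"
  proof (rule orth_projection_eqI)
    fix x
    have "emeasure (?M x) ?N + emeasure (?M x) (- ?N) = emeasure (?M x) UNIV"
      by (subst plus_emeasure)
        (simp_all add: sets_scalar_measure Compl_partition del: Compl_lessThan)
    then have "ennreal ((norm (P x))\<^sup>2 + (norm (E (- ?N) x))\<^sup>2) = ennreal ((norm x)\<^sup>2)"
      by (simp add: em UNIV P_def del: Compl_lessThan)
    then have "(norm (P x))\<^sup>2 + (norm (E (- ?N) x))\<^sup>2 = (norm x)\<^sup>2"
      by (subst (asm) ennreal_inj) auto
    then have "(norm (E (- ?N) x))\<^sup>2 = (norm (x - P x))\<^sup>2"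
      using orth_projection_pythagoras[OF P, of x] by linarith
    then show "norm (E (- ?N) x) = norm (x - P x)"
      by (simp add: power2_eq_iff_nonneg)
  qed (auto intro: orth_projection_complement[OF P] proj)
  \<comment> \<open>By multiplicativity of \<open>E\<close>, passing from \<open>x\<close> to
    \<open>E S x\<close> multiplies the scalar measure by the indicator of \<open>S\<close>.\<close>
  have part: "(\<integral>t. indicator S t * t \<partial>?M x) = inner (X (E S x)) (E S x)" if S: "S \<in> sets borel" for S x
  proof -
    have "?M (E S x) = density (?M x) (indicator S)"
    proof (rule measure_eqI)
      fix T assume "T \<in> sets (?M (E S x))"
      then have T: "T \<in> sets borel" by (simp add: sets_scalar_measure)
      have "emeasure (?M (E S x)) T = ennreal ((norm (E (S \<inter> T) x))\<^sup>2)"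
        using S T by (simp add: em Int[of T S, symmetric] Int_commute)
      also have "\<dots> = emeasure (density (?M x) (indicator S)) T"
        using S T by (simp add: emeasure_restricted sets_scalar_measure em)
      finally show "emeasure (?M (E S x)) T = emeasure (density (?M x) (indicator S)) T" .
    qed (simp add: sets_scalar_measure)
    also have "\<dots> = density (?M x) (\<lambda>t. ennreal (indicator S t))"
      by (simp add: ennreal_indicator)
    finally have "(\<integral>t. t \<partial>?M (E S x)) = (\<integral>t. t \<partial>density (?M x) (\<lambda>t. ennreal (indicator S t)))"
      by (simp only:)
    also have "\<dots> = (\<integral>t. indicator S t *\<^sub>R t \<partial>?M x)"
    proof (rule integral_density)
      show "indicat_real S \<in> borel_measurable (?M x)"
        using S by (simp add: measurable_cong_sets[OF sets_scalar_measure refl])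
    qed (simp_all add: borel_measurable_integrable[OF int])
    finally have "(\<integral>t. t \<partial>?M (E S x)) = (\<integral>t. indicator S t *\<^sub>R t \<partial>?M x)" .
    then show ?thesis by (simp add: form)
  qed
  have split: "inner (X x) x = inner (X (P x)) (P x) + inner (X (x - P x)) (x - P x)" for x
  proof -
    have i: "integrable (?M x) (\<lambda>t. indicator S t * t)" if "S \<in> sets borel" for S
      using integrable_mult_indicator[OF _ int, of S x] that by (simp add: sets_scalar_measure)
    have "inner (X x) x = (\<integral>t. indicator ?N t * t + indicator (- ?N) t * t \<partial>?M x)"
      unfolding form by (rule Bochner_Integration.integral_cong) (auto simp: indicator_def)
    also have "\<dots> = (\<integral>t. indicator ?N t * t \<partial>?M x) + (\<integral>t. indicator (- ?N) t * t \<partial>?M x)"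
      by (intro Bochner_Integration.integral_add i) auto
    finally show ?thesis
      using part[of ?N x] part[of "- ?N" x] by (simp add: compl P_def[symmetric] del: Compl_lessThan)
  qed
  \<comment> \<open>At \<open>P a + (b - P b)\<close> the identity \<open>split\<close> leaves just
    the two equal cross terms.\<close>
  have orth: "inner (X (P a)) (b - P b) = 0" for a b
    using split[of "P a + (b - P b)"]
    by (simp add: bounded_clinear_add[OF Xcl] bounded_clinear_add[OF Pcl] bounded_clinear_diff[OF Pcl]
        orth_projection_idem[OF P] inner_add_left inner_add_right)
      (simp add: selfadjoint_inner[OF X] inner_commute)
  show "P (X x) = X (P x)"
  proof (rule orth_projection_commuteI[OF P X])
    fix x
    show "P (X (P x)) = X (P x)"
    proof (rule inner_eqI)
      show "inner y (P (X (P x))) = inner y (X (P x))" for y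
        using orth[of x y]
        by (simp add: inner_diff_right inner_commute orth_projection_inner[OF P, symmetric])
    qed
  qed
  \<comment> \<open>The measure of \<open>x\<close> lives on the negative axis and has positive
    mass, so its first moment is strictly negative.\<close>
  show "inner (X x) x < 0" if Px: "P x = x" and "x \<noteq> 0"
  proof -
    have "emeasure (?M x) (- ?N) = ennreal ((norm (E (- ?N) (E ?N x)))\<^sup>2)"
      using Px by (simp add: em P_def del: Compl_lessThan)
    also have "\<dots> = emeasure (?M x) {}"
      by (subst Int[symmetric]) (simp_all add: em del: Compl_lessThan emeasure_empty)
    finally have "- ?N \<in> null_sets (?M x)"
      by (simp add: null_sets_def sets_scalar_measure del: Compl_lessThan)
    then have "AE t in ?M x. t < 0" by (rule AE_I') auto
    moreover have "emeasure (?M x) (space (?M x)) \<noteq> 0"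
      using \<open>x \<noteq> 0\<close> by (simp add: space_scalar_measure em UNIV)
    ultimately have "(\<integral>t. t \<partial>?M x) < (\<integral>t. 0 \<partial>?M x)"
      by (intro finite_measure.integral_less_AE_space int finite_measureI)
        (auto simp: space_scalar_measure em)
    then show ?thesis by (simp add: form)
  qed
  show "0 \<le> inner (X x) x" if "P x = 0"
  proof -
    have "?N \<in> null_sets (?M x)"
      using that by (simp add: null_sets_def sets_scalar_measure em P_def)
    then have "AE t in ?M x. 0 \<le> t" by (rule AE_I') auto
    then show ?thesis unfolding form by (rule integral_nonneg_AE)
  qed
qed

text \<open>The interface between the spectral theorem and the linear algebra that follows: a
  reducing projection whose range is negative for \<open>X\<close> and whose kernel is
  nonnegative.\<close>

definition splits_negative :: "('a :: chilbert_space \<Rightarrow> 'a) \<Rightarrow> ('a \<Rightarrow> 'a) \<Rightarrow> bool" where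
  "splits_negative X P \<longleftrightarrow> orth_projection P \<and> (\<forall>x. P (X x) = X (P x)) \<and>
    (\<forall>x. P x = x \<longrightarrow> x \<noteq> 0 \<longrightarrow> inner (X x) x < 0) \<and> (\<forall>x. P x = 0 \<longrightarrow> 0 \<le> inner (X x) x)"

lemma splits_negativeD:
  assumes "splits_negative X P"
  shows splits_negative_projection: "orth_projection P"
    and splits_negative_commute: "P (X x) = X (P x)"
    and splits_negative_neg: "P x = x \<Longrightarrow> x \<noteq> 0 \<Longrightarrow> inner (X x) x < 0"
    and splits_negative_nonneg: "P x = 0 \<Longrightarrow> 0 \<le> inner (X x) x"
  using assms by (auto simp: splits_negative_def)

lemma splits_negative_range:
  fixes X :: "'a :: chilbert_space \<Rightarrow> 'a"
  assumes P: "splits_negative X P" and "x \<in> range P" "x \<noteq> 0"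
  shows "inner (X x) x < 0"
  using assms orth_projection_idem[OF splits_negative_projection[OF P]]
  by (auto intro!: splits_negative_neg[OF P])

lemma splits_negative_clinear:
  fixes X :: "'a :: chilbert_space \<Rightarrow> 'a"
  shows "splits_negative X P \<Longrightarrow> bounded_clinear P"
  by (simp add: orth_projection_clinear splits_negative_projection)

lemma splits_negative_exists:
  fixes X :: "'a :: chilbert_space \<Rightarrow> 'a"
  assumes X: "selfadjoint X"
  obtains P where "splits_negative X P" "nu_minus X = cdimension (range P)"
proof -
  define E where "E = (SOME E. is_spectral_measure X E)"
  obtain E' where "is_spectral_measure X E'" using spectral_measure_exists[OF X] .
  then have E: "is_spectral_measure X E" unfolding E_def by (rule someI[of "is_spectral_measure X"])
  show thesis
  proof (rule that)
    show "splits_negative X (E {..<0})"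
      unfolding splits_negative_def using spectral_measure_negative_part[OF X E] by blast
    show "nu_minus X = cdimension (range (E {..<0}))"
      by (simp add: nu_minus_def spectral_subspace_def E_def)
  qed
qed

section \<open>Dimensions of negative subspaces\<close>

abbreviation cspan :: "'a :: complex_inner set \<Rightarrow> 'a set" where
  "cspan \<equiv> complex_vector.span"

abbreviation cindependent :: "'a :: complex_inner set \<Rightarrow> bool" where
  "cindependent b \<equiv> \<not> complex_vector.dependent b"

abbreviation clinear :: "('a :: complex_inner \<Rightarrow> 'b :: complex_inner) \<Rightarrow> bool" where
  "clinear \<equiv> Vector_Spaces.linear scaleC scaleC"

lemma clinearI:
  fixes T :: "'a :: complex_inner \<Rightarrow> 'b :: complex_inner"
  assumes "\<And>x y. T (x + y) = T x + T y" "\<And>a x. T (a *\<^sub>C x) = a *\<^sub>C T x"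
  shows "clinear T"
  unfolding Vector_Spaces.linear_iff
  using assms by (intro conjI complex_vector.vector_space_axioms) auto

lemma bounded_clinear_clinear: "bounded_clinear T \<Longrightarrow> clinear T"
  by (intro clinearI bounded_clinear_add bounded_clinear_scaleC)

lemma cindependent_image:
  fixes T :: "'a :: complex_inner \<Rightarrow> 'b :: complex_inner"
  assumes T: "clinear T" and c: "cindependent c" and inj: "\<And>x. x \<in> cspan c \<Longrightarrow> T x = 0 \<Longrightarrow> x = 0"
  shows "cindependent (T ` c)" "inj_on T (cspan c)"
proof -
  interpret T: Vector_Spaces.linear "scaleC :: complex \<Rightarrow> 'a \<Rightarrow> 'a" "scaleC :: complex \<Rightarrow> 'b \<Rightarrow> 'b" T
    by (rule T)
  show inj': "inj_on T (cspan c)"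
  proof (rule inj_onI)
    fix x y assume "x \<in> cspan c" "y \<in> cspan c" "T x = T y"
    then have "x - y \<in> cspan c" "T (x - y) = 0"
      by (simp_all add: complex_vector.span_diff T.diff)
    then show "x = y" using inj by fastforce
  qed
  show "cindependent (T ` c)" by (rule T.independent_injective_image[OF c inj'])
qed

text \<open>A vector of the negative subspace killed by \<open>T\<close> would have both
  \<open>q x < 0\<close> and \<open>0 \<le> q x\<close>, so \<open>T\<close> is injective there and
  carries \<open>c\<close> to an independent set in \<open>cspan b\<close>.\<close>

lemma negative_definite_card_le:
  fixes T :: "'a :: complex_inner \<Rightarrow> 'b :: complex_inner" and q :: "'a \<Rightarrow> real"
  assumes T: "clinear T" and c: "cindependent c"
    and neg: "\<And>x. x \<in> cspan c \<Longrightarrow> x \<noteq> 0 \<Longrightarrow> q x < 0"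
    and ker: "\<And>x. T x = 0 \<Longrightarrow> 0 \<le> q x"
    and b: "finite b" "range T \<subseteq> cspan b"
  shows "finite c \<and> card c \<le> card b"
proof -
  have inj: "x = 0" if "x \<in> cspan c" "T x = 0" for x
    using neg[OF that(1)] ker[OF that(2)] by (cases "x = 0") auto
  have "inj_on T c"
    using cindependent_image(2)[OF T c inj] complex_vector.span_superset inj_on_subset by blast
  moreover have "finite (T ` c) \<and> card (T ` c) \<le> card b"
    using cindependent_image(1)[OF T c inj] b
    by (intro complex_vector.independent_span_bound) auto
  ultimately show ?thesis by (simp add: finite_image_iff card_image)
qed

lemma cdimension_finite:
  assumes "cindependent b" "finite b"
  shows "cdimension (cspan b) = enat (card b)"
  using assms complex_vector.dim_span_eq_card_independent by (auto simp: cdimension_def)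

lemma csubspace_range:
  fixes T :: "'a :: complex_inner \<Rightarrow> 'b :: complex_inner"
  assumes "clinear T"
  shows "complex_vector.subspace (range T)"
proof -
  interpret T: Vector_Spaces.linear "scaleC :: complex \<Rightarrow> 'a \<Rightarrow> 'a" "scaleC :: complex \<Rightarrow> 'b \<Rightarrow> 'b" T
    by (rule assms)
  show ?thesis by (rule T.subspace_image) (rule complex_vector.subspace_UNIV)
qed

lemma range_basis:
  fixes T :: "'a :: complex_inner \<Rightarrow> 'b :: complex_inner"
  assumes "clinear T"
  obtains b where "cindependent b" "cspan b = range T"
proof -
  obtain b where b: "b \<subseteq> range T" "cindependent b" "range T \<subseteq> cspan b"
    by (rule complex_vector.basis_exists[of "range T"])
  have "cspan b \<subseteq> range T"
    by (rule complex_vector.span_minimal[OF b(1) csubspace_range[OF assms]])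
  with b(3) have "cspan b = range T" by (rule subset_antisym[rotated])
  with b(2) show thesis by (rule that)
qed

lemma nu_minus_le:
  fixes X :: "'a :: chilbert_space \<Rightarrow> 'a" and T :: "'a \<Rightarrow> 'b :: complex_inner"
  assumes X: "selfadjoint X" and T: "clinear T" and b: "finite b" "range T \<subseteq> cspan b"
    and ker: "\<And>x. T x = 0 \<Longrightarrow> 0 \<le> inner (X x) x"
  shows "nu_minus X \<le> enat (card b)"
proof -
  obtain P where P: "splits_negative X P" "nu_minus X = cdimension (range P)"
    using splits_negative_exists[OF X] .
  obtain c where c: "cindependent c" "cspan c = range P"
    using range_basis[OF bounded_clinear_clinear[OF splits_negative_clinear[OF P(1)]]] .
  have "finite c \<and> card c \<le> card b"
    using splits_negative_range[OF P(1)]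
    by (intro negative_definite_card_le[OF T c(1) _ ker b]) (auto simp only: c(2))
  then show ?thesis using cdimension_finite[OF c(1)] by (simp add: P(2) c(2))
qed

text \<open>Finiteness of \<open>cdimension\<close> provides a finite spanning set; this bounds the
  basis \<open>b\<close>, which is obtained with no information on its size.\<close>

lemma nu_minus_finiteE:
  fixes X :: "'a :: chilbert_space \<Rightarrow> 'a"
  assumes X: "selfadjoint X" and fin: "nu_minus X < \<infinity>"
  obtains P b where "splits_negative X P" "finite b" "cindependent b" "cspan b = range P"
    "nu_minus X = enat (card b)"
proof -
  obtain P where P: "splits_negative X P" "nu_minus X = cdimension (range P)"
    using splits_negative_exists[OF X] .
  obtain b where b: "cindependent b" "cspan b = range P"
    using range_basis[OF bounded_clinear_clinear[OF splits_negative_clinear[OF P(1)]]] .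
  obtain b' where b': "finite b'" "cspan b' = range P"
    using fin P(2) by (auto simp: cdimension_def split: if_splits)
  have "b \<subseteq> cspan b'" using complex_vector.span_superset[of b] b(2) b'(2) by simp
  then have "finite b" using complex_vector.independent_span_bound[OF b'(1) b(1)] by simp
  with P b show thesis using cdimension_finite[OF b(1)] that by simp
qed

section \<open>Finite dimensional subspaces and factorization\<close>

instantiation prod :: (complex_inner, complex_inner) complex_inner
begin

definition scaleC_prod :: "complex \<Rightarrow> 'a \<times> 'b \<Rightarrow> 'a \<times> 'b" where
  "scaleC_prod a x = (a *\<^sub>C fst x, a *\<^sub>C snd x)"

definition cinner_prod :: "'a \<times> 'b \<Rightarrow> 'a \<times> 'b \<Rightarrow> complex" where
  "cinner_prod x y = cinner (fst x) (fst y) + cinner (snd x) (snd y)"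

instance
proof
  show "cinner x y = cnj (cinner y x)" for x y :: "'a \<times> 'b"
    by (simp add: cinner_prod_def flip: cinner_commute)
qed (simp_all add: scaleC_prod_def cinner_prod_def scaleC_add_right scaleC_add_left scaleC_scaleC
    scaleC_of_real cinner_add_left cinner_scaleC_left Re_cinner inner_prod_def scaleR_prod_def
    distrib_left)

end

lemma scaleC_Pair: "a *\<^sub>C (x, y) = (a *\<^sub>C x, a *\<^sub>C y)"
  by (simp add: scaleC_prod_def)

lemma clinear_compose:
  fixes S :: "'b :: complex_inner \<Rightarrow> 'c :: complex_inner" and T :: "'a :: complex_inner \<Rightarrow> 'b"
  assumes "clinear S" "clinear T"
  shows "clinear (\<lambda>x. S (T x))"
  using assms by (intro clinearI) (simp_all add: Vector_Spaces.linear_iff)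

definition pair_basis ::
    "'a :: complex_inner set \<Rightarrow> 'b :: complex_inner set \<Rightarrow> ('a \<times> 'b) set" where
  "pair_basis b c = (\<lambda>x. (x, 0)) ` b \<union> (\<lambda>y. (0, y)) ` c"

lemma cspan_Pair_zero:
  "cspan ((\<lambda>x. (x, 0 :: 'b :: complex_inner)) ` b) = (\<lambda>x. (x, 0)) ` cspan (b :: 'a :: complex_inner set)"
  "cspan ((\<lambda>y. (0 :: 'a, y)) ` c) = (\<lambda>y. (0, y)) ` cspan (c :: 'b set)"
proof -
  have 1: "clinear (\<lambda>x :: 'a. (x, 0 :: 'b))" and 2: "clinear (\<lambda>y :: 'b. (0 :: 'a, y))"
    by (intro clinearI; simp add: scaleC_Pair)+
  interpret f: Vector_Spaces.linear scaleC scaleC "\<lambda>x :: 'a. (x, 0 :: 'b)" by (rule 1)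
  interpret g: Vector_Spaces.linear scaleC scaleC "\<lambda>y :: 'b. (0 :: 'a, y)" by (rule 2)
  show "cspan ((\<lambda>x. (x, 0 :: 'b)) ` b) = (\<lambda>x. (x, 0)) ` cspan b" by (rule f.span_image)
  show "cspan ((\<lambda>y. (0 :: 'a, y)) ` c) = (\<lambda>y. (0, y)) ` cspan c" by (rule g.span_image)
qed

lemma cspan_pair_basis: "cspan (pair_basis b c) = cspan b \<times> cspan c"
  unfolding pair_basis_def complex_vector.span_Un cspan_Pair_zero by force

lemma finite_pair_basis: "finite b \<Longrightarrow> finite c \<Longrightarrow> finite (pair_basis b c)"
  by (simp add: pair_basis_def)

lemma card_pair_basis:
  assumes "finite b" "finite c" "cindependent b"
  shows "card (pair_basis b c) = card b + card c"
proof -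
  have "0 \<notin> b" using assms(3) complex_vector.dependent_zero by blast
  then have "(\<lambda>x. (x, 0)) ` b \<inter> (\<lambda>y. (0, y)) ` c = {}" by auto
  then show ?thesis
    using assms by (simp add: pair_basis_def card_Un_disjoint card_image inj_on_def)
qed

lemma cindependent_pair_basis:
  assumes b: "finite b" "cindependent b" and c: "finite c" "cindependent c"
  shows "cindependent (pair_basis b c)"
proof (rule complex_vector.independent_if_scalars_zero)
  show "finite (pair_basis b c)" by (rule finite_pair_basis[OF b(1) c(1)])
  fix f p assume sum: "(\<Sum>p\<in>pair_basis b c. f p *\<^sub>C p) = 0" and p: "p \<in> pair_basis b c"
  have "0 \<notin> b" using b(2) complex_vector.dependent_zero by blast
  then have "(\<lambda>x. (x, 0)) ` b \<inter> (\<lambda>y. (0, y)) ` c = {}" by auto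
  then have "(\<Sum>p\<in>pair_basis b c. f p *\<^sub>C p)
      = (\<Sum>x\<in>b. f (x, 0) *\<^sub>C (x, 0)) + (\<Sum>y\<in>c. f (0, y) *\<^sub>C (0, y))"
    unfolding pair_basis_def using b(1) c(1)
    by (subst sum.union_disjoint) (simp_all add: sum.reindex inj_on_def)
  also have "\<dots> = (\<Sum>x\<in>b. f (x, 0) *\<^sub>C x, \<Sum>y\<in>c. f (0, y) *\<^sub>C y)"
    by (simp add: scaleC_Pair prod_eq_iff fst_sum snd_sum)
  finally have "(\<Sum>x\<in>b. f (x, 0) *\<^sub>C x) = 0" "(\<Sum>y\<in>c. f (0, y) *\<^sub>C y) = 0"
    using sum by (simp_all add: zero_prod_def)
  then have "\<forall>x\<in>b. f (x, 0) = 0" "\<forall>y\<in>c. f (0, y) = 0"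
    using complex_vector.independentD[OF b(2,1) subset_refl, of "\<lambda>x. f (x, 0)"]
      complex_vector.independentD[OF c(2,1) subset_refl, of "\<lambda>y. f (0, y)"] by blast+
  then show "f p = 0" using p by (auto simp: pair_basis_def)
qed

lemma cinner_sum_left: "cinner (\<Sum>i\<in>I. f i) y = (\<Sum>i\<in>I. cinner (f i) (y :: 'a :: complex_inner))"
proof -
  have "cinner 0 y = 0" using cinner_scaleC_left[of 0 0 y] by (simp)
  then show ?thesis by (induction I rule: infinite_finite_induct) (simp_all add: cinner_add_left)
qed

lemma norm_orthonormal_expansion:
  fixes u :: "'a :: complex_inner set"
  assumes u: "finite u" and on: "\<And>v w. v \<in> u \<Longrightarrow> w \<in> u \<Longrightarrow> cinner v w = (if v = w then 1 else 0)"
    and x: "x \<in> cspan u"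
  shows "(norm x)\<^sup>2 = (\<Sum>v\<in>u. (cmod (cinner x v))\<^sup>2)"
proof -
  obtain f where f: "x = (\<Sum>v\<in>u. f v *\<^sub>C v)"
    using x by (auto simp: complex_vector.span_finite[OF u])
  have coeff: "cinner x w = f w" if "w \<in> u" for w
  proof -
    have "cinner x w = (\<Sum>v\<in>u. if v = w then f v else 0)"
      unfolding f cinner_sum_left using on that by (intro sum.cong) (auto simp: cinner_scaleC_left)
    then show ?thesis using that u by simp
  qed
  have "cinner x x = (\<Sum>v\<in>u. f v * cinner v x)"
    by (subst (1) f) (simp add: cinner_sum_left cinner_scaleC_left)
  also have "\<dots> = (\<Sum>v\<in>u. complex_of_real ((cmod (cinner x v))\<^sup>2))"
    using coeff by (intro sum.cong refl) (simp add: cinner_commute[of _ x] complex_norm_square del: of_real_power)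
  finally have "complex_of_real ((norm x)\<^sup>2) = complex_of_real (\<Sum>v\<in>u. (cmod (cinner x v))\<^sup>2)"
    by (simp only: cinner_self of_real_sum)
  then show ?thesis by (simp only: of_real_eq_iff)
qed

text \<open>Gram-Schmidt, one vector at a time; a vanishing remainder \<open>e'\<close> leaves the
  system unchanged.\<close>

lemma finite_orthonormal_basis:
  fixes b :: "'a :: complex_inner set"
  assumes "finite b"
  shows "\<exists>u. finite u \<and> cspan u = cspan b \<and>
    (\<forall>v\<in>u. \<forall>w\<in>u. cinner v w = (if v = w then 1 else 0))"
  using assms
proof induction
  case empty
  show ?case by (rule exI[of _ "{}"]) simp
next
  case (insert e b)
  then obtain u where u: "finite u" "cspan u = cspan b"
    and on: "\<And>v w. v \<in> u \<Longrightarrow> w \<in> u \<Longrightarrow> cinner v w = (if v = w then 1 else 0)"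
    by blast
  define s where "s = (\<Sum>v\<in>u. cinner e v *\<^sub>C v)"
  define e' where "e' = e - s"
  have s: "s \<in> cspan u"
    unfolding s_def by (intro complex_vector.span_sum complex_vector.span_scale complex_vector.span_base)
  have span: "cspan (insert e u) = cspan (insert e b)"
    unfolding complex_vector.span_insert u(2) ..
  have diff: "cinner (x - y) w = cinner x w - cinner y w" for x y w :: 'a
    using cinner_add_left[of "x - y" y w] by simp
  have orth: "cinner e' w = 0" if "w \<in> u" for w
  proof -
    have "cinner s w = (\<Sum>v\<in>u. if v = w then cinner e v else 0)"
      unfolding s_def cinner_sum_left using on that
      by (intro sum.cong) (auto simp: cinner_scaleC_left)
    then show ?thesis using that u(1) by (simp add: e'_def diff)
  qed
  show ?case
  proof (cases "e' = 0")
    case True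
    then have "e \<in> cspan u" using s by (simp add: e'_def)
    then have "cspan u = cspan (insert e b)"
      using span complex_vector.span_redundant by blast
    then show ?thesis using u(1) on by blast
  next
    case False
    define v where "v = complex_of_real (1 / norm e') *\<^sub>C e'"
    have "norm v = 1"
      using False by (simp add: v_def norm_scaleC norm_divide)
    then have "cinner v v = 1" by (simp add: cinner_self)
    moreover have v: "cinner v w = 0" "cinner w v = 0" if "w \<in> u" for w
      using orth[OF that] cinner_commute[of w e']
      by (simp_all add: v_def cinner_scaleC_left cinner_scaleC_right)
    ultimately have on': "cinner x w = (if x = w then 1 else 0)"
      if "x \<in> insert v u" "w \<in> insert v u" for x w
      using that on by fastforce
    have "cspan (insert v u) = cspan (insert e u)"
    proof (subst complex_vector.span_eq, intro conjI)
      have su: "s \<in> cspan (insert x u)" for x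
        using s complex_vector.span_mono[of u "insert x u"] by blast
      have "e' \<in> cspan (insert e u)"
        unfolding e'_def by (intro complex_vector.span_diff su complex_vector.span_base) simp
      then show "insert v u \<subseteq> cspan (insert e u)"
        unfolding v_def by (auto intro: complex_vector.span_scale complex_vector.span_base)
      have "e = s + complex_of_real (norm e') *\<^sub>C v"
        using False by (simp add: v_def scaleC_scaleC scaleC_one e'_def flip: of_real_mult)
      also have "\<dots> \<in> cspan (insert v u)"
        by (intro complex_vector.span_add su complex_vector.span_scale complex_vector.span_base) simp
      finally show "insert e u \<subseteq> cspan (insert v u)"
        by (auto intro: complex_vector.span_base)
    qed
    then show ?thesis
      using span u(1) on' by (intro exI[of _ "insert v u"]) auto
  qed
qed

text \<open>A vector outside the image could be added to the image of a basis, giving an independent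
  set larger than the dimension.\<close>

lemma surjective_on_cspan:
  fixes R :: "'a :: complex_inner \<Rightarrow> 'a"
  assumes R: "clinear R" and b: "finite b" and inv: "R ` cspan b \<subseteq> cspan b"
    and inj: "\<And>x. x \<in> cspan b \<Longrightarrow> R x = 0 \<Longrightarrow> x = 0"
  shows "R ` cspan b = cspan b"
proof -
  interpret R: Vector_Spaces.linear scaleC scaleC R by (rule R)
  obtain c where c: "c \<subseteq> cspan b" "cindependent c" "cspan b \<subseteq> cspan c"
    by (rule complex_vector.basis_exists[of "cspan b"])
  have span: "cspan c = cspan b"
    using c complex_vector.span_minimal[OF c(1) complex_vector.subspace_span] by blast
  have fin: "finite c" using complex_vector.independent_span_bound[OF b c(2,1)] by blast
  have img: "cindependent (R ` c)" "inj_on R (cspan c)"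
    using cindependent_image[OF R c(2)] inj by (simp_all add: span)
  have card: "card (R ` c) = card c"
    using inj_on_subset[OF img(2) complex_vector.span_superset] by (rule card_image)
  have "v \<in> cspan (R ` c)" if "v \<in> cspan b" for v
  proof (rule ccontr)
    assume v: "v \<notin> cspan (R ` c)"
    then have "cindependent (insert v (R ` c))"
      by (rule complex_vector.independent_insertI[OF _ img(1)])
    moreover have "insert v (R ` c) \<subseteq> cspan c"
      using that inv c(1) by (auto simp: span)
    ultimately have "card (insert v (R ` c)) \<le> card c"
      using complex_vector.independent_span_bound[OF fin] by blast
    moreover have "v \<notin> R ` c" using v complex_vector.span_superset[of "R ` c"] by auto
    ultimately show False using fin card by simp
  qed
  then show ?thesis using inv by (auto simp: R.span_image span)
qed

text \<open>Write each vector \<open>v\<close> of an orthonormal basis as \<open>R (g v)\<close>.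
  The coordinate of \<open>x\<close> at \<open>v\<close> is then the inner product of
  \<open>R x\<close> with \<open>g v\<close>, hence controlled by \<open>norm (R x)\<close>.\<close>

lemma bounded_below_on_cspan:
  fixes R :: "'a :: chilbert_space \<Rightarrow> 'a"
  assumes R: "selfadjoint R" and b: "finite b" and inv: "R ` cspan b \<subseteq> cspan b"
    and inj: "\<And>x. x \<in> cspan b \<Longrightarrow> R x = 0 \<Longrightarrow> x = 0"
  obtains c where "c \<ge> 0" "\<And>x. x \<in> cspan b \<Longrightarrow> norm x \<le> c * norm (R x)"
proof -
  note Rcl = selfadjoint_bounded_clinear[OF R]
  obtain u where u: "finite u" "cspan u = cspan b"
    and on: "\<And>v w. v \<in> u \<Longrightarrow> w \<in> u \<Longrightarrow> cinner v w = (if v = w then 1 else 0)"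
    using finite_orthonormal_basis[OF b] by blast
  have surj: "R ` cspan b = cspan b"
    by (rule surjective_on_cspan[OF bounded_clinear_clinear[OF Rcl] b inv inj])
  have "\<exists>w. R w = v" if "v \<in> u" for v
  proof -
    have "v \<in> R ` cspan b" using complex_vector.span_base[OF that] by (simp add: surj u(2))
    then show ?thesis by blast
  qed
  then obtain g where g: "\<And>v. v \<in> u \<Longrightarrow> R (g v) = v" by metis
  \<comment> \<open>The factor 2 arises from bounding the real and the imaginary part of a
    coordinate separately.\<close>
  define c where "c = sqrt (\<Sum>v\<in>u. (2 * norm (g v))\<^sup>2)"
  show thesis
  proof (rule that)
    show "c \<ge> 0" by (simp add: c_def sum_nonneg)
    fix x assume x: "x \<in> cspan b"
    have coeff: "(cmod (cinner x v))\<^sup>2 \<le> (2 * norm (g v))\<^sup>2 * (norm (R x))\<^sup>2" if "v \<in> u" for v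
    proof -
      have "\<bar>inner x v\<bar> \<le> norm (g v) * norm (R x)"
        using Cauchy_Schwarz_ineq2[of "R x" "g v"] g[OF that]
        by (simp add: selfadjoint_inner[OF R] mult.commute)
      moreover have "\<bar>inner x (\<i> *\<^sub>C v)\<bar> \<le> norm (g v) * norm (R x)"
        using Cauchy_Schwarz_ineq2[of "R x" "\<i> *\<^sub>C g v"] g[OF that]
        by (simp add: selfadjoint_inner[OF R] bounded_clinear_scaleC[OF Rcl] norm_scaleC mult.commute)
      moreover have "cmod (cinner x v) \<le> \<bar>inner x v\<bar> + \<bar>inner x (\<i> *\<^sub>C v)\<bar>"
        using cmod_le[of "cinner x v"] by (simp add: cinner_eq_Complex)
      ultimately have "cmod (cinner x v) \<le> 2 * norm (g v) * norm (R x)" by simp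
      from power_mono[OF this, of 2] show ?thesis by (simp add: power_mult_distrib)
    qed
    have "(norm x)\<^sup>2 = (\<Sum>v\<in>u. (cmod (cinner x v))\<^sup>2)"
      using x u on by (intro norm_orthonormal_expansion) auto
    also have "\<dots> \<le> (\<Sum>v\<in>u. (2 * norm (g v))\<^sup>2) * (norm (R x))\<^sup>2"
      unfolding sum_distrib_right by (intro sum_mono coeff)
    also have "\<dots> = (c * norm (R x))\<^sup>2"
      by (simp add: c_def power_mult_distrib sum_nonneg)
    finally show "norm x \<le> c * norm (R x)"
      by (rule power2_le_imp_le) (simp add: c_def sum_nonneg)
  qed
qed

text \<open>For \<open>x\<close> orthogonal to the kernel, the Riesz lemma gives \<open>z\<close> in
  the closure of the range with the same inner products against the range. Then \<open>x - z\<close>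
  lies in the kernel and is orthogonal to it, so \<open>x = z\<close>.\<close>

lemma closure_range_selfadjoint:
  fixes T :: "'a :: chilbert_space \<Rightarrow> 'a"
  assumes T: "selfadjoint T" and P: "orth_projection P" "\<And>x. P x = x \<longleftrightarrow> T x = 0"
  shows "closure (range T) = {x. P x = 0}"
proof (intro equalityI subsetI)
  note Pcl = orth_projection_clinear[OF P(1)]
  have TP: "T (P x) = 0" for x using P(2)[of "P x"] orth_projection_idem[OF P(1)] by simp
  have PT: "P (T x) = 0" for x
  proof (rule inner_eqI)
    show "inner y (P (T x)) = inner y 0" for y
      using TP by (simp flip: orth_projection_inner[OF P(1)] selfadjoint_inner[OF T])
  qed
  have "closed {x. P x = 0}"
    using bounded_clinear_bounded_linear[OF Pcl]
    by (intro closed_Collect_eq continuous_intros linear_continuous_on)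
  then have sub: "closure (range T) \<subseteq> {x. P x = 0}" by (intro closure_minimal) (auto simp: PT)
  then show "x \<in> {x. P x = 0}" if "x \<in> closure (range T)" for x using that by blast
  fix x assume "x \<in> {x. P x = 0}"
  then have Px: "P x = 0" by simp
  have "linear (\<lambda>h. inner (T h) x)"
    by (intro linearI) (simp_all add: bounded_clinear_simps[OF selfadjoint_bounded_clinear[OF T]]
        inner_add_left)
  moreover have "\<bar>inner (T h) x\<bar> \<le> norm x * norm (T h)" for h
    using Cauchy_Schwarz_ineq2[of "T h" x] by (simp add: mult.commute)
  ultimately obtain z where z: "z \<in> closure (range T)" "\<And>h. inner (T h) x = inner (T h) z"
    using riesz_representation_range[OF subspace_UNIV
        bounded_clinear_linear[OF selfadjoint_bounded_clinear[OF T]], of "\<lambda>h. inner (T h) x" "norm x"]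
    by (metis UNIV_I)
  have "T (x - z) = 0"
  proof (rule inner_eqI)
    show "inner h (T (x - z)) = inner h 0" for h
      using z(2)[of h] by (simp add: inner_diff_right flip: selfadjoint_inner[OF T])
  qed
  then have "P (x - z) = x - z" by (simp add: P(2))
  moreover have "P z = 0" using z(1) sub by blast
  ultimately show "x \<in> closure (range T)" using Px z(1) by (simp add: bounded_clinear_diff[OF Pcl])
qed

lemma closure_rangeE:
  fixes f :: "'b \<Rightarrow> 'a :: real_normed_vector"
  assumes "z \<in> closure (range f)"
  obtains x where "(\<lambda>n. f (x n)) \<longlonglongrightarrow> z"
proof -
  obtain s where s: "\<And>n. s n \<in> range f" "s \<longlonglongrightarrow> z"
    using assms unfolding closure_sequential by blast
  have "s = (\<lambda>n. f (inv f (s n)))" using s(1) by (simp add: f_inv_into_f)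
  with s(2) show thesis using that[of "\<lambda>n. inv f (s n)"] by simp
qed

text \<open>For fixed \<open>y\<close> the functional \<open>inner x (G y)\<close> is dominated by
  \<open>norm (R x)\<close>, so it is represented through \<open>R\<close> by a vector
  \<open>K y\<close> in the closure of the range. \<open>R\<close> is injective on that closure,
  which makes \<open>K\<close> linear.\<close>

lemma douglas_factorization:
  fixes R :: "'a :: chilbert_space \<Rightarrow> 'a" and G :: "'b :: complex_inner \<Rightarrow> 'a"
  assumes R: "selfadjoint R" and G: "bounded_clinear G"
    and bound: "\<And>x y. \<bar>inner x (G y)\<bar> \<le> c * norm y * norm (R x)"
  obtains K where "bounded_clinear K" "range K \<subseteq> closure (range R)" "\<And>y. G y = R (K y)"
proof -
  note Rcl = selfadjoint_bounded_clinear[OF R]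
  obtain P where P: "orth_projection P" "\<And>x. P x = x \<longleftrightarrow> R x = 0"
    using orth_projection_kernel[OF Rcl] by blast
  note Pcl = orth_projection_clinear[OF P(1)]
  note cl = closure_range_selfadjoint[OF R P]
  have "\<exists>z\<in>closure (range R). G y = R z" for y
  proof -
    have "linear (\<lambda>x. inner x (G y))"
      by (intro linearI) (simp_all add: inner_add_left)
    then obtain z where z: "z \<in> closure (range R)" "\<And>x. inner x (G y) = inner (R x) z"
      using riesz_representation_range[OF subspace_UNIV bounded_clinear_linear[OF Rcl],
          of "\<lambda>x. inner x (G y)" "c * norm y"] bound by (metis UNIV_I)
    have "G y = R z" by (rule inner_eqI) (simp add: z(2) selfadjoint_inner[OF R])
    then show ?thesis using z(1) by blast
  qed
  then obtain K where PK: "\<And>y. P (K y) = 0" and K: "\<And>y. G y = R (K y)"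
    unfolding cl mem_Collect_eq Bex_def by metis
  have uniq: "v = w" if "P v = 0" "P w = 0" "R v = R w" for v w
  proof -
    have "P (v - w) = v - w" using that(3) by (simp add: P(2) bounded_clinear_diff[OF Rcl])
    then show ?thesis using that(1,2) by (simp add: bounded_clinear_diff[OF Pcl])
  qed
  have "bounded_clinear K"
  proof (rule bounded_clinearI)
    show "K (x + y) = K x + K y" for x y
      by (rule uniq) (simp_all add: PK bounded_clinear_add[OF Pcl] bounded_clinear_add[OF Rcl]
          bounded_clinear_add[OF G] flip: K)
    show "K (a *\<^sub>C x) = a *\<^sub>C K x" for a x
      by (rule uniq) (simp_all add: PK bounded_clinear_scaleC[OF Pcl]
          bounded_clinear_scaleC[OF Rcl] bounded_clinear_scaleC[OF G] flip: K)
    \<comment> \<open>Test the bound along vectors \<open>R (x n)\<close> tending to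
      \<open>K y\<close>. The sign of \<open>c\<close> is unknown, hence
      \<open>\<bar>c\<bar>\<close>.\<close>
    show "norm (K y) \<le> norm y * \<bar>c\<bar>" for y
    proof -
      have "K y \<in> closure (range R)" by (simp add: cl PK)
      then obtain x where x: "(\<lambda>n. R (x n)) \<longlonglongrightarrow> K y"
        by (rule closure_rangeE)
      have "inner (R (x n)) (K y) \<le> c * norm y * norm (R (x n))" for n
        using bound[of "x n" y] by (simp add: K selfadjoint_inner[OF R])
      moreover have "(\<lambda>n. inner (R (x n)) (K y)) \<longlonglongrightarrow> inner (K y) (K y)"
        "(\<lambda>n. c * norm y * norm (R (x n))) \<longlonglongrightarrow> c * norm y * norm (K y)"
        by (intro tendsto_intros x)+
      ultimately have "inner (K y) (K y) \<le> c * norm y * norm (K y)"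
        by (meson LIMSEQ_le)
      then have "norm (K y) * norm (K y) \<le> norm y * c * norm (K y)"
        by (simp add: power2_norm_eq_inner[symmetric] power2_eq_square mult.commute)
      then have "norm (K y) \<le> norm y * c \<or> norm (K y) = 0"
        by (metis mult_right_le_imp_le norm_ge_zero order_le_less)
      moreover have "norm y * c \<le> norm y * \<bar>c\<bar>" by (simp add: mult_left_mono)
      ultimately show ?thesis by auto
    qed
  qed
  moreover have "range K \<subseteq> closure (range R)" by (auto simp: cl PK)
  ultimately show thesis using that K by blast
qed

section \<open>Contractive factorizations and the Schur complement\<close>

locale negative_splitting =
  fixes A :: "'a :: chilbert_space \<Rightarrow> 'a" and P :: "'a \<Rightarrow> 'a"
  assumes A: "selfadjoint A" and split: "splits_negative A P"
begin

lemmas A_clinear = selfadjoint_bounded_clinear[OF A]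
  and P = splits_negative_projection[OF split]
  and P_clinear = splits_negative_clinear[OF split]
  and P_A = splits_negative_commute[OF split]

lemmas P_P = orth_projection_idem[OF P]
  and P_inner = orth_projection_inner[OF P]
  and A_inner = selfadjoint_inner[OF A]

definition R :: "'a \<Rightarrow> 'a" where "R = op_sqrt (abs_op A)"

text \<open>\<open>A (1 - 2 P)\<close> flips the sign of \<open>A\<close> on the negative subspace;
  being nonnegative with square \<open>A\<^sup>2\<close>, it is the absolute value.\<close>

lemma abs_op_A: "abs_op A = (\<lambda>x. A x - 2 *\<^sub>R A (P x))"
proof (rule abs_op_unique[OF A])
  note AP = bounded_clinear_compose[OF A_clinear P_clinear]
  have "selfadjoint (\<lambda>x. A x - 2 *\<^sub>R A (P x))"
    unfolding selfadjoint_iff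
    by (intro conjI allI bounded_clinear_intros A_clinear AP)
      (simp add: inner_diff_left inner_diff_right A_inner P_inner P_A)
  moreover have "0 \<le> inner (A x - 2 *\<^sub>R A (P x)) x" for x
  proof -
    have "0 \<le> inner (A (x - P x)) (x - P x)"
      by (rule splits_negative_nonneg[OF split]) (simp add: bounded_clinear_diff[OF P_clinear] P_P)
    moreover have "inner (A (P x)) (P x) \<le> 0"
      using splits_negative_neg[OF split, of "P x"] P_P
      by (cases "P x = 0") (auto simp: bounded_clinear_zero[OF A_clinear])
    moreover have "inner (A x - 2 *\<^sub>R A (P x)) x
        = inner (A (x - P x)) (x - P x) - inner (A (P x)) (P x)"
    proof -
      have "inner (A (P x)) (P x) = inner (A (P x)) x" "inner (A x) (P x) = inner (A (P x)) x"
        by (simp_all add: P_A P_P flip: P_inner)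
      then show ?thesis
        by (simp add: bounded_clinear_diff[OF A_clinear] inner_diff_left inner_diff_right)
    qed
    ultimately show ?thesis by simp
  qed
  ultimately show "nonneg_op (\<lambda>x. A x - 2 *\<^sub>R A (P x))" by (simp add: nonneg_op_iff)
  show "A (A x - 2 *\<^sub>R A (P x)) - 2 *\<^sub>R A (P (A x - 2 *\<^sub>R A (P x))) = A (A x)" for x
    by (simp add: bounded_clinear_simps[OF A_clinear] bounded_clinear_simps[OF P_clinear] P_A P_P
        scaleR_2)
qed

lemma R_nonneg: "nonneg_op R"
  and R_R: "R (R x) = abs_op A x"
  unfolding R_def by (rule nonneg_op_sqrt op_sqrt_square, rule nonneg_abs_op[OF A])+

lemma R: "selfadjoint R"
  by (rule nonneg_op_selfadjoint[OF R_nonneg])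

lemmas R_clinear = selfadjoint_bounded_clinear[OF R]
  and R_inner = selfadjoint_inner[OF R]

lemma R_commute:
  assumes W: "bounded_clinear W" and "\<And>x. W (A x) = A (W x)"
  shows "W (R x) = R (W x)"
  unfolding R_def
  by (rule op_sqrt_commute[OF nonneg_abs_op[OF A] W]) (rule abs_op_commute[OF A assms])

lemma P_R: "P (R x) = R (P x)"
  by (rule R_commute[OF P_clinear P_A])

lemma norm_R: "(norm (R x))\<^sup>2 = inner (abs_op A x) x"
  by (simp add: power2_norm_eq_inner R_inner inner_commute flip: R_R)

lemma R_eq_0_iff: "R x = 0 \<longleftrightarrow> A x = 0"
proof
  assume "R x = 0"
  then have "abs_op A x = 0" by (simp add: bounded_clinear_zero[OF R_clinear] flip: R_R)
  then show "A x = 0" using norm_abs_op[OF A, of x] by simp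
next
  assume "A x = 0"
  then have "abs_op A x = 0" using norm_abs_op[OF A, of x] by simp
  then show "R x = 0" using norm_R[of x] by simp
qed

definition P0 :: "'a \<Rightarrow> 'a" where
  "P0 = (SOME Q. orth_projection Q \<and> (\<forall>x. Q x = x \<longleftrightarrow> A x = 0))"

lemma P0: "orth_projection P0" and P0_iff: "P0 x = x \<longleftrightarrow> A x = 0"
proof -
  obtain Q where "orth_projection Q" "\<And>x. Q x = x \<longleftrightarrow> A x = 0"
    using orth_projection_kernel[OF A_clinear] by blast
  then have "\<exists>Q. orth_projection Q \<and> (\<forall>x. Q x = x \<longleftrightarrow> A x = 0)" by blast
  from someI_ex[OF this] show "orth_projection P0" "P0 x = x \<longleftrightarrow> A x = 0"
    by (simp_all add: P0_def)
qed

lemmas P0_clinear = orth_projection_clinear[OF P0]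
  and P0_inner = orth_projection_inner[OF P0]
  and P0_P0 = orth_projection_idem[OF P0]

lemma A_P0: "A (P0 x) = 0"
  using P0_iff[of "P0 x"] P0_P0 by simp

lemma P0_A: "P0 (A x) = 0"
proof (rule inner_eqI)
  show "inner y (P0 (A x)) = inner y 0" for y
    by (simp add: A_P0 flip: P0_inner A_inner)
qed

lemma closure_range_A: "closure (range A) = {x. P0 x = 0}"
  by (rule closure_range_selfadjoint[OF A P0 P0_iff])

lemma closure_range_R: "closure (range R) = {x. P0 x = 0}"
  by (rule closure_range_selfadjoint[OF R P0]) (simp add: P0_iff R_eq_0_iff)

lemma P0_R: "P0 (R x) = 0"
proof -
  have "R x \<in> closure (range R)" by (rule closure_subset[THEN subsetD]) simp
  then show ?thesis by (simp add: closure_range_R)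
qed

lemma R_P0: "R (P0 x) = 0"
  by (simp add: R_eq_0_iff A_P0)

text \<open>\<open>A (P x) = P (A x) = 0\<close>, while the form of \<open>A\<close> is strictly
  negative at every nonzero vector of the range of \<open>P\<close>.\<close>

lemma P_eq_0_if_A_eq_0: "A x = 0 \<Longrightarrow> P x = 0"
  using splits_negative_neg[OF split, of "P x"] P_A[of x]
  by (cases "P x = 0") (simp_all add: P_P bounded_clinear_zero[OF P_clinear])

lemma P_P0: "P (P0 x) = 0"
  by (rule P_eq_0_if_A_eq_0) (rule A_P0)

lemma P0_P: "P0 (P x) = 0"
  by (rule orth_projection_orthogonal_commute[OF P P0 P_P0])

text \<open>The sign of \<open>A\<close> made explicit: 0 on the kernel of \<open>A\<close>, -1 on
  the range of \<open>P\<close>, and 1 on the orthogonal complement of both.\<close>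

definition J :: "'a \<Rightarrow> 'a" where "J x = x - P0 x - 2 *\<^sub>R P x"

lemma J_clinear: "bounded_clinear J"
  unfolding J_def[abs_def] by (intro bounded_clinear_intros P0_clinear P_clinear)

lemma J_inner: "inner (J x) y = inner x (J y)"
  by (simp add: J_def inner_diff_left inner_diff_right P0_inner P_inner)

lemma J_J: "J (J x) = x - P0 x"
  by (simp add: J_def bounded_clinear_simps[OF P0_clinear] bounded_clinear_simps[OF P_clinear]
      P_P P0_P0 P_P0 P0_P scaleR_2)

lemma J_abs_op: "J (abs_op A x) = A x"
  by (simp add: J_def abs_op_A bounded_clinear_simps[OF P0_clinear]
      bounded_clinear_simps[OF P_clinear] P_P P_A P0_A algebra_simps scaleR_2)

text \<open>Turns the form of \<open>A\<close> into the Krein space form of \<open>J\<close> at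
  \<open>R x\<close>.\<close>

lemma R_J_R: "R (J (R x)) = A x"
proof -
  have "R (J (R x)) = J (R (R x))"
    by (simp add: J_def bounded_clinear_simps[OF R_clinear] P_R P0_R R_P0)
  then show ?thesis by (simp add: R_R J_abs_op)
qed

lemma J_nonneg:
  assumes "P x = 0"
  shows "0 \<le> inner (J x) x"
proof -
  have "inner (J x) x = (norm x)\<^sup>2 - (norm (P0 x))\<^sup>2"
    using assms orth_projection_norm[OF P0, of x]
    by (simp add: J_def inner_diff_left power2_norm_eq_inner)
  then show ?thesis using power_mono[OF orth_projection_norm_le[OF P0], of x 2] by simp
qed

text \<open>A competitor \<open>J'\<close> agrees with \<open>J\<close> on the range of the absolute
  value, by continuity on its closure, and both vanish on the kernel of \<open>A\<close>.\<close>

lemma sgn_op_A: "sgn_op A = J"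
  unfolding sgn_op_def
proof (rule the_equality)
  have "J x = 0" if x: "\<forall>y\<in>range A. cinner x y = 0" for x
  proof -
    have "A x = 0"
    proof (rule inner_eqI)
      fix y
      have "inner x (A y) = 0" using x by (simp flip: Re_cinner)
      then show "inner y (A x) = inner y 0" by (metis A_inner inner_commute inner_zero_right)
    qed
    then show ?thesis using P0_iff[of x] P_eq_0_if_A_eq_0[of x] by (simp add: J_def)
  qed
  then show "bounded_clinear J \<and> J \<circ> abs_op A = A \<and>
      (\<forall>x. (\<forall>y\<in>range A. cinner x y = 0) \<longrightarrow> J x = 0)"
    using J_clinear by (auto simp: J_abs_op)
  fix J' assume J': "bounded_clinear J' \<and> J' \<circ> abs_op A = A \<and>
      (\<forall>x. (\<forall>y\<in>range A. cinner x y = 0) \<longrightarrow> J' x = 0)"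
  then have cl: "bounded_clinear J'" and abs: "\<And>x. J' (abs_op A x) = A x"
    by (auto simp: fun_eq_iff)
  note absA = nonneg_op_selfadjoint[OF nonneg_abs_op[OF A]]
  have ker: "J' (P0 x) = 0" for x
  proof -
    have "cinner (P0 x) (A y) = 0" for y
      by (simp add: cinner_eq_Complex A_P0 complex_eq_iff
          flip: A_inner bounded_clinear_scaleC[OF A_clinear])
    then show ?thesis using J' by blast
  qed
  have "closed {x. J' x = J x}"
    using bounded_clinear_bounded_linear[OF cl] bounded_clinear_bounded_linear[OF J_clinear]
    by (intro closed_Collect_eq continuous_intros linear_continuous_on)
  then have "closure (range (abs_op A)) \<subseteq> {x. J' x = J x}"
    by (intro closure_minimal) (auto simp: abs J_abs_op)
  moreover have "closure (range (abs_op A)) = {x. P0 x = 0}"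
    using norm_abs_op[OF A] P0_iff
    by (intro closure_range_selfadjoint[OF absA P0]) (metis norm_eq_zero)
  ultimately have eq: "J' x = J x" if "P0 x = 0" for x using that by blast
  show "J' = J"
  proof
    fix x
    have "J' (x - P0 x) = J (x - P0 x)"
      by (rule eq) (simp add: bounded_clinear_diff[OF P0_clinear] P0_P0)
    moreover have "J (P0 x) = 0" by (simp add: J_def P0_P0 P_P0)
    ultimately show "J' x = J x"
      by (simp add: bounded_clinear_diff[OF cl] bounded_clinear_diff[OF J_clinear] ker)
  qed
qed

lemma abs_op_range_P: "P x = x \<Longrightarrow> abs_op A x = - A x"
  and abs_op_kernel_P: "P x = 0 \<Longrightarrow> abs_op A x = A x"
  by (simp_all add: abs_op_A scaleR_2 bounded_clinear_zero[OF A_clinear])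

lemma R_injective: "P x = x \<Longrightarrow> R x = 0 \<Longrightarrow> x = 0"
  using splits_negative_neg[OF split, of x] by (auto simp: R_eq_0_iff)

end

section \<open>The block form and its negative squares\<close>

locale schur_setting = negative_splitting A P
  for A :: "'a :: chilbert_space \<Rightarrow> 'a" and P +
  fixes B :: "'a \<Rightarrow> 'b :: chilbert_space" and J2 :: "'b \<Rightarrow> 'b" and b :: "'a set"
  assumes B: "bounded_clinear B"
    and J2: "selfadjoint J2" and J2_J2: "J2 (J2 y) = y"
    and basis: "finite b" "cindependent b" "cspan b = range P" and nu_A: "nu_minus A = enat (card b)"
    and nu_J2: "nu_minus J2 < \<infinity>"
begin

definition C :: "'a \<Rightarrow> 'a" where "C = (\<lambda>x. A x - cadjoint B (J2 (B x)))"

lemmas J2_clinear = selfadjoint_bounded_clinear[OF J2]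
  and J2_inner = selfadjoint_inner[OF J2]
  and B_inner = inner_cadjoint[OF B]
  and Bs_clinear = bounded_clinear_cadjoint[OF B]

lemma C: "selfadjoint C"
  unfolding selfadjoint_iff C_def
proof (intro conjI allI)
  show "bounded_clinear (\<lambda>x. A x - cadjoint B (J2 (B x)))"
    by (intro bounded_clinear_diff_op A_clinear
        bounded_clinear_compose[OF Bs_clinear bounded_clinear_compose[OF J2_clinear B]])
  show "inner (A x - cadjoint B (J2 (B x))) y = inner x (A y - cadjoint B (J2 (B y)))" for x y
    using B_inner[of y "J2 (B x)"] B_inner[of x "J2 (B y)"] J2_inner[of "B x" "B y"]
      A_inner[of x y]
    by (simp add: inner_diff_left inner_diff_right inner_commute)
qed

text \<open>The form of the block operator with rows \<open>(A, B\<^sup>*)\<close> and \<open>(B, J\<^sub>2)\<close>; its Schur complement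
  with respect to \<open>J\<^sub>2\<close> is \<open>C\<close>.\<close>

definition q :: "'a \<Rightarrow> 'b \<Rightarrow> real" where
  "q x y = inner (A x) x + 2 * inner (B x) y + inner (J2 y) y"

lemma q_schur: "q x y = inner (C x) x + inner (J2 (y + J2 (B x))) (y + J2 (B x))"
proof -
  have "inner (J2 y) (J2 (B x)) = inner (B x) y"
    by (simp add: J2_inner J2_J2 inner_commute)
  moreover have "inner (cadjoint B (J2 (B x))) x = inner (B x) (J2 (B x))"
    using B_inner[of x "J2 (B x)"] by (simp add: inner_commute)
  ultimately show ?thesis
    by (simp add: q_def C_def bounded_clinear_add[OF J2_clinear] J2_J2 inner_add_left
        inner_add_right inner_diff_left)
qed

text \<open>By \<open>q_schur\<close>, \<open>q\<close> is nonnegative wherever \<open>PC\<close>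
  kills \<open>x\<close> and \<open>PJ\<close> kills \<open>y + J2 (B x)\<close>. So every
  \<open>q\<close>-negative subspace has dimension at most nu_-(C) + nu_-(J2).\<close>

lemma nu_A_le:
  assumes C': "splits_negative C PC" "finite bC" "cspan bC = range PC"
    and J2': "splits_negative J2 PJ" "finite bJ" "cspan bJ = range PJ"
    and c: "cindependent c" "\<And>p. p \<in> cspan c \<Longrightarrow> p \<noteq> 0 \<Longrightarrow> q (fst p) (snd p) < 0"
  shows "finite c \<and> card c \<le> card (pair_basis bC bJ)"
proof (rule negative_definite_card_le[OF _ c])
  let ?T = "\<lambda>p. (PC (fst p), PJ (snd p + J2 (B (fst p))))"
  note lin = splits_negative_clinear[OF C'(1)] splits_negative_clinear[OF J2'(1)] J2_clinear B
  show "clinear ?T"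
    by (rule clinearI) (simp_all add: lin[THEN bounded_clinear_add] lin[THEN bounded_clinear_scaleC]
        scaleC_prod_def scaleC_add_right)
  show "finite (pair_basis bC bJ)" by (rule finite_pair_basis[OF C'(2) J2'(2)])
  show "range ?T \<subseteq> cspan (pair_basis bC bJ)" by (auto simp: cspan_pair_basis C'(3) J2'(3))
  fix p :: "'a \<times> 'b" assume "?T p = 0"
  then show "0 \<le> q (fst p) (snd p)"
    using splits_negative_nonneg[OF C'(1)] splits_negative_nonneg[OF J2'(1)]
    by (simp add: q_schur zero_prod_def)
qed

lemma nu_minus_eq_if_factorization:
  assumes K: "bounded_clinear K" "range K \<subseteq> closure (range A)" and BK: "cadjoint B = R \<circ> K"
    and contr: "nonneg_op (\<lambda>y. J2 y - cadjoint K (sgn_op A (K y)))"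
  shows "nu_minus A = nu_minus C + nu_minus J2"
proof -
  have P0K: "P0 (K y) = 0" for y using K(2) by (auto simp: closure_range_A)
  have D: "inner (J (K y)) (K y) \<le> inner (J2 y) y" for y
    using nonneg_op_inner[OF contr, of y] inner_cadjoint[OF K(1), of y "J (K y)"]
    by (simp add: inner_diff_left inner_diff_right sgn_op_A inner_commute)
  define w where "w = (\<lambda>x y. R x + J (K y))"
  \<comment> \<open>Since \<open>J (J (K y)) = K y\<close>, the cross term of the square is
    \<open>inner (R x) (K y) = inner x (cadjoint B y)\<close>. Contractivity enters through
    \<open>D\<close>.\<close>
  have q_ge: "inner (J (w x y)) (w x y) \<le> q x y" for x y
  proof -
    have "inner (J (R x)) (R x) = inner (A x) x"
      by (simp add: R_J_R flip: R_inner)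
    moreover have "inner (J (R x)) (J (K y)) = inner (B x) y"
    proof -
      have "inner (J (R x)) (J (K y)) = inner (R x) (K y)"
        by (simp add: J_inner J_J P0K)
      also have "\<dots> = inner x (cadjoint B y)" by (simp add: BK R_inner)
      finally show ?thesis by (simp add: B_inner)
    qed
    moreover have "inner (J (J (K y))) (J (K y)) = inner (J (K y)) (K y)"
      by (simp add: J_J P0K inner_commute)
    moreover have "inner (J (J (K y))) (R x) = inner (J (R x)) (J (K y))"
      by (subst J_inner) (rule inner_commute)
    ultimately show ?thesis
      using D[of y] by (simp add: w_def q_def bounded_clinear_add[OF J_clinear] inner_add_left
          inner_add_right)
  qed
  have q_nonneg: "0 \<le> q x y" if "P (w x y) = 0" for x y
    using J_nonneg[OF that] q_ge order_trans by blast
  note lin = P_clinear R_clinear J_clinear K(1) J2_clinear B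
  \<comment> \<open>Subtracting \<open>J2 (B x)\<close> passes to the coordinates in which
    \<open>q\<close> is the orthogonal sum of the forms of \<open>C\<close> and
    \<open>J2\<close>.\<close>
  have T: "clinear (\<lambda>p. P (w (fst p) (snd p - J2 (B (fst p)))))"
    unfolding w_def
    by (rule clinearI) (simp_all add: lin[THEN bounded_clinear_add] lin[THEN bounded_clinear_diff]
        lin[THEN bounded_clinear_scaleC] scaleC_prod_def scaleC_add_right
        complex_vector.scale_right_diff_distrib)
  have i: "clinear (\<lambda>x :: 'a. (x, 0 :: 'b))"
    by (rule clinearI) (simp_all add: scaleC_Pair)
  have TC: "clinear (\<lambda>x. P (w x (0 - J2 (B x))))"
    using clinear_compose[OF T i] by simp
  \<comment> \<open>The second coordinate 0 leaves the form of \<open>C\<close> alone. This bounds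
    nu_-(C) first, so that a finite basis \<open>bC\<close> is available for the count.\<close>
  have "nu_minus C \<le> enat (card b)"
  proof (rule nu_minus_le[OF C TC basis(1)])
    show "range (\<lambda>x. P (w x (0 - J2 (B x)))) \<subseteq> cspan b" by (auto simp: basis(3))
    show "0 \<le> inner (C x) x" if "P (w x (0 - J2 (B x))) = 0" for x
      using q_nonneg[OF that] by (simp add: q_schur)
  qed
  then have C_fin: "nu_minus C < \<infinity>" using order_le_less_trans by fastforce
  obtain PC bC where C': "splits_negative C PC" "finite bC" "cindependent bC"
    "cspan bC = range PC" and nC: "nu_minus C = enat (card bC)"
    using nu_minus_finiteE[OF C C_fin] .
  obtain PJ bJ where J': "splits_negative J2 PJ" "finite bJ" "cindependent bJ"
    "cspan bJ = range PJ" and nJ: "nu_minus J2 = enat (card bJ)"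
    using nu_minus_finiteE[OF J2 nu_J2] .
  have card: "card (pair_basis bC bJ) = card bC + card bJ"
    using C' J' by (intro card_pair_basis)
  have "card (pair_basis bC bJ) \<le> card b"
  proof (rule negative_definite_card_le[OF T _ _ _ basis(1), THEN conjunct2])
    show "cindependent (pair_basis bC bJ)"
      using C' J' by (intro cindependent_pair_basis)
    show "range (\<lambda>p. P (w (fst p) (snd p - J2 (B (fst p))))) \<subseteq> cspan b" by (auto simp: basis(3))
    fix p :: "'a \<times> 'b"
    show "0 \<le> inner (C (fst p)) (fst p) + inner (J2 (snd p)) (snd p)"
      if "P (w (fst p) (snd p - J2 (B (fst p)))) = 0"
      using q_nonneg[OF that] by (simp add: q_schur)
    assume "p \<in> cspan (pair_basis bC bJ)" "p \<noteq> 0"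
    then have rng: "fst p \<in> range PC" "snd p \<in> range PJ" and "fst p \<noteq> 0 \<or> snd p \<noteq> 0"
      by (auto simp: cspan_pair_basis C'(4) J'(4) prod_eq_iff)
    moreover have "inner (C (fst p)) (fst p) < 0 \<or> fst p = 0"
      "inner (J2 (snd p)) (snd p) < 0 \<or> snd p = 0"
      using splits_negative_range[OF C'(1) rng(1)] splits_negative_range[OF J'(1) rng(2)] by blast+
    ultimately show "inner (C (fst p)) (fst p) + inner (J2 (snd p)) (snd p) < 0"
      by fastforce
  qed
  \<comment> \<open>On pairs \<open>(x, 0)\<close> with \<open>x\<close> in the range of
    \<open>P\<close> the form \<open>q\<close> is that of \<open>A\<close>, hence negative.\<close>
  moreover have "card b \<le> card (pair_basis bC bJ)"
  proof -
    let ?c = "(\<lambda>x. (x, 0 :: 'b)) ` b"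
    have "cindependent ?c"
      by (rule cindependent_image(1)[OF i basis(2)]) (simp add: zero_prod_def)
    then have "card ?c \<le> card (pair_basis bC bJ)"
    proof (rule nu_A_le[OF C'(1,2,4) J'(1,2,4), THEN conjunct2])
      fix p assume "p \<in> cspan ?c" "p \<noteq> 0"
      then obtain x where "p = (x, 0)" "x \<in> range P" "x \<noteq> 0"
        unfolding cspan_Pair_zero basis(3) by (auto simp: zero_prod_def)
      then show "q (fst p) (snd p) < 0"
        using splits_negative_range[OF split] by (simp add: q_def)
    qed
    then show ?thesis by (simp add: card_image inj_on_def)
  qed
  ultimately show ?thesis using card by (simp add: nu_A nC nJ)
qed

text \<open>A \<open>q\<close>-negative vector orthogonal to the pairs \<open>(u, 0)\<close>, with
  \<open>u\<close> in the range of \<open>P\<close>, could be adjoined to them. That would give a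
  negative subspace of dimension nu_-(A) + 1, more than (E) and \<open>nu_A_le\<close>
  permit.\<close>

lemma q_nonneg_orthogonal:
  assumes E: "nu_minus A = nu_minus C + nu_minus J2" and orth: "P (A x + cadjoint B y) = 0"
  shows "0 \<le> q x y"
proof (rule ccontr)
  assume "\<not> 0 \<le> q x y"
  then have neg: "q x y < 0" by simp
  have C_fin: "nu_minus C < \<infinity>" using E nu_A by (cases "nu_minus C") auto
  obtain PC bC where C': "splits_negative C PC" "finite bC" "cindependent bC"
    "cspan bC = range PC" and nC: "nu_minus C = enat (card bC)"
    using nu_minus_finiteE[OF C C_fin] .
  obtain PJ bJ where J': "splits_negative J2 PJ" "finite bJ" "cindependent bJ"
    "cspan bJ = range PJ" and nJ: "nu_minus J2 = enat (card bJ)"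
    using nu_minus_finiteE[OF J2 nu_J2] .
  let ?c = "(\<lambda>x. (x, 0 :: 'b)) ` b"
  have i: "clinear (\<lambda>x :: 'a. (x, 0 :: 'b))"
    by (rule clinearI) (simp_all add: scaleC_Pair)
  have c: "cindependent ?c"
    by (rule cindependent_image(1)[OF i basis(2)]) (simp add: zero_prod_def)
  \<comment> \<open>If \<open>y = 0\<close> and \<open>x\<close> lies in the range of
    \<open>P\<close>, orthogonality reads \<open>A x = 0\<close>, and \<open>q x y\<close> would
    vanish.\<close>
  have out: "(x, y) \<notin> cspan ?c"
  proof
    assume "(x, y) \<in> cspan ?c"
    then have y: "y = 0" and "x \<in> range P" by (auto simp: cspan_Pair_zero basis(3))
    then have "A x = 0"
      using orth by (auto simp: bounded_clinear_zero[OF Bs_clinear] P_A P_P)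
    then show False using neg by (simp add: q_def y)
  qed
  then have ind: "cindependent (insert (x, y) ?c)"
    by (rule complex_vector.independent_insertI[OF _ c])
  have notin: "(x, y) \<notin> ?c" using out complex_vector.span_superset[of ?c] by blast
  have "q (fst p) (snd p) < 0" if p: "p \<in> cspan (insert (x, y) ?c)" "p \<noteq> 0" for p
  proof -
    obtain k u where "p - k *\<^sub>C (x, y) = (u, 0)" and u: "u \<in> range P"
      using p(1) by (auto simp: complex_vector.span_insert cspan_Pair_zero basis(3))
    then have p_eq: "fst p = u + k *\<^sub>C x" "snd p = k *\<^sub>C y"
      by (auto simp: prod_eq_iff scaleC_Pair algebra_simps)
    have Pu: "P u = u" using u P_P by auto
    have kk: "inner (k *\<^sub>C v) (k *\<^sub>C w) = (cmod k)\<^sup>2 * inner v w"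
      for v w :: "'c :: complex_inner"
    proof -
      have "cinner (k *\<^sub>C v) (k *\<^sub>C w) = complex_of_real ((cmod k)\<^sup>2) * cinner v w"
        by (simp add: cinner_scaleC_left cinner_scaleC_right complex_norm_square del: of_real_power)
      then have "Re (cinner (k *\<^sub>C v) (k *\<^sub>C w)) = (cmod k)\<^sup>2 * Re (cinner v w)"
        by (simp del: of_real_power)
      then show ?thesis by (simp add: Re_cinner)
    qed
    \<comment> \<open>\<open>P\<close> annihilates the vector itself and not just a real functional
      of it, so the mixed term of \<open>q\<close> vanishes for every complex multiple
      \<open>k\<close> of \<open>(x, y)\<close>.\<close>
    have "inner u (k *\<^sub>C (A x + cadjoint B y)) = inner u (P (k *\<^sub>C (A x + cadjoint B y)))"
      by (simp add: Pu flip: P_inner)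
    also have "\<dots> = 0"
      by (simp add: bounded_clinear_scaleC[OF P_clinear] orth)
    finally have cross: "inner (A u) (k *\<^sub>C x) + inner (B u) (k *\<^sub>C y) = 0"
      by (simp add: A_inner B_inner bounded_clinear_scaleC[OF A_clinear]
          bounded_clinear_scaleC[OF Bs_clinear] scaleC_add_right inner_add_right)
    have q_eq: "q (fst p) (snd p) = inner (A u) u + (cmod k)\<^sup>2 * q x y"
      using cross A_inner[of "k *\<^sub>C x" u]
      by (simp add: p_eq q_def bounded_clinear_add[OF A_clinear] bounded_clinear_add[OF B]
          bounded_clinear_scaleC[OF A_clinear] bounded_clinear_scaleC[OF B]
          bounded_clinear_scaleC[OF J2_clinear] inner_add_left inner_add_right kk algebra_simps
          inner_commute)
    have "inner (A u) u < 0 \<or> u = 0" using splits_negative_range[OF split u] by blast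
    moreover have "(cmod k)\<^sup>2 * q x y < 0 \<or> k = 0"
      using neg by (auto simp: mult_pos_neg)
    moreover have "u \<noteq> 0 \<or> k \<noteq> 0"
      using p(2) p_eq by (auto simp: prod_eq_iff)
    ultimately show ?thesis unfolding q_eq
      by (auto simp: bounded_clinear_zero[OF A_clinear])
  qed
  from nu_A_le[OF C'(1,2,4) J'(1,2,4) ind this]
  have "card (insert (x, y) ?c) \<le> card (pair_basis bC bJ)" by blast
  moreover have "card ?c = card b" by (simp add: card_image inj_on_def)
  moreover have "card (pair_basis bC bJ) = card bC + card bJ"
    using C' J' by (intro card_pair_basis)
  ultimately show False
    using E notin basis(1) by (simp add: nu_A nC nJ)
qed

text \<open>The range of \<open>P\<close> is finite-dimensional and invariant under
  \<open>R\<close>, and \<open>R\<close> is injective there because the form of \<open>A\<close> is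
  definite.\<close>

lemma R_bounded_below:
  obtains c where "c \<ge> 0" "\<And>x. P x = x \<Longrightarrow> norm x \<le> c * norm (R x)"
proof -
  have fix_P: "x \<in> range P \<longleftrightarrow> P x = x" for x using P_P by (metis rangeE rangeI)
  have inv: "R ` cspan b \<subseteq> cspan b"
    by (auto simp: basis(3) P_R[symmetric])
  have inj: "x = 0" if "x \<in> cspan b" "R x = 0" for x
    using that R_injective by (simp add: basis(3) fix_P)
  obtain c where "c \<ge> 0" "\<And>x. x \<in> cspan b \<Longrightarrow> norm x \<le> c * norm (R x)"
    using bounded_below_on_cspan[OF R basis(1) inv inj] by blast
  then show thesis using that by (simp add: basis(3) fix_P)
qed

lemma R_surjective:
  assumes "P v = v"
  obtains u where "P u = u" "R u = v"
proof -
  have fix_P: "x \<in> range P \<longleftrightarrow> P x = x" for x using P_P by (metis rangeE rangeI)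
  have inv: "R ` cspan b \<subseteq> cspan b"
    by (auto simp: basis(3) P_R[symmetric])
  have inj: "x = 0" if "x \<in> cspan b" "R x = 0" for x
    using that R_injective by (simp add: basis(3) fix_P)
  have "v \<in> R ` range P"
    using surjective_on_cspan[OF bounded_clinear_clinear[OF R_clinear] basis(1) inv inj] assms
    by (simp add: basis(3) fix_P)
  then show thesis using that P_P by auto
qed

text \<open>The vector \<open>u\<close> makes \<open>(x + u, y)\<close> orthogonal to \<open>ran P \<times> 0\<close> with respect to \<open>q\<close>.\<close>

lemma form_inequality:
  assumes E: "nu_minus A = nu_minus C + nu_minus J2"
    and x: "P x = 0" and u: "P u = u" "R (R u) = P (cadjoint B y)"
  shows "0 \<le> (norm (R x))\<^sup>2 + 2 * inner x (cadjoint B y) + (norm (R u))\<^sup>2 + inner (J2 y) y"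
proof -
  have Au: "A u = - R (R u)" by (simp add: R_R abs_op_range_P[OF u(1)])
  \<comment> \<open>On the range of \<open>P\<close>, \<open>A = - R\<^sup>2\<close>; so
    \<open>A u\<close> cancels \<open>P (cadjoint B y)\<close>, while \<open>A x\<close> stays in
    the kernel of \<open>P\<close>.\<close>
  have "P (A (x + u) + cadjoint B y) = 0"
    by (simp add: bounded_clinear_add[OF A_clinear] bounded_clinear_add[OF P_clinear] P_A x u(1)
        bounded_clinear_zero[OF A_clinear] Au u(2) bounded_clinear_diff[OF P_clinear] P_P)
  then have "0 \<le> q (x + u) y" by (rule q_nonneg_orthogonal[OF E])
  \<comment> \<open>The form of \<open>A\<close> at \<open>u\<close> contributes minus the squared
    norm of \<open>R u\<close>, and the cross term of \<open>u\<close> with \<open>y\<close>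
    contributes it twice.\<close>
  also have "q (x + u) y
      = (norm (R x))\<^sup>2 + 2 * inner x (cadjoint B y) + (norm (R u))\<^sup>2 + inner (J2 y) y"
  proof -
    have xx: "inner (A x) x = (norm (R x))\<^sup>2"
      by (simp add: norm_R abs_op_kernel_P[OF x])
    have uu: "inner (A u) u = - (norm (R u))\<^sup>2"
      by (simp add: norm_R abs_op_range_P[OF u(1)])
    have "inner (A x) u = inner (P (A x)) u" by (simp add: P_inner u(1))
    then have xu: "inner (A x) u = 0"
      by (simp add: P_A x bounded_clinear_zero[OF A_clinear])
    then have ux: "inner (A u) x = 0" by (metis A_inner inner_commute)
    have "inner (P u) (cadjoint B y) = inner u (R (R u))" by (simp add: P_inner u(2))
    then have ub: "inner u (cadjoint B y) = (norm (R u))\<^sup>2"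
      by (simp add: u(1) power2_norm_eq_inner R_inner)
    show ?thesis
      by (simp add: q_def bounded_clinear_add[OF A_clinear] inner_add_left inner_add_right xx uu
          xu ux B_inner ub)
  qed
  finally show ?thesis .
qed

lemma R_R_preimage:
  obtains u where "P u = u" "R (R u) = P z"
  using R_surjective[OF P_P] R_surjective by metis

text \<open>On the kernel of \<open>P\<close> the bound is the discriminant of
  \<open>form_inequality\<close>; on the range of \<open>P\<close> it holds because \<open>R\<close>
  is bounded below there. The constants of the two parts add up.\<close>

lemma cadjoint_B_bound:
  assumes E: "nu_minus A = nu_minus C + nu_minus J2"
  obtains c where "\<And>x y. \<bar>inner x (cadjoint B y)\<bar> \<le> c * norm y * norm (R x)"
proof -
  obtain c where c: "c \<ge> 0" "\<And>x. P x = x \<Longrightarrow> norm x \<le> c * norm (R x)"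
    using R_bounded_below by blast
  obtain k where k: "k > 0" "\<And>y. norm (cadjoint B y) \<le> k * norm y"
    using bounded_clinear_bound[OF Bs_clinear] by blast
  obtain j where j: "j > 0" "\<And>y. norm (J2 y) \<le> j * norm y"
    using bounded_clinear_bound[OF J2_clinear] by blast
  \<comment> \<open>\<open>m\<close> bounds the terms of \<open>form_inequality\<close> free of
    \<open>x\<close>: \<open>norm (R u)\<close> is at most \<open>c * norm (R (R u))\<close>, hence
    at most \<open>c * k * norm y\<close>, and \<open>j\<close> bounds \<open>J2\<close>.\<close>
  define m where "m = (c * k)\<^sup>2 + j"
  have m: "m \<ge> 0" using j by (simp add: m_def)
  have kernel: "\<bar>inner x (cadjoint B y)\<bar> \<le> sqrt m * norm y * norm (R x)" if x: "P x = 0" for x y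
  proof -
    obtain u where u: "P u = u" "R (R u) = P (cadjoint B y)" using R_R_preimage .
    have "norm (R u) \<le> c * norm (R (R u))" by (rule c(2)) (simp add: P_R u(1))
    also have "\<dots> \<le> c * (k * norm y)"
      unfolding u(2) using c(1) k(2)[of y] orth_projection_norm_le[OF P, of "cadjoint B y"]
      by (intro mult_left_mono) auto
    finally have "(norm (R u))\<^sup>2 \<le> (c * k * norm y)\<^sup>2" by (intro power_mono) (simp_all add: mult.assoc)
    moreover have "inner (J2 y) y \<le> j * (norm y)\<^sup>2"
      using norm_cauchy_schwarz[of "J2 y" y] mult_right_mono[OF j(2), of "norm y" y]
      by (simp add: power2_eq_square)
    ultimately have le: "(norm (R u))\<^sup>2 + inner (J2 y) y \<le> m * (norm y)\<^sup>2"
      by (simp add: m_def power_mult_distrib distrib_right)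
    \<comment> \<open>\<open>u\<close> depends on \<open>y\<close> alone, so \<open>x\<close> may be
      scaled by every real \<open>t\<close>.\<close>
    have "0 \<le> m * (norm y)\<^sup>2 + 2 * t * inner x (cadjoint B y) + t\<^sup>2 * (norm (R x))\<^sup>2" for t
    proof -
      have "P (t *\<^sub>R x) = 0" by (simp add: x bounded_clinear_scaleR[OF P_clinear])
      from form_inequality[OF E this u] le show ?thesis
        by (simp add: bounded_clinear_scaleR[OF R_clinear] power_mult_distrib)
    qed
    then have "(inner x (cadjoint B y))\<^sup>2 \<le> m * (norm y)\<^sup>2 * (norm (R x))\<^sup>2"
      by (rule quadratic_nonneg_discriminant) simp
    then have "\<bar>inner x (cadjoint B y)\<bar>\<^sup>2 \<le> (sqrt m * norm y * norm (R x))\<^sup>2"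
      using m by (simp add: power_mult_distrib)
    then show ?thesis by (rule power2_le_imp_le) (simp add: m)
  qed
  show thesis
  proof (rule that[of "sqrt m + c * k"])
    fix x y
    have "P (x - P x) = 0" by (simp add: bounded_clinear_diff[OF P_clinear] P_P)
    then have "\<bar>inner (x - P x) (cadjoint B y)\<bar> \<le> sqrt m * norm y * norm (R (x - P x))"
      by (rule kernel)
    also have "\<dots> \<le> sqrt m * norm y * norm (R x)"
      using orth_projection_norm_le[OF orth_projection_complement[OF P], of "R x"] m
      by (intro mult_left_mono) (simp_all add: bounded_clinear_diff[OF R_clinear] P_R)
    finally have 1: "\<bar>inner (x - P x) (cadjoint B y)\<bar> \<le> sqrt m * norm y * norm (R x)" .
    have "norm (P x) \<le> c * norm (R (P x))" by (rule c(2)) (rule P_P)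
    also have "\<dots> \<le> c * norm (R x)"
      using orth_projection_norm_le[OF P, of "R x"] c(1) by (simp add: P_R mult_left_mono)
    finally have "norm (P x) * norm (cadjoint B y) \<le> c * norm (R x) * (k * norm y)"
      using k(2)[of y] c(1) by (intro mult_mono) auto
    then have 2: "\<bar>inner (P x) (cadjoint B y)\<bar> \<le> c * k * norm y * norm (R x)"
      using Cauchy_Schwarz_ineq2[of "P x" "cadjoint B y"] by (simp add: algebra_simps)
    have "inner x (cadjoint B y) = inner (x - P x) (cadjoint B y) + inner (P x) (cadjoint B y)"
      by (simp add: inner_diff_left)
    with 1 2 show "\<bar>inner x (cadjoint B y)\<bar> \<le> (sqrt m + c * k) * norm y * norm (R x)"
      unfolding distrib_right by linarith
  qed
qed

lemma factorization_exists:
  assumes E: "nu_minus A = nu_minus C + nu_minus J2"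
  obtains K where "K \<in> bounded_ops_into (closure (range A))" "cadjoint B = R \<circ> K"
proof -
  obtain c where "\<And>x y. \<bar>inner x (cadjoint B y)\<bar> \<le> c * norm y * norm (R x)"
    using cadjoint_B_bound[OF E] by blast
  then obtain K where K: "bounded_clinear K" "range K \<subseteq> closure (range R)"
    "\<And>y. cadjoint B y = R (K y)"
    using douglas_factorization[OF R Bs_clinear] by blast
  show thesis
    by (rule that[of K]) (use K in \<open>auto simp: bounded_ops_into_def closure_range_A closure_range_R\<close>)
qed

text \<open>The kernel of \<open>R\<close> is that of \<open>A\<close>, which meets the closure of
  the range of \<open>A\<close> only in 0.\<close>

lemma factorization_unique:
  assumes K: "K \<in> bounded_ops_into (closure (range A))" "K' \<in> bounded_ops_into (closure (range A))"
    and eq: "R \<circ> K = R \<circ> K'"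
  shows "K = K'"
proof
  fix y
  have PK: "P0 (K y) = 0" "P0 (K' y) = 0" using K by (auto simp: bounded_ops_into_def closure_range_A)
  have "R (K y) = R (K' y)" using eq by (metis comp_apply)
  then have "R (K y - K' y) = 0" by (simp add: bounded_clinear_diff[OF R_clinear])
  then have "P0 (K y - K' y) = K y - K' y" by (simp add: P0_iff R_eq_0_iff)
  then show "K y = K' y" by (simp add: bounded_clinear_diff[OF P0_clinear] PK)
qed

lemma factorization_contractive:
  assumes E: "nu_minus A = nu_minus C + nu_minus J2"
    and K: "K \<in> bounded_ops_into (closure (range A))" and BK: "cadjoint B = R \<circ> K"
  shows "nonneg_op (\<lambda>y. J2 y - cadjoint K (sgn_op A (K y)))"
proof -
  have Kcl: "bounded_clinear K" using K by (simp add: bounded_ops_into_def)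
  have PK: "P0 (K y) = 0" for y using K by (auto simp: bounded_ops_into_def closure_range_A)
  have "bounded_clinear (\<lambda>y. J2 y - cadjoint K (J (K y)))"
    by (intro bounded_clinear_diff_op J2_clinear
        bounded_clinear_compose[OF bounded_clinear_cadjoint[OF Kcl] bounded_clinear_compose[OF J_clinear Kcl]])
  moreover have "inner (J2 x - cadjoint K (J (K x))) y = inner x (J2 y - cadjoint K (J (K y)))" for x y
    using inner_cadjoint[OF Kcl, of y "J (K x)"] inner_cadjoint[OF Kcl, of x "J (K y)"]
      J_inner[of "K x" "K y"] J2_inner[of x y]
    by (simp add: inner_diff_left inner_diff_right inner_commute)
  moreover have "0 \<le> inner (J2 y - cadjoint K (J (K y))) y" for y
  proof -
    let ?w = "K y"
    obtain u where u: "P u = u" "R (R u) = P (cadjoint B y)" using R_R_preimage .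
    \<comment> \<open>\<open>R\<close> is injective on the range of \<open>P\<close>, so
      \<open>R (R u) = P (R (K y))\<close> identifies \<open>R u\<close> as the component of
      \<open>K y\<close> there.\<close>
    have "R (R u - P ?w) = 0"
      using u(2) by (simp add: bounded_clinear_diff[OF R_clinear] BK P_R)
    moreover have "P (R u - P ?w) = R u - P ?w"
      by (simp add: bounded_clinear_diff[OF P_clinear] P_R u(1) P_P)
    ultimately have Ru: "R u = P ?w" using R_injective by fastforce
    have "?w \<in> closure (range R)" by (simp add: closure_range_R PK)
    then obtain x where x: "(\<lambda>n. R (x n)) \<longlonglongrightarrow> ?w" by (rule closure_rangeE)
    \<comment> \<open>\<open>K y\<close> is only a limit of values of \<open>R\<close>. Applying
      \<open>P - 1\<close> to the approximating vectors moves them into the kernel of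
      \<open>P\<close> and makes \<open>R (z n)\<close> tend to \<open>- (1 - P) (K y)\<close>, the
      point that minimises the squared norm plus twice the inner product with \<open>K y\<close>
      there.\<close>
    define z where "z = (\<lambda>n. P (x n) - x n)"
    have Pz: "P (z n) = 0" for n by (simp add: z_def bounded_clinear_diff[OF P_clinear] P_P)
    have Rz: "(\<lambda>n. R (z n)) \<longlonglongrightarrow> P ?w - ?w"
      unfolding z_def bounded_clinear_diff[OF R_clinear] P_R[symmetric]
      by (intro tendsto_diff bounded_clinear_tendsto[OF P_clinear] x)
    have "0 \<le> (norm (R (z n)))\<^sup>2 + 2 * inner (R (z n)) ?w + (norm (P ?w))\<^sup>2 + inner (J2 y) y" for n
      using form_inequality[OF E Pz u, of n] by (simp add: BK Ru R_inner)
    moreover have "(\<lambda>n. (norm (R (z n)))\<^sup>2 + 2 * inner (R (z n)) ?w + (norm (P ?w))\<^sup>2 + inner (J2 y) y)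
        \<longlonglongrightarrow> (norm (P ?w - ?w))\<^sup>2 + 2 * inner (P ?w - ?w) ?w + (norm (P ?w))\<^sup>2 + inner (J2 y) y"
      by (intro tendsto_intros Rz)
    ultimately have "0 \<le> (norm (P ?w - ?w))\<^sup>2 + 2 * inner (P ?w - ?w) ?w + (norm (P ?w))\<^sup>2 + inner (J2 y) y"
      by (meson Lim_bounded2)
    also have "\<dots> = inner (J2 y) y - inner (J ?w) ?w"
      using orth_projection_norm[OF P, of ?w]
      by (simp add: J_def PK power2_norm_eq_inner inner_diff_left inner_diff_right inner_commute)
    finally show ?thesis
      using inner_cadjoint[OF Kcl, of y "J ?w"]
      by (simp add: inner_diff_left inner_diff_right inner_commute)
  qed
  ultimately show ?thesis by (simp add: nonneg_op_iff selfadjoint_iff sgn_op_A)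
qed

end

theorem theorem3p1:
  fixes A :: "'a :: chilbert_space \<Rightarrow> 'a"
    and B :: "'a \<Rightarrow> 'b :: chilbert_space"
    and J2 :: "'b \<Rightarrow> 'b"
  assumes "selfadjoint A"
    and "bounded_clinear B"
    and "selfadjoint J2" and "J2 \<circ> J2 = id"
    and "nu_minus A < \<infinity>" and "nu_minus J2 < \<infinity>"
  shows
    "(nu_minus A = nu_minus (\<lambda>x. A x - cadjoint B (J2 (B x))) + nu_minus J2 \<longrightarrow>
        range (cadjoint B) \<subseteq> range (op_sqrt (abs_op A)) \<and>
        (\<exists>!K. K \<in> bounded_ops_into (closure (range A)) \<and> cadjoint B = op_sqrt (abs_op A) \<circ> K) \<and>
        (\<forall>K. K \<in> bounded_ops_into (closure (range A)) \<and> cadjoint B = op_sqrt (abs_op A) \<circ> K \<longrightarrow>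
           nonneg_op (\<lambda>y. J2 y - cadjoint K (sgn_op A (K y)))))
     \<and>
     ((\<exists>K. K \<in> bounded_ops_into (closure (range A)) \<and> cadjoint B = op_sqrt (abs_op A) \<circ> K \<and>
           nonneg_op (\<lambda>y. J2 y - cadjoint K (sgn_op A (K y)))) \<longrightarrow>
        nu_minus A = nu_minus (\<lambda>x. A x - cadjoint B (J2 (B x))) + nu_minus J2)"
proof -
  obtain P b where split: "splits_negative A P" and b: "finite b" "cindependent b" "cspan b = range P"
    "nu_minus A = enat (card b)"
    using nu_minus_finiteE[OF assms(1,5)] .
  interpret schur_setting A P B J2 b
    using assms split b by unfold_locales (auto simp: fun_eq_iff)
  show ?thesis
    unfolding R_def[symmetric] C_def[symmetric]
  proof (intro conjI impI)
    assume E: "nu_minus A = nu_minus C + nu_minus J2"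
    obtain K where K: "K \<in> bounded_ops_into (closure (range A))" "cadjoint B = R \<circ> K"
      using factorization_exists[OF E] .
    show "range (cadjoint B) \<subseteq> range R" unfolding K(2) by auto
    show "\<exists>!K. K \<in> bounded_ops_into (closure (range A)) \<and> cadjoint B = R \<circ> K"
      using K factorization_unique by (intro ex1I[of _ K]) auto
    show "\<forall>K. K \<in> bounded_ops_into (closure (range A)) \<and> cadjoint B = R \<circ> K \<longrightarrow>
        nonneg_op (\<lambda>y. J2 y - cadjoint K (sgn_op A (K y)))"
      using factorization_contractive[OF E] by blast
  next
    assume "\<exists>K. K \<in> bounded_ops_into (closure (range A)) \<and> cadjoint B = R \<circ> K \<and>
        nonneg_op (\<lambda>y. J2 y - cadjoint K (sgn_op A (K y)))"
    then show "nu_minus A = nu_minus C + nu_minus J2"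
      using nu_minus_eq_if_factorization by (auto simp: bounded_ops_into_def)
  qed
qed

end
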